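(* Let $B=B_1\cup B_2\cup B_3$ be a 3C-curve of degree at least $4$, with $b_i=\deg B_i$ and $b_1\leq b_2\leq b_3$, and let $C\in\mathrm{Hyp}(B,2)$. Then $\deg C\leq b_3$ (hence $\deg C\leq\deg B-2$).
   Context: We work over $\mathbb{C}$; a curve is integral if it is reduced and irreducible. A 3C-curve is a reduced plane curve $B=B_1\cup B_2\cup B_3\subset\mathbb{P}^2$ with each $B_i$ integral of degree $b_i\geq 1$, such that for all $i\neq j$ every point of $B_i\cap B_j$ is a node of $B$ (so the components meet only pairwise and transversally); one always assumes $b_1\leq b_2\leq b_3$. For an integral plane curve $C$ let $\nu_C:C^\nu\to C$ be its normalization, and set $$\mathrm{Hyp}(B,2)=\{C\subset\mathbb{P}^2:\ C\text{ integral},\ |\nu_C^{-1}(C\cap B)|\leq 2\}.$$ *)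

theory Defs
  imports "HOL-Analysis.Analysis" "HOL-Algebra.Algebraic_Closure_Type" "HOL-Algebra.QuotRing"
begin

section \<open>Homogeneous forms and points of the complex projective plane\<close>

text \<open>
  The polynomial ring in three variables is the iterated polynomial ring: the first coordinate
  is the innermost variable and the third coordinate is the outermost one.
\<close>

type_synonym poly3 = "complex poly poly poly"

definition exponents :: "poly3 \<Rightarrow> (nat \<times> nat \<times> nat) set" where
  "exponents F =
     {(i, j, k). Polynomial.coeff (Polynomial.coeff (Polynomial.coeff F k) j) i \<noteq> 0}"

definition homogeneous :: "nat \<Rightarrow> poly3 \<Rightarrow> bool" where
  "homogeneous d F \<longleftrightarrow> (\<forall>(i, j, k) \<in> exponents F. i + j + k = d)"

definition total_degree :: "poly3 \<Rightarrow> nat" where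
  "total_degree F = (LEAST d. \<forall>(i, j, k) \<in> exponents F. i + j + k \<le> d)"

definition eval3 :: "poly3 \<Rightarrow> complex ^ 3 \<Rightarrow> complex" where
  "eval3 F v = poly (poly (poly F [:[:v $ 3:]:]) [:v $ 2:]) (v $ 1)"

definition partial_deriv :: "3 \<Rightarrow> poly3 \<Rightarrow> poly3" where
  "partial_deriv i F =
     (if i = 1 then map_poly (map_poly pderiv) F
      else if i = 2 then map_poly pderiv F
      else pderiv F)"

text \<open>A point of the projective plane is a line through the origin of \<open>\<complex>\<^sup>3\<close>.\<close>

type_synonym proj_point = "(complex ^ 3) set"

definition proj_plane :: "proj_point set" where
  "proj_plane = {range (\<lambda>c. c *s v) | v. v \<noteq> 0}"

definition zero_locus :: "poly3 \<Rightarrow> proj_point set" where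
  "zero_locus F = {P \<in> proj_plane. \<forall>v\<in>P. eval3 F v = 0}"


section \<open>Plane curves\<close>

text \<open>
  A plane curve is given by a homogeneous equation, unique up to a nonzero constant; the curve
  is reduced iff the equation is squarefree and integral iff the equation is irreducible.
\<close>

definition integral_curve :: "poly3 \<Rightarrow> bool" where
  "integral_curve F \<longleftrightarrow> homogeneous (total_degree F) F \<and> Factorial_Ring.irreducible F"

text \<open>
  A node is a point of multiplicity two with two distinct tangents: the equation vanishes there
  together with its gradient, and the second-order term of its Taylor expansion at a
  representative \<open>v\<close> is a product of two independent linear forms. By Euler's relations the two
  forms vanish at \<open>v\<close> itself, so that they define two distinct lines through the point.
\<close>

definition is_node :: "poly3 \<Rightarrow> proj_point \<Rightarrow> bool" where
  "is_node F P \<longleftrightarrow> P \<in> proj_plane \<and>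
     (\<exists>v\<in>P. v \<noteq> 0 \<and> eval3 F v = 0 \<and> (\<forall>i. eval3 (partial_deriv i F) v = 0) \<and>
        (\<exists>a b :: complex ^ 3. a \<noteq> b \<and> vec.independent {a, b} \<and>
           (\<forall>w. (\<Sum>i\<in>UNIV. \<Sum>j\<in>UNIV.
                    eval3 (partial_deriv i (partial_deriv j F)) v * w $ i * w $ j) / 2
                = (\<Sum>i\<in>UNIV. a $ i * w $ i) * (\<Sum>i\<in>UNIV. b $ i * w $ i))))"

definition three_C_curve :: "poly3 \<Rightarrow> poly3 \<Rightarrow> poly3 \<Rightarrow> bool" where
  "three_C_curve B1 B2 B3 \<longleftrightarrow>
     integral_curve B1 \<and> integral_curve B2 \<and> integral_curve B3 \<and>
     squarefree (B1 * B2 * B3) \<and>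
     (\<forall>P \<in> (zero_locus B1 \<inter> zero_locus B2) \<union> (zero_locus B1 \<inter> zero_locus B3) \<union>
            (zero_locus B2 \<inter> zero_locus B3). is_node (B1 * B2 * B3) P)"


section \<open>Function field and normalization of an integral plane curve\<close>

text \<open>
  The local ring of the plane at the generic point of the curve \<open>F = 0\<close>, as a subring of the
  fraction field of the polynomial ring, and its maximal ideal. Its residue field is the
  function field of the curve.
\<close>

definition generic_local_ring :: "poly3 \<Rightarrow> poly3 fract ring" where
  "generic_local_ring F = ring_of_type_algebra
     \<lparr>carrier := {Fract G H | G H d. homogeneous d G \<and> homogeneous d H \<and> \<not> F dvd H}\<rparr>"

definition generic_max_ideal :: "poly3 \<Rightarrow> poly3 fract set" where
  "generic_max_ideal F =
     {Fract G H | G H d. homogeneous d G \<and> homogeneous d H \<and> \<not> F dvd H \<and> F dvd G}"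

definition function_field :: "poly3 \<Rightarrow> poly3 fract set ring" where
  "function_field F = generic_local_ring F Quot generic_max_ideal F"

definition curve_local_ring :: "poly3 \<Rightarrow> proj_point \<Rightarrow> poly3 fract set set" where
  "curve_local_ring F P =
     {generic_max_ideal F +>\<^bsub>generic_local_ring F\<^esub> Fract G H | G H d.
        homogeneous d G \<and> homogeneous d H \<and> (\<exists>v\<in>P. eval3 H v \<noteq> 0)}"

definition integral_closure :: "('a, 'b) ring_scheme \<Rightarrow> 'a set \<Rightarrow> 'a set" where
  "integral_closure K A = {z \<in> carrier K. \<exists>n a. (\<forall>i<n::nat. a i \<in> A) \<and>
     z [^]\<^bsub>K\<^esub> n \<oplus>\<^bsub>K\<^esub> (\<Oplus>\<^bsub>K\<^esub>i\<in>{..<n}. a i \<otimes>\<^bsub>K\<^esub> z [^]\<^bsub>K\<^esub> i) = \<zero>\<^bsub>K\<^esub>}"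

text \<open>
  Normalization commutes with localization, so its fibre over a point \<open>P\<close> of the curve is the
  set of maximal ideals of the integral closure, in the function field, of the local ring
  at \<open>P\<close>. The (closed) points of the normalization are therefore the pairs \<open>(P, M)\<close> below, and
  the normalization map is the first projection.
\<close>

definition normalization :: "poly3 \<Rightarrow> (proj_point \<times> poly3 fract set set) set" where
  "normalization F = {(P, M). P \<in> zero_locus F \<and>
     maximalideal M ((function_field F)
       \<lparr>carrier := integral_closure (function_field F) (curve_local_ring F P)\<rparr>)}"

definition normalization_preimage ::
    "poly3 \<Rightarrow> proj_point set \<Rightarrow> (proj_point \<times> poly3 fract set set) set" where
  "normalization_preimage F S = {x \<in> normalization F. fst x \<in> S}"

definition Hyp :: "poly3 \<Rightarrow> nat \<Rightarrow> poly3 set" where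
  "Hyp B n = {F. integral_curve F \<and>
     finite (normalization_preimage F (zero_locus F \<inter> zero_locus B)) \<and>
     card (normalization_preimage F (zero_locus F \<inter> zero_locus B)) \<le> n}"

end

theory Submission
  imports Defs "Jordan_Normal_Form.Char_Poly" "HOL-Computational_Algebra.Polynomial_Factorial"
begin

text \<open>
  Project \<open>C\<close> from a point off \<open>C\<close>. The Puiseux branches of \<open>C\<close> centred at a point define valuations, and branches with the same maximal ideal in the normalization
  have the same valuation. As \<open>B\<close> has no triple points, \<open>C\<close> (unless it is a component of \<open>B\<close> or a line)
  meets \<open>B\<close> in exactly two points \<open>P\<close> and \<open>Q\<close>, each with a single place. A component that meets \<open>C\<close> at
  only one of them has contact with \<open>C\<close> there exceeding that of a generic line, so by transversality two
  such components cannot meet \<open>C\<close> at the same point; hence one component \<open>B\<^sub>j\<close> passes through both \<open>P\<close>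
  and \<open>Q\<close>, and by Bezout it is the line \<open>PQ\<close>, with multiplicities \<open>m\<close> and \<open>n\<close> of \<open>C\<close> at \<open>P\<close> and \<open>Q\<close> adding up
  to \<open>d\<close>. Intersecting \<open>C\<close> with its polar at \<open>P\<close> gives \<open>(m - 1) (b\<^sub>i - 1) + (n - 1) (b\<^sub>k - 1) = 0\<close>. Either
  \<open>m = n = 1\<close> and \<open>d = 2\<close>, or \<open>b\<^sub>i = 1\<close> and \<open>n = 1\<close>. In the second case the polar is a multiple of the
  \<open>(d - 1)\<close>-st power of the line \<open>B\<^sub>i\<close>, so \<open>C\<close> is the graph \<open>w = W(t)\<close> of a polynomial of degree \<open>d\<close> off \<open>B\<^sub>i\<close>;
  the equation of \<open>B\<^sub>k\<close> restricted to it is a monomial, and comparing coefficients rules out \<open>d > b\<^sub>k\<close>.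
\<close>

text \<open>Two facts link the normalization to the branches: every point of \<open>C\<close> has a
  point above it, and Puiseux roots with the same centre and maximal ideal give each form the same
  order. The projection centre lies on the line PQ, off \<open>C\<close>: then P and Q are both over
  t = 0, and one list of roots, power series in X with t = X^N, sees both. All orders are scaled by
  N. A generic line has contact at most N with a root, whereas a component of degree b that meets
  \<open>C\<close> at P only has contact N*d*b/m > N, because m < d. The polar at P is useful
  because the derivative of the equation towards the projection centre is, on a root, a constant
  times the product of its differences with the other roots, and Euler's relation carries this over
  to the polar. Roots in high contact with a component transversal to PQ are close to each other,
  which makes the polar vanish to high order, while Bezout allows d*(d - 1) in all. In the final
  comparison the monomial is \<beta>*(\<alpha>*t^d)^b and agrees with \<beta>*W^b up to degree (b -
  1)*d + 1, which forces W = \<alpha>*t^d + s*t; the coefficient of t^d then contradicts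
  transversality at Q.\<close>

hide_const (open) UnivPoly.up_ring.coeff UnivPoly.up_ring.monom Module.module.smult Divisibility.irreducible
  Polynomials.degree Polynomials.lead_coeff
hide_const (open) Determinant.det Matrix.mat Matrix.vec
no_notation Matrix.vec_index (infixl "$" 100)
no_notation fps_nth (infixl "$" 75)

subsection \<open>Evaluation of forms in commutative algebras\<close>

text \<open>The coefficient map \<open>\<iota>\<close> is a parameter so that one evaluation covers
  complex points, polynomial parametrizations, power series along a branch and substitution into
  \<open>poly3\<close> itself.\<close>

definition ev1 :: "(complex \<Rightarrow> 'r::comm_ring_1) \<Rightarrow> 'r \<Rightarrow> complex poly \<Rightarrow> 'r" where
  "ev1 \<iota> x f = poly (map_poly \<iota> f) x"

definition ev2 :: "(complex \<Rightarrow> 'r::comm_ring_1) \<Rightarrow> 'r \<Rightarrow> 'r \<Rightarrow> complex poly poly \<Rightarrow> 'r" where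
  "ev2 \<iota> x y f = poly (map_poly (ev1 \<iota> x) f) y"

definition ev3 :: "(complex \<Rightarrow> 'r::comm_ring_1) \<Rightarrow> 'r \<Rightarrow> 'r \<Rightarrow> 'r \<Rightarrow> poly3 \<Rightarrow> 'r" where
  "ev3 \<iota> x y z f = poly (map_poly (ev2 \<iota> x y) f) z"

lemma comm_ring_hom_poly_map_poly:
  assumes "comm_ring_hom h" shows "comm_ring_hom (\<lambda>p. poly (map_poly h p) x)"
proof -
  interpret h: comm_ring_hom h by fact
  interpret m: map_poly_comm_ring_hom h ..
  show ?thesis by unfold_locales (simp_all add: m.hom_add m.hom_mult)
qed

lemma ev1_hom: "comm_ring_hom \<iota> \<Longrightarrow> comm_ring_hom (ev1 \<iota> x)"
  using comm_ring_hom_poly_map_poly unfolding ev1_def[abs_def] by blast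
lemma ev2_hom: "comm_ring_hom \<iota> \<Longrightarrow> comm_ring_hom (ev2 \<iota> x y)"
  using comm_ring_hom_poly_map_poly[OF ev1_hom] unfolding ev2_def[abs_def] by blast
lemma ev3_hom: "comm_ring_hom \<iota> \<Longrightarrow> comm_ring_hom (ev3 \<iota> x y z)"
  using comm_ring_hom_poly_map_poly[OF ev2_hom] unfolding ev3_def[abs_def] by blast

definition X1 :: poly3 where "X1 = [:[:[:0,1:]:]:]"
definition X2 :: poly3 where "X2 = [:[:0,1:]:]"
definition X3 :: poly3 where "X3 = [:0,1:]"
definition K3 :: "complex \<Rightarrow> poly3" where "K3 c = [:[:[:c:]:]:]"

lemma map_poly_hom_pCons: "comm_ring_hom h \<Longrightarrow> map_poly h (pCons a p) = pCons (h a) (map_poly h p)"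
proof -
  assume "comm_ring_hom h" then interpret h: comm_ring_hom h .
  show ?thesis by (cases "a = 0 \<and> p = 0") (simp_all add: map_poly_pCons)
qed

lemma ev_simps:
  assumes "comm_ring_hom \<iota>"
  shows "ev1 \<iota> x [:c:] = \<iota> c" "ev1 \<iota> x [:0,1:] = x"
   "ev2 \<iota> x y [:f:] = ev1 \<iota> x f" "ev2 \<iota> x y [:0,1:] = y"
   "ev3 \<iota> x y z [:g:] = ev2 \<iota> x y g" "ev3 \<iota> x y z [:0,1:] = z"
   "ev3 \<iota> x y z X1 = x" "ev3 \<iota> x y z X2 = y" "ev3 \<iota> x y z X3 = z" "ev3 \<iota> x y z (K3 c) = \<iota> c"
proof -
  interpret i: comm_ring_hom \<iota> by fact
  interpret e1: comm_ring_hom "ev1 \<iota> x" by (rule ev1_hom[OF assms])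
  interpret e2: comm_ring_hom "ev2 \<iota> x y" by (rule ev2_hom[OF assms])
  interpret e3: comm_ring_hom "ev3 \<iota> x y z" by (rule ev3_hom[OF assms])
  have 1: "ev1 \<iota> x [:c:] = \<iota> c" for c by (simp add: ev1_def map_poly_hom_pCons[OF assms])
  have 2: "ev1 \<iota> x [:0,1:] = x" by (simp add: ev1_def map_poly_hom_pCons[OF assms])
  have 3: "ev2 \<iota> x y [:f:] = ev1 \<iota> x f" for f by (simp add: ev2_def map_poly_hom_pCons[OF ev1_hom[OF assms]])
  have 4: "ev2 \<iota> x y [:0,1:] = y" by (simp add: ev2_def map_poly_hom_pCons[OF ev1_hom[OF assms]])
  have 5: "ev3 \<iota> x y z [:g:] = ev2 \<iota> x y g" for g by (simp add: ev3_def map_poly_hom_pCons[OF ev2_hom[OF assms]])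
  have 6: "ev3 \<iota> x y z [:0,1:] = z" by (simp add: ev3_def map_poly_hom_pCons[OF ev2_hom[OF assms]])
  show "ev1 \<iota> x [:c:] = \<iota> c" "ev1 \<iota> x [:0,1:] = x"
   "ev2 \<iota> x y [:f:] = ev1 \<iota> x f" "ev2 \<iota> x y [:0,1:] = y"
   "ev3 \<iota> x y z [:g:] = ev2 \<iota> x y g" "ev3 \<iota> x y z [:0,1:] = z"
   "ev3 \<iota> x y z X1 = x" "ev3 \<iota> x y z X2 = y" "ev3 \<iota> x y z X3 = z" "ev3 \<iota> x y z (K3 c) = \<iota> c"
    by (simp_all only: 1 2 3 4 5 6 X1_def X2_def X3_def K3_def)
qed

text \<open>The constants and the three coordinates generate the ring, so a property closed under
  sums and products need only be checked on them; this bypasses the nesting of the polynomial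
  types.\<close>

lemma poly3_induct [case_names const X1 X2 X3 add mult]:
  assumes "\<And>c. P (K3 c)" "P X1" "P X2" "P X3"
    and add: "\<And>F G. P F \<Longrightarrow> P G \<Longrightarrow> P (F + G)" and mult: "\<And>F G. P F \<Longrightarrow> P G \<Longrightarrow> P (F * G)"
  shows "P F"
proof -
  have z: "P 0" using assms(1)[of 0] by (simp add: K3_def)
  have 1: "P [:[:f:]:]" for f
  proof (induction f)
    case 0 then show ?case using z by simp
  next
    case (pCons a f)
    have "[:[:pCons a f:]:] = K3 a + X1 * [:[:f:]:]" by (simp add: K3_def X1_def)
    then show ?case using pCons assms(1,2) add mult by metis
  qed
  have 2: "P [:f:]" for f
  proof (induction f)
    case 0 then show ?case using z by simp
  next
    case (pCons a f)
    have "[:pCons a f:] = [:[:a:]:] + X2 * [:f:]" by (simp add: X2_def)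
    then show ?case using pCons 1 assms(3) add mult by metis
  qed
  show ?thesis
  proof (induction F)
    case 0 then show ?case using z by simp
  next
    case (pCons a f)
    have "pCons a f = [:a:] + X3 * f" by (simp add: X3_def)
    then show ?case using pCons 2 assms(4) add mult by metis
  qed
qed

lemma poly3_hom_eqI:
  assumes "comm_ring_hom f" "comm_ring_hom g" "\<And>c. f (K3 c) = g (K3 c)" "f X1 = g X1" "f X2 = g X2" "f X3 = g X3"
  shows "f F = g F"
proof -
  interpret f: comm_ring_hom f by fact
  interpret g: comm_ring_hom g by fact
  show ?thesis by (induction F rule: poly3_induct) (simp_all add: assms f.hom_add g.hom_add f.hom_mult g.hom_mult)
qed

lemma comm_ring_hom_comp: "comm_ring_hom f \<Longrightarrow> comm_ring_hom g \<Longrightarrow> comm_ring_hom (\<lambda>x. f (g x))"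
proof -
  assume "comm_ring_hom f" "comm_ring_hom g"
  then interpret f: comm_ring_hom f + g: comm_ring_hom g by simp_all
  show ?thesis by unfold_locales (simp_all add: g.hom_add f.hom_add g.hom_mult f.hom_mult)
qed

text \<open>Base change: both sides are homomorphisms in \<open>F\<close> that agree on the
  generators. It is the step behind every specialization, such as setting the branch parameter to
  0.\<close>

lemma hom_ev3:
  assumes "comm_ring_hom \<iota>" "comm_ring_hom \<phi>"
  shows "\<phi> (ev3 \<iota> x y z F) = ev3 (\<lambda>c. \<phi> (\<iota> c)) (\<phi> x) (\<phi> y) (\<phi> z) F"
  by (rule poly3_hom_eqI) (simp_all add: comm_ring_hom_comp ev3_hom assms ev_simps)

lemma hom_ev2:
  assumes "comm_ring_hom \<iota>" "comm_ring_hom \<phi>"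
  shows "\<phi> (ev2 \<iota> x y f) = ev2 (\<lambda>c. \<phi> (\<iota> c)) (\<phi> x) (\<phi> y) f"
  using hom_ev3[OF assms, of x y 0 "[:f:]"] by (simp add: ev_simps assms comm_ring_hom_comp)

lemma comm_ring_hom_id: "comm_ring_hom (\<lambda>x::'a::comm_ring_1. x)" by unfold_locales auto

lemma eval3_ev3: "eval3 F v = ev3 (\<lambda>c. c) (v $ 1) (v $ 2) (v $ 3) F"
proof (rule poly3_hom_eqI)
  show "comm_ring_hom (\<lambda>a. eval3 a v)" by unfold_locales (simp_all add: eval3_def)
  show "comm_ring_hom (ev3 (\<lambda>c. c) (v $ 1) (v $ 2) (v $ 3))" by (rule ev3_hom[OF comm_ring_hom_id])
qed (simp_all add: ev_simps[OF comm_ring_hom_id] eval3_def X1_def X2_def X3_def K3_def)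

lemma comm_ring_hom_K3: "comm_ring_hom K3" by unfold_locales (simp_all add: K3_def one_pCons)
lemma comm_ring_hom_const_poly: "comm_ring_hom h \<Longrightarrow> comm_ring_hom (\<lambda>c. [:h c:])"
proof -
  assume "comm_ring_hom h" then interpret h: comm_ring_hom h .
  show ?thesis by unfold_locales (simp_all add: h.hom_add h.hom_mult one_pCons)
qed
lemma comm_ring_hom_fps_const: "comm_ring_hom (fps_const :: 'a::comm_ring_1 \<Rightarrow> _)"
  by unfold_locales (simp_all)

lemma ev3_K3_X: "ev3 K3 X1 X2 X3 F = F"
  by (rule poly3_hom_eqI[OF ev3_hom[OF comm_ring_hom_K3] comm_ring_hom_id]) (simp_all add: ev_simps[OF comm_ring_hom_K3])

subsection \<open>Expansion into monomials\<close>

definition coeff3 :: "poly3 \<Rightarrow> nat \<times> nat \<times> nat \<Rightarrow> complex" where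
  "coeff3 F = (\<lambda>(i,j,k). coeff (coeff (coeff F k) j) i)"

lemma exponents_eq: "exponents F = {e. coeff3 F e \<noteq> 0}"
  by (auto simp: exponents_def coeff3_def)

lemma finite_exponents: "finite (exponents F)"
proof -
  have "exponents F \<subseteq> (\<Union>k\<le>degree F. \<Union>j\<le>degree (coeff F k). \<Union>i\<le>degree (coeff (coeff F k) j). {(i,j,k)})"
  proof
    fix e assume e: "e \<in> exponents F"
    obtain i j k where "e = (i,j,k)" by (cases e)
    with e have 1: "coeff (coeff (coeff F k) j) i \<noteq> 0" by (simp add: exponents_def)
    then have "i \<le> degree (coeff (coeff F k) j)" by (rule le_degree)
    moreover from 1 have 2: "coeff (coeff F k) j \<noteq> 0" by auto
    then have "j \<le> degree (coeff F k)" by (rule le_degree)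
    moreover from 2 have "coeff F k \<noteq> 0" by auto
    then have "k \<le> degree F" by (rule le_degree)
    ultimately show "e \<in> (\<Union>k\<le>degree F. \<Union>j\<le>degree (coeff F k). \<Union>i\<le>degree (coeff (coeff F k) j). {(i,j,k)})"
      using \<open>e = _\<close> by auto
  qed
  then show ?thesis by (rule finite_subset) auto
qed

definition mono3 :: "complex \<Rightarrow> nat \<times> nat \<times> nat \<Rightarrow> poly3" where
  "mono3 c = (\<lambda>(i,j,k). K3 c * X1 ^ i * X2 ^ j * X3 ^ k)"

lemma mono3_monom: "mono3 c (i,j,k) = monom (monom (monom c i) j) k"
proof -
  have a: "X1 ^ i = [:[:monom 1 i:]:]" by (simp add: X1_def poly_const_pow monom_altdef)
  have b: "X2 ^ j = [:monom 1 j:]" by (simp add: X2_def poly_const_pow monom_altdef)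
  have c: "X3 ^ k = monom 1 k" by (simp add: X3_def monom_altdef)
  show ?thesis by (simp add: mono3_def a b c K3_def smult_monom)
qed

lemma coeff3_mono3: "coeff3 (mono3 c e) e' = (if e = e' then c else 0)"
  by (cases e; cases e') (auto simp: mono3_monom coeff3_def)

lemma coeff3_add: "coeff3 (F + G) e = coeff3 F e + coeff3 G e" by (cases e) (simp add: coeff3_def)
lemma coeff3_0: "coeff3 0 e = 0" by (cases e) (simp add: coeff3_def)
lemma coeff3_sum: "coeff3 (sum f A) e = (\<Sum>a\<in>A. coeff3 (f a) e)"
  by (induction A rule: infinite_finite_induct) (simp_all add: coeff3_add coeff3_0)
lemma coeff3_eqI: "(\<And>e. coeff3 F e = coeff3 G e) \<Longrightarrow> F = G"
  by (intro poly_eqI) (metis coeff3_def case_prod_conv)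

lemma mono3_expansion: "F = (\<Sum>e\<in>exponents F. mono3 (coeff3 F e) e)"
proof (rule coeff3_eqI)
  fix e show "coeff3 F e = coeff3 (\<Sum>e\<in>exponents F. mono3 (coeff3 F e) e) e"
    using finite_exponents[of F] by (simp add: coeff3_sum coeff3_mono3 exponents_eq)
qed

lemma ev3_mono3: assumes "comm_ring_hom \<iota>" shows "ev3 \<iota> x y z (mono3 c (i,j,k)) = \<iota> c * x^i * y^j * z^k"
proof -
  interpret e3: comm_ring_hom "ev3 \<iota> x y z" by (rule ev3_hom[OF assms])
  show ?thesis by (simp add: mono3_def e3.hom_mult e3.hom_power ev_simps[OF assms])
qed

lemma ev3_expand: assumes "comm_ring_hom \<iota>"
  shows "ev3 \<iota> x y z F = (\<Sum>(i,j,k)\<in>exponents F. \<iota> (coeff3 F (i,j,k)) * x^i * y^j * z^k)"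
proof -
  interpret e3: comm_ring_hom "ev3 \<iota> x y z" by (rule ev3_hom[OF assms])
  show ?thesis by (subst mono3_expansion[of F], unfold e3.hom_sum, rule sum.cong[OF refl])
    (auto simp: ev3_mono3[OF assms])
qed

lemma ev3_scale: assumes "comm_ring_hom \<iota>" "homogeneous d F"
  shows "ev3 \<iota> (t*x) (t*y) (t*z) F = t^d * ev3 \<iota> x y z F"
  unfolding ev3_expand[OF assms(1)] sum_distrib_left
proof (rule sum.cong[OF refl], safe)
  fix i j k assume "(i,j,k) \<in> exponents F"
  then have "d = i+j+k" using assms(2) by (auto simp: homogeneous_def)
  then show "\<iota> (coeff3 F (i, j, k)) * (t * x) ^ i * (t * y) ^ j * (t * z) ^ k =
       t ^ d * (\<iota> (coeff3 F (i, j, k)) * x ^ i * y ^ j * z ^ k)"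
    by (simp add: power_add power_mult_distrib algebra_simps)
qed

lemma coeff3_mult: "coeff3 (F * G) (i,j,k) =
   (\<Sum>k'\<le>k. \<Sum>j'\<le>j. \<Sum>i'\<le>i. coeff3 F (i',j',k') * coeff3 G (i-i',j-j',k-k'))"
  by (simp add: coeff3_def coeff_mult coeff_sum)

lemma homogeneous_iff: "homogeneous d F \<longleftrightarrow> (\<forall>i j k. coeff3 F (i,j,k) \<noteq> 0 \<longrightarrow> i + j + k = d)"
  by (auto simp: homogeneous_def exponents_eq)

lemma homogeneous_mult:
  assumes "homogeneous d F" "homogeneous e G" shows "homogeneous (d + e) (F * G)"
  unfolding homogeneous_iff
proof (intro allI impI)
  fix i j k assume "coeff3 (F * G) (i,j,k) \<noteq> 0"
  then obtain k' where k: "k' \<le> k" "(\<Sum>j'\<le>j. \<Sum>i'\<le>i. coeff3 F (i',j',k') * coeff3 G (i-i',j-j',k-k')) \<noteq> 0"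
    unfolding coeff3_mult by (metis (no_types, lifting) atMost_iff sum.neutral)
  then obtain j' where j: "j' \<le> j" "(\<Sum>i'\<le>i. coeff3 F (i',j',k') * coeff3 G (i-i',j-j',k-k')) \<noteq> 0"
    by (metis (no_types, lifting) atMost_iff sum.neutral)
  then obtain i' where i: "i' \<le> i" "coeff3 F (i',j',k') * coeff3 G (i-i',j-j',k-k') \<noteq> 0"
    by (metis (no_types, lifting) atMost_iff sum.neutral)
  then have "coeff3 F (i',j',k') \<noteq> 0" "coeff3 G (i-i',j-j',k-k') \<noteq> 0" by auto
  then have "i' + j' + k' = d" "i-i' + (j-j') + (k-k') = e" using assms unfolding homogeneous_iff by blast+
  then show "i + j + k = d + e" using k(1) j(1) i(1) by linarith
qed

lemma homogeneous_add: "homogeneous d F \<Longrightarrow> homogeneous d G \<Longrightarrow> homogeneous d (F + G)"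
  unfolding homogeneous_iff by (metis coeff3_add add_0)
lemma homogeneous_0: "homogeneous d 0" by (simp add: homogeneous_iff coeff3_0)
lemma homogeneous_mono3: "homogeneous (i+j+k) (mono3 c (i,j,k))"
  by (auto simp: homogeneous_iff coeff3_mono3 split: if_splits)
lemma homogeneous_K3: "homogeneous 0 (K3 c)" using homogeneous_mono3[of 0 0 0 c] by (simp add: mono3_def)
lemma K3_1: "K3 1 = 1" by (simp add: K3_def one_pCons)
lemma homogeneous_X: "homogeneous 1 X1" "homogeneous 1 X2" "homogeneous 1 X3"
  using homogeneous_mono3[of 1 0 0 1] homogeneous_mono3[of 0 1 0 1] homogeneous_mono3[of 0 0 1 1]
  by (simp_all add: mono3_def K3_1)
lemma homogeneous_1: "homogeneous 0 1" using homogeneous_K3[of 1] by (simp add: K3_1)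
lemma homogeneous_K3_mult: "homogeneous d F \<Longrightarrow> homogeneous d (K3 c * F)"
  using homogeneous_mult[OF homogeneous_K3, of d F c] by simp
lemma homogeneous_uminus: "homogeneous d F \<Longrightarrow> homogeneous d (- F)"
proof -
  assume F: "homogeneous d F"
  have "K3 (-1) = -1" by (simp add: K3_def one_pCons)
  then show ?thesis using homogeneous_K3_mult[OF F, of "-1"] by simp
qed
lemma homogeneous_diff: "homogeneous d F \<Longrightarrow> homogeneous d G \<Longrightarrow> homogeneous d (F - G)"
  using homogeneous_add[OF _ homogeneous_uminus, of d F G] by simp
lemma homogeneous_power: "homogeneous d F \<Longrightarrow> homogeneous (n * d) (F ^ n)"
  by (induction n) (use homogeneous_1 homogeneous_mult in auto)

lemma total_degree_eq:
  assumes "homogeneous d F" "F \<noteq> 0" shows "total_degree F = d"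
proof -
  obtain i j k where e: "(i,j,k) \<in> exponents F"
    using assms(2) coeff3_eqI[of F 0] by (auto simp: exponents_eq coeff3_0)
  then have "i + j + k = d" using assms(1) by (auto simp: homogeneous_def)
  show ?thesis unfolding total_degree_def
  proof (rule Least_equality)
    show "\<forall>(i, j, k)\<in>exponents F. i + j + k \<le> d" using assms(1) by (auto simp: homogeneous_def)
    fix y assume "\<forall>(i, j, k)\<in>exponents F. i + j + k \<le> y"
    then show "d \<le> y" using e \<open>i + j + k = d\<close> by auto
  qed
qed

subsection \<open>Derivations\<close>

text \<open>Constants are not mentioned, because the base ring varies; the chain rule asks
  separately that \<open>D\<close> kills the image of \<open>\<iota>\<close>.\<close>

definition derivation :: "('a::comm_ring_1 \<Rightarrow> 'a) \<Rightarrow> bool" where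
  "derivation D \<longleftrightarrow> (\<forall>x y. D (x + y) = D x + D y) \<and> (\<forall>x y. D (x * y) = D x * y + x * D y)"

lemma derivation_add: "derivation D \<Longrightarrow> D (x + y) = D x + D y"
  and derivation_mult: "derivation D \<Longrightarrow> D (x * y) = D x * y + x * D y"
  by (simp_all add: derivation_def)
lemma derivation_0: "derivation D \<Longrightarrow> D 0 = 0"
  using derivation_add[of D 0 0] by simp
lemma derivation_sum: "derivation D \<Longrightarrow> D (sum f A) = (\<Sum>a\<in>A. D (f a))"
  by (induction A rule: infinite_finite_induct) (simp_all add: derivation_0 derivation_add)

lemma derivation_map_poly:
  assumes "derivation D" shows "derivation (map_poly D)"
  unfolding derivation_def
proof (intro conjI allI)
  fix p q :: "'a poly"
  show "map_poly D (p + q) = map_poly D p + map_poly D q"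
    by (rule poly_eqI) (simp add: coeff_map_poly derivation_0[OF assms] derivation_add[OF assms])
  show "map_poly D (p * q) = map_poly D p * q + p * map_poly D q"
    by (rule poly_eqI) (simp add: coeff_map_poly coeff_mult derivation_0[OF assms] derivation_sum[OF assms]
      derivation_mult[OF assms] sum.distrib)
qed

lemma derivation_pderiv: "derivation (pderiv :: 'a::idom poly \<Rightarrow> _)"
  unfolding derivation_def by (simp add: pderiv_add pderiv_mult algebra_simps)

lemma derivation_fps_deriv: "derivation (fps_deriv :: 'a::idom fps \<Rightarrow> _)"
  unfolding derivation_def by (simp add: algebra_simps)

lemma three_cases: "(i::3) = 1 \<or> i = 2 \<or> i = 3" using exhaust_3 by blast
lemma derivation_partial_deriv: "derivation (partial_deriv i)"
  using three_cases[of i]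
  by (auto simp: partial_deriv_def[abs_def] derivation_pderiv derivation_map_poly)

lemma partial_deriv_simps:
  "partial_deriv i (K3 c) = 0"
  "partial_deriv i X1 = (if i = 1 then 1 else 0)"
  "partial_deriv i X2 = (if i = 2 then 1 else 0)"
  "partial_deriv i X3 = (if i = 3 then 1 else 0)"
  using three_cases[of i]
  by (cases "c = 0", auto simp: partial_deriv_def K3_def X1_def X2_def X3_def map_poly_pCons pderiv_pCons one_pCons)

lemma partial_deriv_homogeneous:
  assumes "homogeneous d F" shows "homogeneous (d - 1) (partial_deriv i F)"
proof -
  have 1: "coeff3 (partial_deriv 1 F) (i,j,k) = of_nat (Suc i) * coeff3 F (Suc i,j,k)" for i j k
    by (simp add: coeff3_def partial_deriv_def coeff_map_poly coeff_pderiv)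
  have 2: "coeff3 (partial_deriv 2 F) (i,j,k) = of_nat (Suc j) * coeff3 F (i,Suc j,k)" for i j k
    by (simp add: coeff3_def partial_deriv_def coeff_map_poly coeff_pderiv of_nat_poly flip: of_nat_Suc)
  have 3: "coeff3 (partial_deriv 3 F) (i,j,k) = of_nat (Suc k) * coeff3 F (i,j,Suc k)" for i j k
    by (simp add: coeff3_def partial_deriv_def coeff_pderiv of_nat_poly flip: of_nat_Suc)
  show ?thesis using assms three_cases[of i] unfolding homogeneous_iff
    by (fastforce simp: 1 2 3 simp del: of_nat_Suc)
qed

text \<open>Both sides are additive in \<open>F\<close> and satisfy the same Leibniz rule, so the
  generators decide. It is applied to \<open>fps_deriv\<close> along a branch and to
  \<open>pderiv\<close> along a line.\<close>

lemma chain_rule_ev3: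
  assumes D: "derivation D" and i: "comm_ring_hom \<iota>" and "\<And>c. D (\<iota> c) = 0"
  shows "D (ev3 \<iota> x y z F) = D x * ev3 \<iota> x y z (partial_deriv 1 F) + D y * ev3 \<iota> x y z (partial_deriv 2 F)
     + D z * ev3 \<iota> x y z (partial_deriv 3 F)"
proof -
  interpret e3: comm_ring_hom "ev3 \<iota> x y z" by (rule ev3_hom[OF i])
  show ?thesis
    by (induction F rule: poly3_induct)
      (simp_all add: ev_simps[OF i] assms partial_deriv_simps derivation_add[OF D] derivation_mult[OF D]
       e3.hom_add e3.hom_mult derivation_add[OF derivation_partial_deriv] derivation_mult[OF derivation_partial_deriv]
       algebra_simps)
qed

text \<open>First-order Taylor expansion modulo the square of a common divisor \<open>u\<close> of
  the increments. Stated by divisibility it is stable under products, since the product of two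
  linear terms is a multiple of u^2, and no higher derivatives appear.\<close>

lemma taylor_ev3:
  assumes i: "comm_ring_hom \<iota>" and u: "u dvd a" "u dvd b" "u dvd c"
  shows "u\<^sup>2 dvd ev3 \<iota> (x+a) (y+b) (z+c) F - ev3 \<iota> x y z F
     - (a * ev3 \<iota> x y z (partial_deriv 1 F) + b * ev3 \<iota> x y z (partial_deriv 2 F) + c * ev3 \<iota> x y z (partial_deriv 3 F))"
proof -
  interpret e3: comm_ring_hom "ev3 \<iota> x y z" by (rule ev3_hom[OF i])
  interpret e3': comm_ring_hom "ev3 \<iota> (x+a) (y+b) (z+c)" by (rule ev3_hom[OF i])
  define L where "L F = a * ev3 \<iota> x y z (partial_deriv 1 F) + b * ev3 \<iota> x y z (partial_deriv 2 F) + c * ev3 \<iota> x y z (partial_deriv 3 F)" for F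
  have L: "u dvd L F" for F unfolding L_def using u by (intro dvd_add dvd_mult2) auto
  have Ladd: "L (F + G) = L F + L G" for F G
    by (simp add: L_def e3.hom_add derivation_add[OF derivation_partial_deriv] algebra_simps)
  have Lmult: "L (F * G) = L F * ev3 \<iota> x y z G + ev3 \<iota> x y z F * L G" for F G
    by (simp add: L_def e3.hom_add e3.hom_mult derivation_mult[OF derivation_partial_deriv] algebra_simps)
  have "u\<^sup>2 dvd ev3 \<iota> (x+a) (y+b) (z+c) F - ev3 \<iota> x y z F - L F"
  proof (induction F rule: poly3_induct)
    case (add F G)
    then have "u\<^sup>2 dvd (ev3 \<iota> (x+a) (y+b) (z+c) F - ev3 \<iota> x y z F - L F) + (ev3 \<iota> (x+a) (y+b) (z+c) G - ev3 \<iota> x y z G - L G)"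
      by (rule dvd_add)
    then show ?case unfolding e3.hom_add e3'.hom_add Ladd by (simp add: algebra_simps)
  next
    case (mult F G)
    define f f' g g' where "f = ev3 \<iota> x y z F" and "f' = ev3 \<iota> (x+a) (y+b) (z+c) F"
      and "g = ev3 \<iota> x y z G" and "g' = ev3 \<iota> (x+a) (y+b) (z+c) G"
    obtain r s where rs: "f' - f - L F = u\<^sup>2 * r" "g' - g - L G = u\<^sup>2 * s"
      using mult unfolding f_def g_def f'_def g'_def by (auto simp: dvd_def)
    obtain m n where mn: "L F = u * m" "L G = u * n" using L by (meson dvdE)
    have f': "f' = f + u * m + u\<^sup>2 * r" "g' = g + u * n + u\<^sup>2 * s" using rs mn by (simp_all add: algebra_simps)
    have "f' * g' - f * g - (u * m * g + f * (u * n)) = u\<^sup>2 * (r * g' + m * n + s * f + u * m * s)"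
      unfolding f' by (simp add: algebra_simps power2_eq_square)
    then show ?case
      unfolding e3.hom_mult e3'.hom_mult Lmult mn f_def g_def f'_def g'_def by (metis dvd_triv_left)
  qed (simp_all add: ev_simps[OF i] L_def partial_deriv_simps)
  then show ?thesis unfolding L_def .
qed

text \<open>The Euler operator is a derivation that fixes the coordinates and kills the constants,
  so every monomial is an eigenvector whose eigenvalue is its degree.\<close>

lemma euler:
  assumes "homogeneous d F"
  shows "X1 * partial_deriv 1 F + X2 * partial_deriv 2 F + X3 * partial_deriv 3 F = of_nat d * F"
proof -
  define E where "E F = X1 * partial_deriv 1 F + X2 * partial_deriv 2 F + X3 * partial_deriv 3 F" for F
  have E: "derivation E" unfolding derivation_def E_def
    by (auto simp: derivation_add[OF derivation_partial_deriv] derivation_mult[OF derivation_partial_deriv] algebra_simps)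
  have EX: "E X1 = X1" "E X2 = X2" "E X3 = X3" "E (K3 c) = 0" for c by (simp_all add: E_def partial_deriv_simps)
  have E1: "E 1 = 0" using EX(4)[of 1] by (simp add: K3_1)
  have pow: "E x = x \<Longrightarrow> E (x ^ n) = of_nat n * x ^ n" for x n
    by (induction n) (simp_all add: E1 derivation_mult[OF E] algebra_simps)
  have mono: "E (mono3 c (i,j,k)) = of_nat (i + j + k) * mono3 c (i,j,k)" for c i j k
    by (simp add: mono3_def derivation_mult[OF E] EX pow algebra_simps)
  have "E F = (\<Sum>e\<in>exponents F. E (mono3 (coeff3 F e) e))"
    by (subst mono3_expansion[of F], simp add: derivation_sum[OF E])
  also have "\<dots> = (\<Sum>e\<in>exponents F. of_nat d * mono3 (coeff3 F e) e)"
    using assms by (intro sum.cong) (auto simp: homogeneous_def mono)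
  also have "\<dots> = of_nat d * F" by (simp add: mono3_expansion[of F, symmetric] flip: sum_distrib_left)
  finally show ?thesis unfolding E_def .
qed

lemma euler_ev3:
  assumes "homogeneous d F" "comm_ring_hom \<iota>"
  shows "x * ev3 \<iota> x y z (partial_deriv 1 F) + y * ev3 \<iota> x y z (partial_deriv 2 F) + z * ev3 \<iota> x y z (partial_deriv 3 F)
     = of_nat d * ev3 \<iota> x y z F"
proof -
  interpret e3: comm_ring_hom "ev3 \<iota> x y z" by (rule ev3_hom[OF assms(2)])
  show ?thesis using arg_cong[OF euler[OF assms(1)], of "ev3 \<iota> x y z"]
    by (simp add: e3.hom_add e3.hom_mult ev_simps[OF assms(2)] e3.hom_of_nat)
qed

subsection \<open>Linear changes of coordinates\<close>

definition lin :: "(complex \<Rightarrow> 'r::comm_ring_1) \<Rightarrow> complex^3^3 \<Rightarrow> 'r \<Rightarrow> 'r \<Rightarrow> 'r \<Rightarrow> 3 \<Rightarrow> 'r" where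
  "lin \<iota> A x y z i = \<iota> (A $ i $ 1) * x + \<iota> (A $ i $ 2) * y + \<iota> (A $ i $ 3) * z"

definition lsub :: "complex^3^3 \<Rightarrow> poly3 \<Rightarrow> poly3" where
  "lsub A F = ev3 K3 (lin K3 A X1 X2 X3 1) (lin K3 A X1 X2 X3 2) (lin K3 A X1 X2 X3 3) F"

lemma lsub_hom: "comm_ring_hom (lsub A)"
  unfolding lsub_def[abs_def] by (rule ev3_hom[OF comm_ring_hom_K3])

lemma ev3_lsub:
  assumes "comm_ring_hom \<iota>"
  shows "ev3 \<iota> x y z (lsub A F) = ev3 \<iota> (lin \<iota> A x y z 1) (lin \<iota> A x y z 2) (lin \<iota> A x y z 3) F"
proof -
  interpret e3: comm_ring_hom "ev3 \<iota> x y z" by (rule ev3_hom[OF assms])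
  show ?thesis unfolding lsub_def
    by (subst hom_ev3[OF comm_ring_hom_K3 ev3_hom[OF assms]])
      (simp add: lin_def e3.hom_add e3.hom_mult ev_simps[OF assms])
qed

lemma lin_mult:
  assumes "comm_ring_hom \<iota>"
  shows "lin \<iota> B (lin \<iota> A x y z 1) (lin \<iota> A x y z 2) (lin \<iota> A x y z 3) i = lin \<iota> (B ** A) x y z i"
proof -
  interpret h: comm_ring_hom \<iota> by fact
  show ?thesis by (simp add: lin_def matrix_matrix_mult_def sum_3 h.hom_add h.hom_mult algebra_simps)
qed

lemma lin_mat_1:
  assumes "comm_ring_hom \<iota>"
  shows "lin \<iota> (mat 1) x y z 1 = x" "lin \<iota> (mat 1) x y z 2 = y" "lin \<iota> (mat 1) x y z 3 = z"
proof -
  interpret h: comm_ring_hom \<iota> by fact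
  show "lin \<iota> (mat 1) x y z 1 = x" "lin \<iota> (mat 1) x y z 2 = y" "lin \<iota> (mat 1) x y z 3 = z"
    by (simp_all add: lin_def Finite_Cartesian_Product.mat_def)
qed

text \<open>The value of \<open>lsub A (lsub B F)\<close> at v is that of \<open>F\<close> at B (A
  v), hence the order of the matrix product.\<close>

lemma lsub_lsub:
  assumes "B ** A = mat 1" shows "lsub A (lsub B F) = F"
  unfolding lsub_def[of A]
  by (simp add: ev3_lsub[OF comm_ring_hom_K3] lin_mult[OF comm_ring_hom_K3] assms lin_mat_1[OF comm_ring_hom_K3] ev3_K3_X)

lemma lin_complex: "lin (\<lambda>c. c) A x y z i = (A *v vector [x,y,z]) $ i"
  by (simp add: lin_def matrix_vector_mult_def sum_3)

lemma lsub_irreducible: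
  assumes "B ** A = mat 1" "A ** B = mat 1" "irreducible F" shows "irreducible (lsub A F)"
proof -
  interpret a: comm_ring_hom "lsub A" by (rule lsub_hom)
  interpret b: comm_ring_hom "lsub B" by (rule lsub_hom)
  have unit: "lsub A G dvd 1 \<longleftrightarrow> G dvd 1" for G
    by (metis a.hom_dvd a.hom_one assms(2) b.hom_dvd b.hom_one lsub_lsub)
  show ?thesis
  proof (rule Factorial_Ring.irreducibleI)
    show "lsub A F \<noteq> 0" using assms(3) lsub_lsub[OF assms(2), of F] by (metis b.hom_zero Factorial_Ring.irreducible_def)
    show "\<not> lsub A F dvd 1" using assms(3) unit by (simp add: Factorial_Ring.irreducible_def)
    fix a b assume "lsub A F = a * b"
    then have "F = lsub B a * lsub B b" using lsub_lsub[OF assms(2), of F] by (metis b.hom_mult)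
    then have "lsub B a dvd 1 \<or> lsub B b dvd 1" using assms(3) by (simp add: Factorial_Ring.irreducible_def)
    then show "a dvd 1 \<or> b dvd 1" by (metis lsub_lsub[OF assms(1)] a.hom_dvd a.hom_one)
  qed
qed

lemma lsub_dvd:
  assumes "A ** B = mat 1" "lsub A F dvd lsub A G" shows "F dvd G"
proof -
  interpret b: comm_ring_hom "lsub B" by (rule lsub_hom)
  show ?thesis using b.hom_dvd[OF assms(2)] lsub_lsub[OF assms(1)] by simp
qed

subsection \<open>Norms of polynomials\<close>

text \<open>For monic \<open>p\<close>, the matrix of multiplication by the variable on the residue
  ring modulo \<open>p\<close>, in the basis of powers: column \<open>j\<close> is the image of the
  \<open>j\<close>-th power.\<close>

definition companion :: "'a::comm_ring_1 poly \<Rightarrow> 'a Matrix.mat" where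
  "companion p = Matrix.mat (degree p) (degree p)
     (\<lambda>(i,j). if Suc j = degree p then - coeff p i else if i = Suc j then 1 else 0)"

definition mat_poly :: "'a::comm_ring_1 poly \<Rightarrow> 'a Matrix.mat \<Rightarrow> 'a Matrix.mat" where
  "mat_poly g M = Matrix.mat (dim_row M) (dim_row M) (\<lambda>(i,j). \<Sum>n\<le>degree g. coeff g n * (M ^\<^sub>m n) $$ (i,j))"

text \<open>For monic \<open>p\<close> this is the norm of \<open>g\<close> from the residue ring
  modulo \<open>p\<close>, that is the resultant of \<open>p\<close> and \<open>g\<close>. A
  determinant lives over the base ring and commutes with homomorphisms, so the roots of
  \<open>p\<close> can be taken later, in whichever extension is convenient.\<close>

definition poly_norm :: "'a::comm_ring_1 poly \<Rightarrow> 'a poly \<Rightarrow> 'a" where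
  "poly_norm p g = Determinant.det (mat_poly g (companion p))"

lemma companion_carrier [simp]: "companion p \<in> carrier_mat (degree p) (degree p)"
  by (simp add: companion_def)
lemma mat_poly_carrier: "M \<in> carrier_mat n n \<Longrightarrow> mat_poly g M \<in> carrier_mat n n"
  by (simp add: mat_poly_def)

lemma mat_poly_index:
  assumes "M \<in> carrier_mat n n" "i < n" "j < n" "degree g \<le> m"
  shows "mat_poly g M $$ (i,j) = (\<Sum>k\<le>m. coeff g k * (M ^\<^sub>m k) $$ (i,j))"
proof -
  have "mat_poly g M $$ (i,j) = (\<Sum>k\<le>degree g. coeff g k * (M ^\<^sub>m k) $$ (i,j))"
    using assms(1-3) by (simp add: mat_poly_def)
  also have "\<dots> = (\<Sum>k\<le>m. coeff g k * (M ^\<^sub>m k) $$ (i,j))"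
    using assms(4) by (intro sum.mono_neutral_left) (auto simp: coeff_eq_0)
  finally show ?thesis .
qed

text \<open>Monicity keeps the degree of \<open>p\<close> under \<open>h\<close>, hence the size of
  the companion matrix; the rest is entrywise.\<close>

lemma poly_norm_hom:
  assumes "comm_ring_hom h" "lead_coeff p = 1"
  shows "h (poly_norm p g) = poly_norm (map_poly h p) (map_poly h g)"
proof -
  interpret h: comm_ring_hom h by fact
  have deg: "degree (map_poly h p) = degree p"
  proof (rule antisym[OF degree_map_poly_le])
    have "coeff (map_poly h p) (degree p) = 1" using assms(2) by (simp add: coeff_map_poly)
    then show "degree p \<le> degree (map_poly h p)" by (simp add: le_degree)
  qed
  have c: "companion (map_poly h p) = map_mat h (companion p)"
    by (rule eq_matI) (auto simp: companion_def deg h.hom_uminus)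
  define C where "C = companion p"
  have C: "C \<in> carrier_mat (degree p) (degree p)" by (simp add: C_def)
  have C': "map_mat h C \<in> carrier_mat (degree p) (degree p)" using C by simp
  have pow: "(map_mat h C ^\<^sub>m n) $$ (i,j) = h ((C ^\<^sub>m n) $$ (i,j))" if "i < degree p" "j < degree p" for n i j
    using pow_carrier_mat[OF C, of n] that unfolding h.mat_hom_pow[symmetric, OF C] by (subst index_map_mat(1)) auto
  have "map_mat h (mat_poly g C) = mat_poly (map_poly h g) (map_mat h C)"
  proof (rule eq_matI)
    note carr = mat_poly_carrier[OF C, of g] mat_poly_carrier[OF C', of "map_poly h g"]
    fix i j assume "i < dim_row (mat_poly (map_poly h g) (map_mat h C))" "j < dim_col (mat_poly (map_poly h g) (map_mat h C))"
    then have ij: "i < degree p" "j < degree p" using carr by auto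
    have "map_mat h (mat_poly g C) $$ (i,j) = h (mat_poly g C $$ (i,j))" using ij carr by (subst index_map_mat(1)) auto
    also have "\<dots> = (\<Sum>n\<le>degree g. h (coeff g n) * h ((C ^\<^sub>m n) $$ (i,j)))"
      by (simp add: mat_poly_index[OF C ij order_refl] h.hom_sum h.hom_mult)
    also have "\<dots> = mat_poly (map_poly h g) (map_mat h C) $$ (i,j)"
      by (simp add: mat_poly_index[OF C' ij degree_map_poly_le] pow[OF ij] coeff_map_poly)
    finally show "map_mat h (mat_poly g C) $$ (i,j) = mat_poly (map_poly h g) (map_mat h C) $$ (i,j)" .
  next
    show "dim_row (map_mat h (mat_poly g C)) = dim_row (mat_poly (map_poly h g) (map_mat h C))"
      "dim_col (map_mat h (mat_poly g C)) = dim_col (mat_poly (map_poly h g) (map_mat h C))"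
      by (simp_all add: mat_poly_def)
  qed
  note mp = this
  have "h (poly_norm p g) = Determinant.det (map_mat h (mat_poly g C))"
    unfolding poly_norm_def C_def by (rule h.hom_det[symmetric])
  also have "\<dots> = poly_norm (map_poly h p) (map_poly h g)"
    unfolding mp poly_norm_def c C_def[symmetric] by (rule refl)
  finally show ?thesis .
qed

lemma pow_mat_intertwine:
  assumes "A \<in> carrier_mat n n" "B \<in> carrier_mat n n" "E \<in> carrier_mat n n" "A * E = E * B"
  shows "A ^\<^sub>m k * E = E * B ^\<^sub>m k"
proof (induction k)
  case 0 then show ?case using assms by auto
next
  case (Suc k)
  have "A ^\<^sub>m Suc k * E = A ^\<^sub>m k * (A * E)" using assms by (simp add: assoc_mult_mat[of _ n n _ n _ n])
  also have "\<dots> = (A ^\<^sub>m k * E) * B" using assms by (simp add: assoc_mult_mat[of _ n n _ n _ n])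
  also have "\<dots> = E * B ^\<^sub>m Suc k" using assms by (simp add: Suc assoc_mult_mat[of _ n n _ n _ n])
  finally show ?case .
qed

lemma mat_poly_intertwine:
  assumes A: "A \<in> carrier_mat n n" and B: "B \<in> carrier_mat n n" and E: "E \<in> carrier_mat n n" "A * E = E * B"
  shows "mat_poly g A * E = E * mat_poly g B"
proof (rule eq_matI)
  note carr = mat_poly_carrier[OF A, of g] mat_poly_carrier[OF B, of g]
  fix i j assume "i < dim_row (E * mat_poly g B)" "j < dim_col (E * mat_poly g B)"
  then have ij: "i < n" "j < n" using carr E by auto
  have "(mat_poly g A * E) $$ (i,j) = (\<Sum>l<n. mat_poly g A $$ (i,l) * E $$ (l,j))"
    using ij carr E by (simp add: scalar_prod_def lessThan_atLeast0)
  also have "\<dots> = (\<Sum>l<n. (\<Sum>k\<le>degree g. coeff g k * ((A ^\<^sub>m k) $$ (i,l) * E $$ (l,j))))"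
    using ij by (intro sum.cong) (auto simp: mat_poly_index[OF A _ _ order_refl] sum_distrib_right mult.assoc)
  also have "\<dots> = (\<Sum>k\<le>degree g. coeff g k * (\<Sum>l<n. (A ^\<^sub>m k) $$ (i,l) * E $$ (l,j)))"
    by (subst sum.swap) (simp add: sum_distrib_left)
  also have "\<dots> = (\<Sum>k\<le>degree g. coeff g k * (A ^\<^sub>m k * E) $$ (i,j))"
    using ij A E by (intro sum.cong refl) (auto simp: scalar_prod_def lessThan_atLeast0 dest: pow_carrier_mat)
  also have "\<dots> = (\<Sum>k\<le>degree g. coeff g k * (E * B ^\<^sub>m k) $$ (i,j))"
    by (simp add: pow_mat_intertwine[OF assms])
  also have "\<dots> = (\<Sum>k\<le>degree g. coeff g k * (\<Sum>l<n. E $$ (i,l) * (B ^\<^sub>m k) $$ (l,j)))"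
    using ij B E by (intro sum.cong refl) (auto simp: scalar_prod_def lessThan_atLeast0 dest: pow_carrier_mat)
  also have "\<dots> = (\<Sum>l<n. (\<Sum>k\<le>degree g. E $$ (i,l) * (coeff g k * (B ^\<^sub>m k) $$ (l,j))))"
    by (subst sum.swap) (simp add: sum_distrib_left mult_ac)
  also have "\<dots> = (\<Sum>l<n. E $$ (i,l) * mat_poly g B $$ (l,j))"
    using ij by (intro sum.cong) (auto simp: mat_poly_index[OF B _ _ order_refl] sum_distrib_left)
  also have "\<dots> = (E * mat_poly g B) $$ (i,j)"
    using ij carr E by (simp add: scalar_prod_def lessThan_atLeast0)
  finally show "(mat_poly g A * E) $$ (i,j) = (E * mat_poly g B) $$ (i,j)" .
qed (use mat_poly_carrier[OF A, of g] mat_poly_carrier[OF B, of g] E in auto)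

lemma pow_mat_lower:
  assumes B: "B \<in> carrier_mat n n" and low: "\<And>i j. i < j \<Longrightarrow> j < n \<Longrightarrow> B $$ (i,j) = 0"
  shows "i < j \<Longrightarrow> j < n \<Longrightarrow> (B ^\<^sub>m k) $$ (i,j) = 0" and "i < n \<Longrightarrow> (B ^\<^sub>m k) $$ (i,i) = B $$ (i,i) ^ k"
proof (induction k arbitrary: i j)
  case 0
  { case 1 then show ?case using B by auto next case 2 then show ?case using B by auto }
next
  case (Suc k)
  have ind: "(B ^\<^sub>m Suc k) $$ (i,j) = (\<Sum>l<n. (B ^\<^sub>m k) $$ (i,l) * B $$ (l,j))" if "i < n" "j < n" for i j
    using that B pow_carrier_mat[OF B, of k] by (simp add: scalar_prod_def lessThan_atLeast0)
  { case 1
    then have "(B ^\<^sub>m Suc k) $$ (i,j) = (\<Sum>l<n. (B ^\<^sub>m k) $$ (i,l) * B $$ (l,j))" by (intro ind) auto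
    also have "\<dots> = 0"
    proof (intro sum.neutral ballI)
      fix l assume "l \<in> {..<n}"
      then show "(B ^\<^sub>m k) $$ (i,l) * B $$ (l,j) = 0"
        using Suc(1)[of i l] low[of l j] 1 by (cases "i < l") auto
    qed
    finally show ?case .
  next case 2
    then have "(B ^\<^sub>m Suc k) $$ (i,i) = (\<Sum>l<n. (B ^\<^sub>m k) $$ (i,l) * B $$ (l,i))" by (intro ind) auto
    also have "\<dots> = (\<Sum>l\<in>{i}. (B ^\<^sub>m k) $$ (i,l) * B $$ (l,i))"
    proof (intro sum.mono_neutral_right ballI)
      fix l assume "l \<in> {..<n} - {i}"
      then show "(B ^\<^sub>m k) $$ (i,l) * B $$ (l,i) = 0"
        using Suc(1)[of i l] low[of l i] 2 by (cases "i < l") auto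
    qed (use 2 in auto)
    also have "\<dots> = B $$ (i,i) ^ Suc k" using Suc(2)[OF 2] by (simp add: power_commutes)
    finally show ?case . }
qed

text \<open>In the Newton basis \<open>\<Prod>l<j. (Y - \<eta> l)\<close> multiplication by \<open>Y\<close> is lower bidiagonal with
  diagonal \<open>\<eta>\<close>.\<close>

lemma poly_norm_split:
  fixes \<eta> :: "nat \<Rightarrow> 'a::idom"
  shows "poly_norm (\<Prod>k<n. [:- \<eta> k, 1:]) g = (\<Prod>k<n. poly g (\<eta> k))"
proof -
  define e where "e j = (\<Prod>k<j. [:- \<eta> k, 1:])" for j
  have e_Suc: "e (Suc j) = [:- \<eta> j, 1:] * e j" for j by (simp add: e_def mult.commute)
  have deg_e: "degree (e j) = j" for j
    by (simp add: e_def degree_prod_eq_sum_degree)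
  have lead_e: "coeff (e j) j = 1" for j
  proof -
    have "lead_coeff (e j) = 1" by (simp add: e_def lead_coeff_prod)
    then show ?thesis by (simp add: deg_e)
  qed
  define C where "C = companion (e n)"
  define B where "B = Matrix.mat n n (\<lambda>(i,j). if i = j then \<eta> i else if i = Suc j then 1 else 0)"
  define E where "E = Matrix.mat n n (\<lambda>(i,j). coeff (e j) i)"
  have C: "C \<in> carrier_mat n n" using companion_carrier[of "e n"] by (simp add: C_def deg_e)
  have B: "B \<in> carrier_mat n n" by (simp add: B_def)
  have E: "E \<in> carrier_mat n n" by (simp add: E_def)
  have shift: "coeff (e (Suc j)) i = (if i = 0 then 0 else coeff (e j) (i-1)) - \<eta> j * coeff (e j) i" for i j
    by (simp add: e_Suc coeff_pCons split: nat.split)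
  \<comment> \<open>\<open>E\<close> rewrites the Newton basis in monomials. The identity is Y * e_j
    = e_(j+1) + \<eta>_j * e_j read in both bases; in the last column e_n drops out, being zero
    modulo itself.\<close>
  have "C * E = E * B"
  proof (rule eq_matI)
    fix i j assume "i < dim_row (E * B)" "j < dim_col (E * B)"
    then have ij: "i < n" "j < n" using E B by auto
    have "(C * E) $$ (i,j) = (\<Sum>l<n. C $$ (i,l) * E $$ (l,j))"
      using ij C E by (simp add: scalar_prod_def lessThan_atLeast0)
    also have "\<dots> = (\<Sum>l<n. if Suc l = n then - coeff (e n) i * coeff (e j) l else if l = i - 1 \<and> 0 < i then coeff (e j) l else 0)"
      using ij by (intro sum.cong) (auto simp: C_def companion_def deg_e E_def)
    also have "\<dots> = (\<Sum>l<n. (if l = n - 1 then - coeff (e n) i * coeff (e j) (n - 1) else 0) + (if l = i - 1 then if 0 < i then coeff (e j) (i-1) else 0 else 0))"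
      using ij by (intro sum.cong) auto
    also have "\<dots> = - coeff (e n) i * coeff (e j) (n - 1) + (if 0 < i then coeff (e j) (i-1) else 0)"
      using ij by (simp add: sum.distrib)
    also have "\<dots> = (if i = 0 then 0 else coeff (e j) (i-1)) - (if Suc j = n then coeff (e n) i else 0)"
    proof (cases "Suc j = n")
      case True
      then have "coeff (e j) (n-1) = 1" using lead_e[of j] by auto
      then show ?thesis using True by simp
    next
      case False
      then have "coeff (e j) (n-1) = 0" using ij by (intro coeff_eq_0) (simp add: deg_e)
      then show ?thesis using False by simp
    qed
    also have "\<dots> = (if Suc j = n then 0 else coeff (e (Suc j)) i) + \<eta> j * coeff (e j) i"
      using shift[of j i] by auto
    also have "\<dots> = (\<Sum>l<n. (if l = j then coeff (e j) i * \<eta> j else 0) + (if l = Suc j then coeff (e (Suc j)) i else 0))"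
      using ij by (simp add: sum.distrib)
    also have "\<dots> = (\<Sum>l<n. E $$ (i,l) * B $$ (l,j))"
      using ij by (intro sum.cong) (auto simp: B_def E_def)
    also have "\<dots> = (E * B) $$ (i,j)"
      using ij B E by (simp add: scalar_prod_def lessThan_atLeast0)
    finally show "(C * E) $$ (i,j) = (E * B) $$ (i,j)" .
  qed (use C E B in auto)
  then have "mat_poly g C * E = E * mat_poly g B" by (rule mat_poly_intertwine[OF C B E])
  then have "Determinant.det (mat_poly g C) * Determinant.det E = Determinant.det E * Determinant.det (mat_poly g B)"
    by (metis Determinant.det_mult mat_poly_carrier C B E)
  moreover have "Determinant.det E = 1"
  proof -
    have "upper_triangular E" unfolding upper_triangular_def using E by (auto simp: E_def deg_e coeff_eq_0)
    then have "Determinant.det E = prod_list (diag_mat E)" by (rule det_upper_triangular[OF _ E])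
    also have "diag_mat E = map (\<lambda>i. 1) [0..<n]" using E by (auto simp: diag_mat_def E_def lead_e)
    finally show ?thesis by (simp add: map_replicate_const)
  qed
  moreover have "Determinant.det (mat_poly g B) = (\<Prod>k<n. poly g (\<eta> k))"
  proof -
    have Bl: "i < j \<Longrightarrow> j < n \<Longrightarrow> B $$ (i,j) = 0" for i j by (simp add: B_def)
    have "mat_poly g B $$ (i,j) = 0" if "i < j" "j < n" for i j
      using that pow_mat_lower(1)[OF B Bl] by (simp add: mat_poly_index[OF B _ _ order_refl])
    then have "Determinant.det (mat_poly g B) = prod_list (diag_mat (mat_poly g B))"
      by (rule det_lower_triangular[OF _ mat_poly_carrier[OF B]])
    also have "diag_mat (mat_poly g B) = map (\<lambda>k. poly g (\<eta> k)) [0..<n]"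
    proof -
      have "mat_poly g B $$ (k,k) = poly g (\<eta> k)" if "k < n" for k
      proof -
        have "B $$ (k,k) = \<eta> k" using that by (simp add: B_def)
        then show ?thesis
          using that pow_mat_lower(2)[OF B Bl] by (simp add: mat_poly_index[OF B _ _ order_refl] poly_altdef)
      qed
      then show ?thesis using mat_poly_carrier[OF B, of g] by (simp add: diag_mat_def)
    qed
    finally show ?thesis by (simp add: prod.list_conv_set_nth lessThan_atLeast0)
  qed
  ultimately have "Determinant.det (mat_poly g C) = (\<Prod>k<n. poly g (\<eta> k))" by simp
  then show ?thesis unfolding poly_norm_def C_def e_def .
qed

subsection \<open>Integral elements over a subring of a field\<close>

definition subring_set :: "'a::comm_ring_1 set \<Rightarrow> bool" where
  "subring_set A \<longleftrightarrow> 1 \<in> A \<and> (\<forall>x\<in>A. - x \<in> A) \<and> (\<forall>x\<in>A. \<forall>y\<in>A. x + y \<in> A) \<and> (\<forall>x\<in>A. \<forall>y\<in>A. x * y \<in> A)"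

lemma subring_setD:
  assumes "subring_set A"
  shows "1 \<in> A" "x \<in> A \<Longrightarrow> - x \<in> A" "x \<in> A \<Longrightarrow> y \<in> A \<Longrightarrow> x + y \<in> A" "x \<in> A \<Longrightarrow> y \<in> A \<Longrightarrow> x * y \<in> A" "0 \<in> A"
proof -
  have "1 + (-1) \<in> A" using assms unfolding subring_set_def by blast
  then show "0 \<in> A" by simp
qed (use assms in \<open>auto simp: subring_set_def\<close>)

lemma subring_set_sum: "subring_set A \<Longrightarrow> (\<And>i. i \<in> I \<Longrightarrow> f i \<in> A) \<Longrightarrow> sum f I \<in> A"
  by (induction I rule: infinite_finite_induct) (auto simp: subring_setD)
lemma subring_set_prod: "subring_set A \<Longrightarrow> (\<And>i. i \<in> I \<Longrightarrow> f i \<in> A) \<Longrightarrow> prod f I \<in> A"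
  by (induction I rule: infinite_finite_induct) (auto simp: subring_setD)

lemma subring_set_det:
  assumes A: "subring_set A" and M: "M \<in> carrier_mat n n" "\<And>i j. i < n \<Longrightarrow> j < n \<Longrightarrow> M $$ (i,j) \<in> A"
  shows "Determinant.det M \<in> A"
  unfolding det_def'[OF M(1)]
proof (rule subring_set_sum[OF A])
  fix p assume "p \<in> {p. p permutes {0..<n}}"
  then have p: "p permutes {0..<n}" by simp
  have "(\<Prod>i = 0..<n. M $$ (i, p i)) \<in> A"
    using permutes_in_image[OF p] by (intro subring_set_prod[OF A] M(2)) auto
  then show "signof p * (\<Prod>i = 0..<n. M $$ (i, p i)) \<in> A"
    using subring_setD(2)[OF A] by (cases "sign p = 1") (auto simp: sign_def)
qed

lemma subring_set_poly: "subring_set A \<Longrightarrow> subring_set {p. \<forall>i. coeff p i \<in> A}"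
  unfolding subring_set_def[of "{p. \<forall>i. coeff p i \<in> A}"]
  by (auto simp: coeff_mult one_pCons coeff_pCons subring_setD split: nat.split intro!: subring_set_sum)

text \<open>The counterpart of \<open>integral_closure\<close> inside a field type. The exponent
  \<open>n\<close> needs no lower bound, since n = 0 would read 1 = 0.\<close>

definition int_over :: "'a::field set \<Rightarrow> 'a \<Rightarrow> bool" where
  "int_over A z \<longleftrightarrow> (\<exists>n a. (\<forall>i<n::nat. a i \<in> A) \<and> z ^ n + (\<Sum>i<n. a i * z ^ i) = 0)"

text \<open>The determinant trick: \<open>e\<close> is an eigenvector of the matrix \<open>m\<close>
  with eigenvalue \<open>z\<close>, so \<open>z\<close> is a root of the characteristic polynomial,
  which is monic with coefficients in \<open>A\<close>.\<close>

lemma int_over_nat: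
  fixes z :: "'a::field" and n :: nat
  assumes A: "subring_set A" and e: "k < n" "e k \<noteq> 0"
    and m: "\<And>i j. i < n \<Longrightarrow> j < n \<Longrightarrow> m i j \<in> A"
    and eq: "\<And>i. i < n \<Longrightarrow> z * e i = (\<Sum>j<n. m i j * e j)"
  shows "int_over A z"
proof -
  define M where "M = Matrix.mat n n (\<lambda>(i,j). m i j)"
  define v where "v = Matrix.vec n e"
  have M: "M \<in> carrier_mat n n" by (simp add: M_def)
  have "eigenvector M v z"
    unfolding eigenvector_def
  proof (intro conjI)
    show "v \<in> carrier_vec (dim_row M)" by (simp add: v_def M_def)
    have "vec_index v k \<noteq> 0" using e by (simp add: v_def)
    then show "v \<noteq> 0\<^sub>v (dim_row M)" using e by (auto simp: M_def)
    show "M *\<^sub>v v = z \<cdot>\<^sub>v v"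
      by (rule eq_vecI) (auto simp: M_def v_def scalar_prod_def eq lessThan_atLeast0)
  qed
  then have root: "poly (char_poly M) z = 0"
    using eigenvalue_root_char_poly[OF M] unfolding eigenvalue_def by blast
  have deg: "degree (char_poly M) = n" "coeff (char_poly M) n = 1" using degree_monic_char_poly[OF M] by auto
  have "char_poly M \<in> {p. \<forall>i. coeff p i \<in> A}"
    unfolding char_poly_def
  proof (rule subring_set_det[OF subring_set_poly[OF A]])
    show "char_poly_matrix M \<in> carrier_mat n n" using M by simp
    fix i j assume ij: "i < n" "j < n"
    then have "char_poly_matrix M $$ (i,j) = (if i = j then [:0,1:] else 0) + [: - m i j :]"
      using M by (auto simp: char_poly_matrix_def M_def)
    then show "char_poly_matrix M $$ (i,j) \<in> {p. \<forall>i. coeff p i \<in> A}"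
      using ij m[of i j] subring_setD[OF A] by (auto simp: coeff_pCons split: nat.split)
  qed
  then have c: "coeff (char_poly M) i \<in> A" for i by simp
  have "z ^ n + (\<Sum>i<n. coeff (char_poly M) i * z ^ i) = poly (char_poly M) z"
    unfolding poly_altdef deg(1) by (simp add: deg(2) lessThan_Suc_atMost[symmetric])
  then show ?thesis unfolding int_over_def using c root by metis
qed

definition span_over :: "'a::field set \<Rightarrow> ('i \<Rightarrow> 'a) \<Rightarrow> 'i set \<Rightarrow> 'a set" where
  "span_over A e I = {\<Sum>j\<in>I. m j * e j | m. \<forall>j\<in>I. m j \<in> A}"

lemma span_over_add: "subring_set A \<Longrightarrow> x \<in> span_over A e I \<Longrightarrow> y \<in> span_over A e I \<Longrightarrow> x + y \<in> span_over A e I"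
  unfolding span_over_def
proof clarify
  fix m m' assume "subring_set A" "\<forall>j\<in>I. m j \<in> A" "\<forall>j\<in>I. m' j \<in> A"
  then show "\<exists>m''. (\<Sum>j\<in>I. m j * e j) + (\<Sum>j\<in>I. m' j * e j) = (\<Sum>j\<in>I. m'' j * e j) \<and> (\<forall>j\<in>I. m'' j \<in> A)"
    by (intro exI[of _ "\<lambda>j. m j + m' j"]) (auto simp: subring_setD sum.distrib algebra_simps)
qed
lemma span_over_scale: "subring_set A \<Longrightarrow> x \<in> span_over A e I \<Longrightarrow> a \<in> A \<Longrightarrow> a * x \<in> span_over A e I"
  unfolding span_over_def
proof clarify
  fix m assume "subring_set A" "\<forall>j\<in>I. m j \<in> A" "a \<in> A"
  then show "\<exists>m''. a * (\<Sum>j\<in>I. m j * e j) = (\<Sum>j\<in>I. m'' j * e j) \<and> (\<forall>j\<in>I. m'' j \<in> A)"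
    by (intro exI[of _ "\<lambda>j. a * m j"]) (auto simp: subring_setD sum_distrib_left algebra_simps)
qed
lemma span_over_0: "subring_set A \<Longrightarrow> 0 \<in> span_over A e I"
  unfolding span_over_def using subring_setD(5)[of A] by (auto intro!: exI[of _ "\<lambda>_. 0"])
lemma span_over_sum: "subring_set A \<Longrightarrow> (\<And>k. k \<in> K \<Longrightarrow> f k \<in> span_over A e I) \<Longrightarrow> sum f K \<in> span_over A e I"
  by (induction K rule: infinite_finite_induct) (auto simp: span_over_0 span_over_add)
lemma span_over_base: "subring_set A \<Longrightarrow> finite I \<Longrightarrow> i \<in> I \<Longrightarrow> e i \<in> span_over A e I"
  unfolding span_over_def
proof clarify
  assume "subring_set A" "finite I" "i \<in> I"
  then show "\<exists>m. e i = (\<Sum>j\<in>I. m j * e j) \<and> (\<forall>j\<in>I. m j \<in> A)"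
    by (intro exI[of _ "\<lambda>j. if j = i then 1 else 0"]) (auto simp: subring_setD if_distrib[of "\<lambda>x. x * _"] cong: if_cong)
qed
lemma span_over_mult:
  assumes A: "subring_set A" and z: "\<And>i. i \<in> I \<Longrightarrow> z * e i \<in> span_over A e I" and x: "x \<in> span_over A e I"
  shows "z * x \<in> span_over A e I"
proof -
  obtain m where m: "x = (\<Sum>j\<in>I. m j * e j)" "\<forall>j\<in>I. m j \<in> A" using x by (auto simp: span_over_def)
  have "z * x = (\<Sum>j\<in>I. m j * (z * e j))" by (simp add: m(1) sum_distrib_left mult_ac)
  then show ?thesis using m(2) z by (simp add: span_over_sum[OF A] span_over_scale[OF A])
qed

lemma int_over_span:
  assumes A: "subring_set A" and I: "finite I" "k \<in> I" "e k \<noteq> 0"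
    and z: "\<And>i. i \<in> I \<Longrightarrow> z * e i \<in> span_over A e I"
  shows "int_over A z"
proof -
  obtain f where f: "bij_betw f {..<card I} I"
    using ex_bij_betw_nat_finite[OF I(1)] by (auto simp: lessThan_atLeast0)
  have "\<forall>i\<in>I. \<exists>m. z * e i = (\<Sum>j\<in>I. m j * e j) \<and> (\<forall>j\<in>I. m j \<in> A)"
    using z unfolding span_over_def by blast
  then obtain m where m: "\<And>i. i \<in> I \<Longrightarrow> z * e i = (\<Sum>j\<in>I. m i j * e j)" "\<And>i j. i \<in> I \<Longrightarrow> j \<in> I \<Longrightarrow> m i j \<in> A"
    by metis
  have fI: "f i \<in> I" if "i < card I" for i using f that by (auto simp: bij_betw_def)
  have "k \<in> f ` {..<card I}" using f I(2) by (simp add: bij_betw_def)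
  then obtain l where l: "l < card I" "f l = k" by auto
  show ?thesis
  proof (rule int_over_nat[OF A, of l "card I" "\<lambda>i. e (f i)" "\<lambda>i j. m (f i) (f j)"])
    fix i assume "i < card I"
    then show "z * e (f i) = (\<Sum>j<card I. m (f i) (f j) * e (f j))"
      using m(1)[OF fI[of i]] sum.reindex_bij_betw[OF f, of "\<lambda>j. m (f i) j * e j"] by simp
  qed (use l I fI m(2) in auto)
qed

text \<open>Multiplication by \<open>z\<close> raises the exponent \<open>i\<close>; when it reaches
  \<open>n\<close>, the monic equation of \<open>z\<close> brings it down again. The span of the
  products z^i * w^j is thus stable under \<open>z\<close> and, by symmetry, under
  \<open>w\<close>.\<close>

lemma int_over_span_powers:
  assumes A: "subring_set A" and z: "\<forall>i<n. a i \<in> A" "z ^ n + (\<Sum>i<n. a i * z ^ i) = 0"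
    and w: "\<forall>i<m. b i \<in> A" "w ^ m + (\<Sum>i<m. b i * w ^ i) = 0"
    and ij: "i < n" "j < m"
  shows "z * (z ^ i * w ^ j) \<in> span_over A (\<lambda>(i,j). z ^ i * w ^ j) ({..<n} \<times> {..<m})" (is "_ \<in> ?S")
proof (cases "Suc i < n")
  case True
  then show ?thesis using span_over_base[OF A, of "{..<n} \<times> {..<m}" "(Suc i, j)" "\<lambda>(i,j). z ^ i * w ^ j"] ij
    by (simp add: mult_ac)
next
  case False
  then have n: "n = Suc i" using ij by simp
  have "z ^ n = - (\<Sum>i<n. a i * z ^ i)" using z(2) by (simp add: eq_neg_iff_add_eq_0)
  then have "z * (z ^ i * w ^ j) = - (\<Sum>i<n. a i * z ^ i) * w ^ j" by (simp add: n mult_ac)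
  also have "\<dots> = (\<Sum>l<n. (- a l) * (z ^ l * w ^ j))" by (simp add: sum_distrib_left sum_distrib_right sum_negf mult_ac)
  also have "\<dots> \<in> ?S"
  proof (rule span_over_sum[OF A], rule span_over_scale[OF A])
    fix l assume "l \<in> {..<n}"
    then show "z ^ l * w ^ j \<in> ?S" using span_over_base[OF A, of "{..<n} \<times> {..<m}" "(l, j)" "\<lambda>(i,j). z ^ i * w ^ j"] ij by simp
    show "- a l \<in> A" using z(1) \<open>l \<in> _\<close> subring_setD(2)[OF A] by auto
  qed
  finally show ?thesis .
qed

lemma int_over_add_mult:
  assumes A: "subring_set A" and "int_over A z" "int_over A w"
  shows "int_over A (z + w)" "int_over A (z * w)"
proof -
  obtain n a where z: "\<forall>i<n. a i \<in> A" "z ^ n + (\<Sum>i<n. a i * z ^ i) = 0" using assms(2) unfolding int_over_def by blast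
  obtain m b where w: "\<forall>i<m. b i \<in> A" "w ^ m + (\<Sum>i<m. b i * w ^ i) = 0" using assms(3) unfolding int_over_def by blast
  have nm: "n \<noteq> 0" "m \<noteq> 0" using z w by (metis add.right_neutral lessThan_0 power_0 sum.empty zero_neq_one)+
  define e where "e = (\<lambda>(i,j). z ^ i * w ^ j)"
  let ?I = "{..<n} \<times> {..<m}"
  have ze: "z * e ij \<in> span_over A e ?I" if "ij \<in> ?I" for ij
    using int_over_span_powers[OF A z w] that unfolding e_def by auto
  have we: "w * e ij \<in> span_over A e ?I" if ij: "ij \<in> ?I" for ij
  proof -
    obtain i j where [simp]: "ij = (i,j)" "i < n" "j < m" using ij by auto
    have "w * (w ^ j * z ^ i) \<in> span_over A (\<lambda>(i,j). w ^ i * z ^ j) ({..<m} \<times> {..<n})"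
      by (rule int_over_span_powers[OF A w z]) auto
    then obtain c where c: "w * (w ^ j * z ^ i) = (\<Sum>(k,l)\<in>{..<m}\<times>{..<n}. c (k,l) * (w ^ k * z ^ l))" "\<forall>x\<in>{..<m}\<times>{..<n}. c x \<in> A"
      unfolding span_over_def by (auto simp: case_prod_unfold)
    have "(\<Sum>(k,l)\<in>{..<m}\<times>{..<n}. c (k,l) * (w ^ k * z ^ l)) = (\<Sum>(k,l)\<in>?I. c (l,k) * e (k,l))"
      by (rule sum.reindex_bij_witness[of _ "\<lambda>(a,b). (b,a)" "\<lambda>(a,b). (b,a)"]) (auto simp: e_def mult_ac)
    also have "\<dots> \<in> span_over A e ?I"
      unfolding span_over_def using c(2) by (auto intro!: exI[of _ "\<lambda>(k,l). c (l,k)"] sum.cong)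
    finally show ?thesis using c(1) by (simp add: e_def mult_ac)
  qed
  have e0: "(0,0) \<in> ?I" "e (0,0) \<noteq> 0" using nm by (auto simp: e_def)
  show "int_over A (z + w)"
    by (rule int_over_span[where k = "(0,0)" and e = e, OF A finite_cartesian_product[OF finite_lessThan finite_lessThan] e0]) (auto simp: distrib_right intro!: span_over_add[OF A] ze we)
  have "z * w * e ij \<in> span_over A e ?I" if "ij \<in> ?I" for ij
    using span_over_mult[OF A ze we[OF that]] by (simp add: mult.assoc)
  then show "int_over A (z * w)"
    by (intro int_over_span[where k = "(0,0)" and e = e, OF A finite_cartesian_product[OF finite_lessThan finite_lessThan] e0]) auto
qed

lemma int_over_base: assumes "subring_set A" "z \<in> A" shows "int_over A z"
  unfolding int_over_def using assms subring_setD(2)[OF assms] by (intro exI[of _ 1] exI[of _ "\<lambda>_. - z"]) auto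

lemma subring_set_int_over:
  assumes A: "subring_set A" shows "subring_set {z. int_over A z}"
proof -
  have "int_over A (- x)" if "int_over A x" for x
    using int_over_add_mult(2)[OF A int_over_base[OF A] that, of "-1"] subring_setD[OF A] by auto
  then show ?thesis unfolding subring_set_def using int_over_add_mult[OF A] int_over_base[OF A] subring_setD[OF A] by blast
qed

text \<open>The elements \<open>c i = a n * z ^ i + \<dots> + a (n - i + 1) * z\<close> of Seidenberg's argument are integral
  because they map the span of \<open>1, z, \<dots>, z ^ (n - 1)\<close> to itself.\<close>

lemma int_over_horner:
  assumes A: "subring_set A" and a: "\<And>i. i \<le> n \<Longrightarrow> a i \<in> A" and z: "(\<Sum>i\<le>n. a i * z ^ i) = 0"
    and i: "i \<le> n" "0 < n"
  shows "int_over A (\<Sum>l<i. a (n - l) * z ^ (i - l))" (is "int_over A ?c")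
proof (rule int_over_span[OF A, of "{..<n}" 0 "\<lambda>j. z ^ j"])
  fix j assume j: "j \<in> {..<n}"
  have base: "z ^ k \<in> span_over A ((^) z) {..<n}" if "k < n" for k
    using span_over_base[OF A, of "{..<n}" k "\<lambda>j. z ^ j"] that by simp
  show "?c * z ^ j \<in> span_over A ((^) z) {..<n}"
  proof (cases "i + j < n")
    case True
    have "?c * z ^ j = (\<Sum>l<i. a (n - l) * z ^ (i - l + j))" unfolding sum_distrib_right
      by (intro sum.cong refl) (simp only: power_add mult.assoc)
    also have "\<dots> \<in> span_over A ((^) z) {..<n}"
      using True by (intro span_over_sum[OF A] span_over_scale[OF A] base a) auto
    finally show ?thesis .
  next
    case False
    \<comment> \<open>Here i + j \<ge> n, so z^(i + j - n) splits off and the relation replaces the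
      top part of the sum by minus its lower part, whose exponents are at most j.\<close>
    define q where "q = Suc (n - i)"
    have "(\<Sum>i\<le>n. a i * z ^ i) = (\<Sum>k<q. a k * z ^ k) + (\<Sum>l<i. a (n - l) * z ^ (n - l))"
    proof -
      have "{..n} = {..<q} \<union> (\<lambda>l. n - l) ` {..<i}"
      proof (intro equalityI subsetI)
        fix k assume k: "k \<in> {..n}"
        show "k \<in> {..<q} \<union> (\<lambda>l. n - l) ` {..<i}"
        proof (cases "k < q")
          case False
          then have "n - k < i" "k = n - (n - k)" using k i by (auto simp: q_def)
          then show ?thesis by blast
        qed simp
      qed (use i in \<open>auto simp: q_def\<close>)
      moreover have "{..<q} \<inter> (\<lambda>l. n - l) ` {..<i} = {}" using i by (auto simp: q_def)
      moreover have "inj_on (\<lambda>l. n - l) {..<i}" using i by (auto simp: inj_on_def)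
      ultimately show ?thesis by (simp add: sum.union_disjoint sum.reindex)
    qed
    then have eq: "(\<Sum>l<i. a (n - l) * z ^ (n - l)) = - (\<Sum>k<q. a k * z ^ k)"
      using z by (metis add.commute add_eq_0_iff)
    have "?c * z ^ j = (\<Sum>l<i. a (n - l) * z ^ (n - l)) * z ^ (i + j - n)"
      unfolding sum_distrib_right
    proof (intro sum.cong refl)
      fix l assume "l \<in> {..<i}"
      then have "i - l + j = n - l + (i + j - n)" using False i by auto
      then show "a (n - l) * z ^ (i - l) * z ^ j = a (n - l) * z ^ (n - l) * z ^ (i + j - n)"
        by (metis mult.assoc power_add)
    qed
    also have "\<dots> = (\<Sum>k<q. (- a k) * z ^ (k + (i + j - n)))"
      unfolding eq sum_negf[symmetric] sum_distrib_right by (simp add: power_add mult.assoc)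
    also have "\<dots> \<in> span_over A ((^) z) {..<n}"
      using j i False by (intro span_over_sum[OF A] span_over_scale[OF A] base subring_setD(2)[OF A] a) (auto simp: q_def)
    finally show ?thesis .
  qed
qed (use i in auto)

subsection \<open>Hensel's lemma and Puiseux expansions\<close>

text \<open>Bezout's identity with \<open>u\<close> reduced modulo \<open>q1\<close>; the degree of
  \<open>w\<close> is then read off from q1 * w = e - q2 * u.\<close>

lemma coprime_solve:
  fixes q1 q2 e :: "complex poly"
  assumes "coprime q1 q2" "degree q1 = n1" "degree q2 = n2" "0 < n1" "0 < n2" "degree e < n1 + n2"
  shows "\<exists>u w. q1 * w + q2 * u = e \<and> degree u < n1 \<and> degree w < n2"
proof -
  obtain s r where sr: "s * q1 + r * q2 = 1"
    using assms(1) by (metis bezout_coefficients_fst_snd coprime_imp_gcd_eq_1)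
  define u where "u = (r * e) mod q1"
  have q1: "q1 \<noteq> 0" using assms by auto
  have du: "degree u < n1" using degree_mod_less'[of q1 "r * e"] q1 assms by (cases "u = 0") (auto simp: u_def)
  have "e - q2 * u = q1 * (s * e + q2 * ((r * e) div q1))"
  proof -
    have "u = r * e - q1 * ((r * e) div q1)" unfolding u_def by (metis minus_mult_div_eq_mod)
    then have "e - q2 * u = (s * q1 + r * q2) * e - q2 * (r * e - q1 * ((r * e) div q1))" using sr by simp
    then show ?thesis by (simp add: algebra_simps)
  qed
  then obtain w where w: "e - q2 * u = q1 * w" by blast
  have "degree w < n2"
  proof (cases "w = 0")
    case False
    have "degree (q2 * u) \<le> degree q2 + degree u" by (rule degree_mult_le)
    then have "degree (e - q2 * u) < n1 + n2"
      using assms du by (intro degree_diff_less) auto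
    then show ?thesis using False q1 assms(2) by (simp add: w degree_mult_eq)
  qed (use assms in simp)
  then show ?thesis using w du by (intro exI[of _ u] exI[of _ w]) (simp add: algebra_simps)
qed

text \<open>Exchanges the two variables: a power series whose coefficients are polynomials of degree
  at most \<open>n\<close> becomes a polynomial with power series coefficients.\<close>

definition fps_poly :: "nat \<Rightarrow> (nat \<Rightarrow> 'a::zero poly) \<Rightarrow> 'a fps poly" where
  "fps_poly n u = Poly (map (\<lambda>i. Abs_fps (\<lambda>k. coeff (u k) i)) [0..<Suc n])"

lemma coeff_fps_poly: "(\<And>k. degree (u k) \<le> n) \<Longrightarrow> coeff (fps_poly n u) i = Abs_fps (\<lambda>k. coeff (u k) i)"
proof -
  assume d: "\<And>k. degree (u k) \<le> n"
  have "coeff (u k) i = 0" if "n < i" for k using d[of k] that by (intro coeff_eq_0) simp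
  then show ?thesis by (auto simp: fps_poly_def nth_default_def fps_eq_iff simp del: upt_Suc)
qed

text \<open>The factors are lifted one power of the series variable at a time. Each step is a linear
  equation in the coprime pair \<open>q1\<close>, \<open>q2\<close>; its solutions have degrees
  below those of \<open>q1\<close> and \<open>q2\<close>, which keeps the factors monic.\<close>

lemma hensel:
  fixes p :: "complex fps poly"
  assumes p: "lead_coeff p = 1" and q: "map_poly (\<lambda>f. fps_nth f 0) p = q1 * q2" "coprime q1 q2"
    "lead_coeff q1 = 1" "lead_coeff q2 = 1" "0 < degree q1" "0 < degree q2"
  shows "\<exists>p1 p2. p = p1 * p2 \<and> lead_coeff p1 = 1 \<and> lead_coeff p2 = 1 \<and> degree p1 = degree q1 \<and> degree p2 = degree q2"
proof -
  define n1 n2 where "n1 = degree q1" and "n2 = degree q2"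
  define pk where "pk k = map_poly (\<lambda>f. fps_nth f k) p" for k
  have cpk: "coeff (pk k) i = fps_nth (coeff p i) k" for k i by (simp add: pk_def coeff_map_poly)
  have pk0: "pk 0 = q1 * q2" using q(1) by (simp add: pk_def)
  have n: "degree p = n1 + n2"
  proof (rule antisym)
    have "lead_coeff (q1 * q2) = 1" "degree (q1 * q2) = n1 + n2" 
      using q by (simp_all add: lead_coeff_mult coeff_mult_degree_sum n1_def n2_def degree_mult_eq leading_coeff_0_iff[symmetric] del: leading_coeff_0_iff)
    then have "fps_nth (coeff p (n1 + n2)) 0 = 1" using cpk[of 0 "n1 + n2"] by (simp add: pk0)
    then have "coeff p (n1 + n2) \<noteq> 0" by auto
    then show "n1 + n2 \<le> degree p" by (rule le_degree)
    have "coeff (q1 * q2) (degree p) = 1" using p by (simp add: cpk flip: pk0)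
    then have "coeff (q1 * q2) (degree p) \<noteq> 0" by simp
    then have "degree p \<le> degree (q1 * q2)" by (rule le_degree)
    then show "degree p \<le> n1 + n2" using \<open>degree (q1 * q2) = n1 + n2\<close> by simp
  qed
  have dpk: "degree (pk k) < n1 + n2" if "0 < k" for k
  proof -
    have "coeff (pk k) i = 0" if "i \<ge> n1 + n2" for i
      using that \<open>0 < k\<close> p by (cases "i = n1 + n2") (auto simp: cpk coeff_eq_0 simp flip: n)
    moreover have "0 < n1 + n2" using q by (simp add: n1_def)
    ultimately show ?thesis by (metis coeff_0 degree_0 leading_coeff_0_iff not_le)
  qed
  \<comment> \<open>\<open>r\<close> is the pair of k-th coefficients of the two factors. The sum
    runs over the products of earlier coefficients, so that the two terms with the unknowns remain
    on the left.\<close>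
  define P where "P f k r \<longleftrightarrow> (if k = 0 then r = (q1,q2) else
      q1 * snd r + q2 * fst r = pk k - (\<Sum>i\<in>{0<..<k}. fst (f i) * snd (f (k - i)))
      \<and> degree (fst r) < n1 \<and> degree (snd r) < n2)" for f :: "nat \<Rightarrow> complex poly \<times> complex poly" and k r
  have "\<exists>f. \<forall>k. P f k (f k)"
  proof (rule dependent_wellorder_choice)
    fix r and f g :: "nat \<Rightarrow> complex poly \<times> complex poly" and x :: nat assume "\<And>y. y < x \<Longrightarrow> f y = g y"
    then have "(\<Sum>i\<in>{0<..<x}. fst (f i) * snd (f (x - i))) = (\<Sum>i\<in>{0<..<x}. fst (g i) * snd (g (x - i)))"
      by (intro sum.cong) auto
    then show "P f x r = P g x r" by (simp add: P_def)
  next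
    fix x :: nat and f :: "nat \<Rightarrow> complex poly \<times> complex poly" assume IH: "\<And>y. y < x \<Longrightarrow> P f y (f y)"
    show "\<exists>r. P f x r"
    proof (cases "x = 0")
      case False
      have "degree (\<Sum>i\<in>{0<..<x}. fst (f i) * snd (f (x - i))) \<le> n1 + n2 - 1"
      proof (rule degree_sum_le)
        fix i assume "i \<in> {0<..<x}"
        then have "degree (fst (f i)) < n1" "degree (snd (f (x - i))) < n2"
          using IH[of i] IH[of "x - i"] by (auto simp: P_def)
        then show "degree (fst (f i) * snd (f (x - i))) \<le> n1 + n2 - 1"
          using degree_mult_le[of "fst (f i)" "snd (f (x - i))"] by linarith
      qed simp
      then have "degree (pk x - (\<Sum>i\<in>{0<..<x}. fst (f i) * snd (f (x - i)))) < n1 + n2"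
        using dpk[of x] False by (intro degree_diff_less) auto
      from coprime_solve[OF q(2) n1_def[symmetric] n2_def[symmetric] _ _ this] obtain u w where
        "q1 * w + q2 * u = pk x - (\<Sum>i\<in>{0<..<x}. fst (f i) * snd (f (x - i)))" "degree u < n1" "degree w < n2"
        using q by (auto simp: n1_def n2_def)
      then show ?thesis using False by (intro exI[of _ "(u,w)"]) (simp add: P_def)
    qed (simp add: P_def)
  qed
  then obtain f where f: "\<And>k. P f k (f k)" by blast
  define u w where "u k = fst (f k)" and "w k = snd (f k)" for k
  have 0: "u 0 = q1" "w 0 = q2" using f[of 0] by (simp_all add: P_def u_def w_def)
  have d: "degree (u k) < n1" "degree (w k) < n2" if "0 < k" for k using f[of k] that by (simp_all add: P_def u_def w_def)
  have d': "degree (u k) \<le> n1" "degree (w k) \<le> n2" for k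
    using d[of k] 0 by (cases "k = 0"; simp add: n1_def n2_def)+
  have prod: "(\<Sum>i\<le>k. u i * w (k - i)) = pk k" for k
  proof (cases "k = 0")
    case True then show ?thesis by (simp add: 0 pk0)
  next
    case False
    have "{..k} = insert 0 (insert k {0<..<k})" using False by auto
    then have "(\<Sum>i\<le>k. u i * w (k - i)) = u 0 * w k + (u k * w 0 + (\<Sum>i\<in>{0<..<k}. u i * w (k - i)))"
      using False by simp
    also have "\<dots> = pk k" using f[of k] False by (simp add: P_def u_def w_def 0[unfolded u_def w_def] algebra_simps)
    finally show ?thesis .
  qed
  define p1 p2 where "p1 = fps_poly n1 u" and "p2 = fps_poly n2 w"
  have c: "coeff p1 i = Abs_fps (\<lambda>k. coeff (u k) i)" "coeff p2 i = Abs_fps (\<lambda>k. coeff (w k) i)" for i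
    by (simp_all add: p1_def p2_def coeff_fps_poly d')
  have "p = p1 * p2"
  proof (rule poly_eqI, rule fps_ext)
    fix j k
    have "fps_nth (coeff (p1 * p2) j) k = (\<Sum>i\<le>j. \<Sum>l\<le>k. coeff (u l) i * coeff (w (k - l)) (j - i))"
      by (simp add: coeff_mult fps_sum_nth fps_mult_nth c atLeast0AtMost)
    also have "\<dots> = coeff (\<Sum>l\<le>k. u l * w (k - l)) j"
      by (subst sum.swap) (simp add: coeff_sum coeff_mult)
    finally show "fps_nth (coeff p j) k = fps_nth (coeff (p1 * p2) j) k" by (simp add: prod cpk)
  qed
  have monic: "degree (fps_poly m v) = m \<and> lead_coeff (fps_poly m v) = 1"
    if "\<And>k. degree (v k) \<le> m" "\<And>k. 0 < k \<Longrightarrow> degree (v k) < m" "coeff (v 0) m = 1" for m and v :: "nat \<Rightarrow> complex poly"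
  proof -
    have c: "coeff (fps_poly m v) i = Abs_fps (\<lambda>k. coeff (v k) i)" for i by (rule coeff_fps_poly) (rule that)
    have 1: "coeff (fps_poly m v) m = 1"
    proof (rule fps_ext)
      fix k show "fps_nth (coeff (fps_poly m v) m) k = fps_nth 1 k"
        using that by (cases "k = 0") (auto simp: c coeff_eq_0)
    qed
    have "degree (fps_poly m v) = m"
    proof (rule antisym)
      have "coeff (v k) i = 0" if "i > m" for i k
        using that \<open>\<And>k. degree (v k) \<le> m\<close>[of k] by (intro coeff_eq_0) simp
      then show "degree (fps_poly m v) \<le> m" by (intro degree_le) (simp add: c fps_eq_iff)
    qed (use 1 in \<open>simp add: le_degree\<close>)
    then show ?thesis using 1 by simp
  qed
  have "degree p1 = n1 \<and> lead_coeff p1 = 1" unfolding p1_def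
    using d' d q by (intro monic) (auto simp: 0 n1_def)
  moreover have "degree p2 = n2 \<and> lead_coeff p2 = 1" unfolding p2_def
    using d' d q by (intro monic) (auto simp: 0 n2_def)
  ultimately show ?thesis using \<open>p = p1 * p2\<close> unfolding n1_def n2_def by blast
qed

text \<open>The ramified base change that replaces the parameter by its \<open>N\<close>-th
  power.\<close>

definition fps_subst :: "nat \<Rightarrow> complex fps \<Rightarrow> complex fps" where
  "fps_subst N f = fps_compose f (fps_X ^ N)"

lemma fps_subst_hom: "0 < N \<Longrightarrow> comm_ring_hom (fps_subst N)"
  by unfold_locales (simp_all add: fps_subst_def fps_compose_add_distrib fps_compose_mult_distrib fps_X_power_nth)

lemma fps_subst_const: "fps_subst N (fps_const c) = fps_const c" by (simp add: fps_subst_def)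
lemma fps_subst_subst: "0 < N \<Longrightarrow> 0 < M \<Longrightarrow> fps_subst N (fps_subst M f) = fps_subst (M * N) f"
  by (simp add: fps_subst_def fps_compose_assoc[symmetric] fps_X_power_nth fps_compose_power[symmetric] power_mult[symmetric] mult.commute)
lemma fps_subst_X: "0 < N \<Longrightarrow> fps_subst N fps_X = fps_X ^ N"
  by (simp add: fps_subst_def fps_X_fps_compose_startby0 fps_X_power_nth)
lemma fps_subst_subdegree: "0 < N \<Longrightarrow> subdegree (fps_subst N f) = N * subdegree f"
  by (simp add: fps_subst_def subdegree_fps_compose fps_X_power_nth mult.commute)
lemma map_poly_fps_subst_1: "map_poly (fps_subst 1) p = p"
  by (rule poly_eqI) (simp add: coeff_map_poly fps_subst_def)
lemma fps_subst_nth_0: "0 < N \<Longrightarrow> fps_nth (fps_subst N f) 0 = fps_nth f 0"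
  by (simp add: fps_subst_def fps_compose_nth)

lemma map_poly_hom_props:
  assumes "comm_ring_hom h" shows "map_poly h (p * q) = map_poly h p * map_poly h q"
    "lead_coeff p = 1 \<Longrightarrow> degree (map_poly h p) = degree p" "lead_coeff p = 1 \<Longrightarrow> lead_coeff (map_poly h p) = 1"
proof -
  interpret h: comm_ring_hom h by fact
  interpret m: map_poly_comm_ring_hom h ..
  show "map_poly h (p * q) = map_poly h p * map_poly h q" by (rule m.hom_mult)
  assume "lead_coeff p = 1"
  then have 1: "coeff (map_poly h p) (degree p) = 1" by (simp add: coeff_map_poly)
  then show d: "degree (map_poly h p) = degree p"
    by (intro antisym[OF degree_map_poly_le]) (simp add: le_degree)
  show "lead_coeff (map_poly h p) = 1" using 1 by (simp add: d)
qed

lemma coeff_linear_power_Suc: "coeff ([:b, 1:] ^ Suc m) m = of_nat (Suc m) * (b::'a::comm_ring_1)"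
proof (induction m)
  case (Suc m)
  have 1: "coeff ([:b,1:] ^ Suc m) (Suc m) = 1"
    using coeff_linear_power[of b "Suc m"] by simp
  have "coeff ([:b, 1:] ^ Suc (Suc m)) (Suc m) = b * coeff ([:b,1:] ^ Suc m) (Suc m) + coeff ([:b,1:] ^ Suc m) m"
    by (subst power_Suc) (simp del: power_Suc add: coeff_pCons split: nat.split)
  then show ?case unfolding 1 Suc by (simp add: algebra_simps)
qed simp

text \<open>\<open>scale_poly r p\<close> is \<open>T^(r * degree p) * p(Y / T^r)\<close>.\<close>

definition scale_poly :: "nat \<Rightarrow> nat \<Rightarrow> complex fps poly \<Rightarrow> complex fps poly" where
  "scale_poly r n p = (\<Sum>i\<le>n. monom (coeff p i * fps_X ^ (r * (n - i))) i)"

lemma coeff_scale_poly: "degree p \<le> n \<Longrightarrow> coeff (scale_poly r n p) i = coeff p i * fps_X ^ (r * (n - i))"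
  by (auto simp: scale_poly_def coeff_sum coeff_eq_0)

lemma scale_poly_mult:
  assumes "degree p \<le> n" "degree q \<le> m"
  shows "scale_poly r (n + m) (p * q) = scale_poly r n p * scale_poly r m q"
proof (rule poly_eqI)
  fix j
  have "degree (p * q) \<le> n + m" using degree_mult_le[of p q] assms by linarith
  then have "coeff (scale_poly r (n + m) (p * q)) j = (\<Sum>i\<le>j. coeff p i * coeff q (j - i)) * fps_X ^ (r * (n + m - j))"
    by (simp add: coeff_scale_poly coeff_mult)
  also have "\<dots> = (\<Sum>i\<le>j. (coeff p i * fps_X ^ (r * (n - i))) * (coeff q (j - i) * fps_X ^ (r * (m - (j - i)))))"
    unfolding sum_distrib_right
  proof (rule sum.cong[OF refl])
    fix i assume i: "i \<in> {..j}"
    show "coeff p i * coeff q (j - i) * fps_X ^ (r * (n + m - j)) = (coeff p i * fps_X ^ (r * (n - i))) * (coeff q (j - i) * fps_X ^ (r * (m - (j - i))))"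
    proof (cases "i \<le> n \<and> j - i \<le> m")
      case True
      then have "n + m - j = (n - i) + (m - (j - i))" using i by auto
      then have "fps_X ^ (r * (n + m - j)) = (fps_X ^ (r * (n - i)) * fps_X ^ (r * (m - (j - i))) :: complex fps)"
        by (simp add: power_add[symmetric] distrib_left)
      then show ?thesis by (simp add: mult_ac)
    next
      case False
      then have "coeff p i = 0 \<or> coeff q (j - i) = 0" using assms by (metis coeff_eq_0 le_less_trans not_le)
      then show ?thesis by auto
    qed
  qed
  also have "\<dots> = coeff (scale_poly r n p * scale_poly r m q) j"
    using assms by (simp add: coeff_mult coeff_scale_poly)
  finally show "coeff (scale_poly r (n + m) (p * q)) j = coeff (scale_poly r n p * scale_poly r m q) j" .
qed

lemma scale_poly_monic:
  assumes "lead_coeff p = 1" shows "degree (scale_poly r (degree p) p) = degree p" "lead_coeff (scale_poly r (degree p) p) = 1"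
proof -
  show d: "degree (scale_poly r (degree p) p) = degree p"
  proof (rule antisym)
    show "degree (scale_poly r (degree p) p) \<le> degree p" by (intro degree_le) (auto simp: coeff_scale_poly coeff_eq_0)
    show "degree p \<le> degree (scale_poly r (degree p) p)" using assms by (intro le_degree) (simp add: coeff_scale_poly)
  qed
  show "lead_coeff (scale_poly r (degree p) p) = 1" using assms by (simp add: d coeff_scale_poly)
qed

lemma pcompose_linear_monic:
  fixes p :: "'a::idom poly" assumes "lead_coeff p = 1"
  shows "degree (pcompose p [:c,1:]) = degree p" "lead_coeff (pcompose p [:c,1:]) = 1"
  using assms lead_coeff_comp[of "[:c,1:]" p] by (simp_all add: degree_pcompose)

text \<open>Tschirnhaus shift: the choice c = coeff p (n - 1) / n kills the subleading
  coefficient.\<close>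

lemma depressed_coeff:
  fixes p :: "complex fps poly"
  assumes p: "lead_coeff p = 1" "degree p = n" "2 \<le> n"
  shows "coeff (pcompose p [:- c, 1:]) (n - 1) = coeff p (n - 1) - of_nat n * c"
proof -
  obtain m where n: "n = Suc (Suc m)" using p(3) by (metis add_2_eq_Suc le_Suc_ex)
  define a where "a = coeff p (Suc m)"
  define r where "r = p - monom 1 n - monom a (Suc m)"
  have "degree r \<le> m"
  proof (rule degree_le, intro allI impI)
    fix i assume "m < i"
    then consider "i = Suc m" | "i = n" | "n < i" using n by linarith
    then show "coeff r i = 0" using p by cases (auto simp: r_def a_def n coeff_eq_0)
  qed
  then have r0: "coeff (pcompose r [:-c,1:]) (Suc m) = 0" by (intro coeff_eq_0) (simp add: degree_pcompose)
  have mon: "pcompose (monom b k) [:-c,1:] = smult b ([:-c,1:] ^ k)" for b k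
    by (simp add: monom_altdef pcompose_smult pcompose_hom.hom_power pcompose_pCons)
  have "p = monom 1 n + monom a (Suc m) + r" by (simp add: r_def)
  then have "coeff (pcompose p [:-c,1:]) (Suc m) = coeff ([:-c,1:] ^ n) (Suc m) + a * coeff ([:-c,1:] ^ Suc m) (Suc m)"
    using r0 by (simp add: pcompose_add mon del: power_Suc)
  also have "coeff ([:-c,1:] ^ Suc m) (Suc m) = 1" using coeff_linear_power[of "-c" "Suc m"] by simp
  also have "coeff ([:-c,1:] ^ n) (Suc m) = - (of_nat n * c)" unfolding n coeff_linear_power_Suc by simp
  finally show ?thesis by (simp add: n a_def)
qed

lemma coprime_linear_power:
  fixes q :: "complex poly" assumes "poly q a \<noteq> 0" shows "coprime ([:-a,1:] ^ m) q"
proof -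
  have "irreducible [:-a,1:]" by (rule irreducible_linear_field_poly) simp
  moreover have "\<not> [:-a,1:] dvd q" using assms by (simp add: poly_eq_0_iff_dvd)
  ultimately have "coprime [:-a,1:] q" by (metis irreducible_imp_prime_elem_gcd prime_elem_imp_coprime)
  then show ?thesis by simp
qed

text \<open>One step of the Newton polygon. Once the subleading coefficient is gone and the roots
  are divided by X^r for the least slope r, the reduction modulo X has degree n, no subleading term
  and a further nonzero coefficient. Such a polynomial is no power of a linear one, so it has two
  coprime factors, and Hensel lifts them.\<close>

lemma puiseux_factor:
  fixes p :: "complex fps poly"
  assumes p: "lead_coeff p = 1" "degree p = n" "2 \<le> n"
  shows "\<exists>N>0. \<exists>p1 p2. map_poly (fps_subst N) p = p1 * p2 \<and> lead_coeff p1 = 1 \<and> lead_coeff p2 = 1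
     \<and> 0 < degree p1 \<and> 0 < degree p2 \<and> degree p1 + degree p2 = n"
proof -
  define c where "c = coeff p (n - 1) * fps_const (1 / of_nat n)"
  define q where "q = pcompose p [:- c, 1:]"
  have ncn: "of_nat n * fps_const (1 / of_nat n) = (1 :: complex fps)"
    using p(3) by (simp add: fps_of_nat[symmetric] flip: fps_const_mult)
  have q1: "degree q = n" "coeff q n = 1" using pcompose_linear_monic[OF p(1), of "-c"] p(2) by (simp_all add: q_def)
  have q2: "coeff q (n - 1) = 0" unfolding q_def depressed_coeff[OF p] c_def using ncn
    by (simp add: mult.left_commute[of "of_nat n"])
  have pq: "p = pcompose q [:c, 1:]" unfolding q_def by (simp add: pcompose_assoc[symmetric] pcompose_pCons)
  show ?thesis
  proof (cases "\<forall>i<n. coeff q i = 0")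
    case True
    have "q = monom 1 n" using True q1 by (intro poly_eqI) (metis coeff_eq_0 coeff_monom linorder_neqE_nat)
    then have "p = [:c,1:] ^ n" unfolding pq by (simp add: monom_altdef pcompose_hom.hom_power pcompose_pCons)
    then have "map_poly (fps_subst 1) p = [:c,1:] ^ 1 * [:c,1:] ^ (n - 1)"
      using p(3) by (simp only: map_poly_fps_subst_1 flip: power_add) simp
    moreover have "lead_coeff ([:c,1:] ^ k) = 1" "degree ([:c,1:] ^ k) = k" for k
      by (simp_all add: degree_linear_power coeff_linear_power)
    ultimately show ?thesis using p(3)
      by (intro exI[of _ "1::nat"] conjI exI[of _ "[:c,1:] ^ 1"] exI[of _ "[:c,1:] ^ (n - 1)"]) (simp_all del: power_one_right)
  next
    case False
    \<comment> \<open>The slope at i is the order of the coefficient divided by n - i; after the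
      ramification by M = n! all slopes are integers.\<close>
    define M where "M = (fact n :: nat)"
    have M: "0 < M" by (simp add: M_def)
    have dvdM: "(n - i) dvd M" if "i < n" for i unfolding M_def using that by (intro dvd_fact) auto
    define I where "I = {i. i < n \<and> coeff q i \<noteq> 0}"
    define R where "R i = subdegree (coeff q i) * (M div (n - i))" for i
    \<comment> \<open>With the least slope the scaled coefficients are still power series, and the
      one where the minimum is attained becomes a unit.\<close>
    define r where "r = Min (R ` I)"
    have I: "finite I" "I \<noteq> {}" using False by (auto simp: I_def)
    have "r \<in> R ` I" unfolding r_def using I by (intro Min_in) auto
    then obtain i0 where i0: "i0 \<in> I" "R i0 = r" by (metis imageE)
    have Rn: "R i * (n - i) = M * subdegree (coeff q i)" if "i \<in> I" for i
      using dvdM[of i] that by (simp add: R_def I_def mult.assoc)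
    interpret s: comm_ring_hom "fps_subst M" by (rule fps_subst_hom[OF M])
    define Q where "Q = map_poly (fps_subst M) q"
    have cQ: "coeff Q i = fps_subst M (coeff q i)" for i by (simp add: Q_def coeff_map_poly)
    have dvd: "fps_X ^ (r * (n - i)) dvd coeff Q i" if "i \<le> n" for i
    proof (cases "i \<in> I")
      case True
      then have "r \<le> R i" using I by (simp add: r_def)
      then have "r * (n - i) \<le> subdegree (coeff Q i)"
        using Rn[OF True] by (simp add: cQ fps_subst_subdegree[OF M]) (metis mult_le_mono1)
      then show ?thesis by (metis fps_shift_times_fps_X_power dvd_triv_right)
    qed (use that in \<open>auto simp: I_def cQ le_less\<close>)
    then obtain d where d: "\<And>i. i \<le> n \<Longrightarrow> coeff Q i = fps_X ^ (r * (n - i)) * d i" unfolding dvd_def by metis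
    define q' where "q' = (\<Sum>i\<le>n. monom (d i) i)"
    have cq': "coeff q' i = (if i \<le> n then d i else 0)" for i by (simp add: q'_def coeff_sum)
    have dn: "d n = 1" using d[of n] q1 by (simp add: cQ)
    have dq': "degree q' = n" by (intro antisym degree_le le_degree) (auto simp: cq' dn)
    have Qs: "Q = scale_poly r n q'"
    proof (rule poly_eqI)
      fix i show "coeff Q i = coeff (scale_poly r n q') i"
        using q1(1) d[of i] by (cases "i \<le> n") (auto simp: coeff_scale_poly dq' cq' cQ coeff_eq_0)
    qed
    define q0 where "q0 = map_poly (\<lambda>f. fps_nth f 0) q'"
    have cq0: "coeff q0 i = (if i \<le> n then fps_nth (d i) 0 else 0)" for i by (simp add: q0_def coeff_map_poly cq')
    have dq0: "degree q0 = n" by (intro antisym degree_le le_degree) (auto simp: cq0 dn)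
    have q0n: "coeff q0 (n - 1) = 0"
    proof -
      have "d (n - 1) = 0" using d[of "n - 1"] q2 by (simp add: cQ)
      then show ?thesis by (simp add: cq0)
    qed
    have i0n: "i0 < n" "coeff q0 i0 \<noteq> 0"
    proof -
      show "i0 < n" using i0 by (simp add: I_def)
      have nz: "coeff Q i0 \<noteq> 0"
      proof -
        have "fps_subst M (coeff q i0) \<noteq> 0" using i0 M by (simp add: fps_subst_def I_def fps_compose_eq_0_iff fps_X_power_nth)
        then show ?thesis by (simp add: cQ)
      qed
      have "subdegree (coeff Q i0) = r * (n - i0)" using Rn[OF i0(1)] i0(2) by (simp add: cQ fps_subst_subdegree[OF M])
      moreover have "coeff Q i0 = fps_X ^ (r * (n - i0)) * d i0" using d \<open>i0 < n\<close> by simp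
      ultimately have "subdegree (d i0) = 0" using nz by (auto simp: subdegree_mult)
      moreover have "d i0 \<noteq> 0" using nz d[of i0] \<open>i0 < n\<close> by auto
      ultimately show "coeff q0 i0 \<noteq> 0" using \<open>i0 < n\<close> by (simp add: cq0 subdegree_eq_0_iff)
    qed
    have "\<not> constant (poly q0)" using dq0 p(3) by (simp add: constant_degree)
    then obtain a where a: "poly q0 a = 0" using fundamental_theorem_of_algebra by blast
    define m where "m = Polynomial.order a q0"
    have q00: "q0 \<noteq> 0" using dq0 p(3) by auto
    obtain h where h: "q0 = [:-a,1:] ^ m * h" "\<not> [:-a,1:] dvd h" using order_decomp[OF q00, of a] by (auto simp: m_def)
    have m0: "0 < m" using a q00 order_root unfolding m_def by blast
    have h0: "h \<noteq> 0" using h q00 by auto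
    have mh: "m + degree h = n" using dq0 h(1) h0 by (simp add: degree_mult_eq degree_linear_power)
    have lh: "lead_coeff h = 1"
    proof -
      have "lead_coeff q0 = 1" by (simp add: dq0 cq0 dn)
      then show ?thesis using h(1) by (simp add: lead_coeff_mult lead_coeff_power)
    qed
    \<comment> \<open>Otherwise \<open>q0\<close> is (Y - a)^n; the missing subleading term gives a
      = 0, and then the coefficient at \<open>i0\<close> would vanish.\<close>
    have dh: "0 < degree h"
    proof (rule ccontr)
      assume "\<not> 0 < degree h"
      then have "h = 1" using lh by (metis degree_0_id gr0I one_pCons)
      then have q0: "q0 = [:-a,1:] ^ n" using h mh by simp
      have "coeff q0 (n - 1) = of_nat n * (- a)" unfolding q0 using coeff_linear_power_Suc[of "-a" "n - 1"] p(3) by simp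
      then have "a = 0" using q0n p(3) by simp
      then have "q0 = monom 1 n" using q0 by (simp add: monom_altdef)
      then show False using i0n by simp
    qed
    have "\<exists>p1 p2. q' = p1 * p2 \<and> lead_coeff p1 = 1 \<and> lead_coeff p2 = 1 \<and> degree p1 = degree ([:-a,1:] ^ m) \<and> degree p2 = degree h"
    proof (rule hensel)
      show "lead_coeff q' = 1" by (simp add: dq' cq' dn)
      show "map_poly (\<lambda>f. fps_nth f 0) q' = [:-a,1:] ^ m * h" using h by (simp add: q0_def)
      show "coprime ([:- a, 1:] ^ m) h" using h(2) by (intro coprime_linear_power) (simp add: poly_eq_0_iff_dvd)
    qed (use m0 dh lh in \<open>simp_all add: degree_linear_power coeff_linear_power\<close>)
    then obtain p1 p2 where P: "q' = p1 * p2" "lead_coeff p1 = 1" "lead_coeff p2 = 1" "degree p1 = m" "degree p2 = degree h"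
      by (auto simp: degree_linear_power)
    define S1 S2 where "S1 = scale_poly r m p1" and "S2 = scale_poly r (degree h) p2"
    have QS: "Q = S1 * S2" unfolding Qs P(1) S1_def S2_def mh[symmetric] using P by (intro scale_poly_mult) auto
    have S: "lead_coeff S1 = 1" "degree S1 = m" "lead_coeff S2 = 1" "degree S2 = degree h"
      using scale_poly_monic[OF P(2), of r] scale_poly_monic[OF P(3), of r] P(4,5) by (simp_all add: S1_def S2_def)
    define c' where "c' = fps_subst M c"
    have "map_poly (fps_subst M) p = pcompose Q [:c',1:]"
      unfolding pq Q_def c'_def by (subst s.map_poly_pcompose) (simp add: map_poly_hom_pCons[OF s.comm_ring_hom_axioms])
    also have "\<dots> = pcompose S1 [:c',1:] * pcompose S2 [:c',1:]" by (simp add: QS pcompose_mult)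
    finally show ?thesis using M m0 dh mh pcompose_linear_monic[OF S(1), of c'] pcompose_linear_monic[OF S(3), of c'] S(2,4)
      by (intro exI[of _ M] conjI exI[of _ "pcompose S1 [:c',1:]"] exI[of _ "pcompose S2 [:c',1:]"]) auto
  qed
qed

lemma puiseux:
  fixes p :: "complex fps poly"
  assumes "lead_coeff p = 1"
  shows "\<exists>N>0. \<exists>\<eta>. map_poly (fps_subst N) p = (\<Prod>k<degree p. [:- \<eta> k, 1:])"
  using assms
proof (induction "degree p" arbitrary: p rule: less_induct)
  case less
  consider "degree p = 0" | "degree p = 1" | "2 \<le> degree p" by linarith
  then show ?case
  proof cases
    case 1
    then have "p = 1" using less(2) by (metis degree_0_id one_pCons)
    then show ?thesis by (intro exI[of _ 1]) (simp add: map_poly_fps_subst_1[unfolded One_nat_def])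
  next
    case 2
    then have "p = [:coeff p 0, 1:]" using less(2) by (metis One_nat_def degree1_coeffs lead_coeff_pCons(1) coeff_pCons_0 one_neq_zero coeff_pCons_Suc)
    then have "map_poly (fps_subst 1) p = (\<Prod>k<degree p. [:- (- coeff p 0), 1:])"
      by (simp add: map_poly_fps_subst_1[unfolded One_nat_def] 2)
    then show ?thesis by (intro exI[of _ "1::nat"] conjI exI[of _ "\<lambda>_. - coeff p 0"]) simp_all
  next
    case 3
    from puiseux_factor[OF less(2) refl 3] obtain N p1 p2 where
      N: "0 < N" "map_poly (fps_subst N) p = p1 * p2" "lead_coeff p1 = 1" "lead_coeff p2 = 1"
       "0 < degree p1" "0 < degree p2" "degree p1 + degree p2 = degree p" by blast
    obtain N1 \<eta>1 where 1: "0 < N1" "map_poly (fps_subst N1) p1 = (\<Prod>k<degree p1. [:- \<eta>1 k, 1:])"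
      using less(1)[of p1] N by auto
    obtain N2 \<eta>2 where 2: "0 < N2" "map_poly (fps_subst N2) p2 = (\<Prod>k<degree p2. [:- \<eta>2 k, 1:])"
      using less(1)[of p2] N by auto
    have comp: "map_poly (fps_subst b) (map_poly (fps_subst a) q) = map_poly (fps_subst (a * b)) q" if "0 < a" "0 < b" for a b q
    proof -
      interpret a: comm_ring_hom "fps_subst a" by (rule fps_subst_hom) fact
      interpret b: comm_ring_hom "fps_subst b" by (rule fps_subst_hom) fact
      interpret ab: comm_ring_hom "fps_subst (a * b)" by (rule fps_subst_hom) (simp add: that)
      show ?thesis by (rule poly_eqI) (simp add: coeff_map_poly fps_subst_subst that)
    qed
    have lin: "map_poly (fps_subst a) (\<Prod>k<n. [:- \<eta> k, 1:]) = (\<Prod>k<n. [:- fps_subst a (\<eta> k), 1:])" if "0 < a" for a n \<eta>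
    proof -
      interpret a: comm_ring_hom "fps_subst a" by (rule fps_subst_hom) fact
      interpret m: map_poly_comm_ring_hom "fps_subst a" ..
      show ?thesis by (simp add: m.hom_prod map_poly_hom_pCons[OF a.comm_ring_hom_axioms] a.hom_uminus)
    qed
    have split: "(\<Prod>k<a + b. f k) = (\<Prod>k<a. f k) * (\<Prod>k<b. f (a + k))" for a b and f :: "nat \<Rightarrow> complex fps poly"
      by (induction b) (simp_all add: mult.assoc)
    \<comment> \<open>The two factors split after different ramifications N1 and N2; each list of
      roots is ramified by the index of the other to reach the common one.\<close>
    define \<eta> where "\<eta> k = (if k < degree p1 then fps_subst N2 (\<eta>1 k) else fps_subst N1 (\<eta>2 (k - degree p1)))" for k
    have "map_poly (fps_subst (N * (N1 * N2))) p = map_poly (fps_subst (N1 * N2)) (p1 * p2)"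
      using comp[of N "N1 * N2" p] N 1 2 by simp
    also have "\<dots> = map_poly (fps_subst N2) (map_poly (fps_subst N1) p1) * map_poly (fps_subst N1) (map_poly (fps_subst N2) p2)"
      using map_poly_hom_props(1)[OF fps_subst_hom, of "N1 * N2" p1 p2] 1(1) 2(1)
      by (simp add: comp[OF 1(1) 2(1)] comp[OF 2(1) 1(1)] mult.commute[of N2 N1])
    also have "\<dots> = (\<Prod>k<degree p1. [:- \<eta> k, 1:]) * (\<Prod>k<degree p2. [:- \<eta> (degree p1 + k), 1:])"
      unfolding 1 2 lin[OF 1(1)] lin[OF 2(1)] by (simp add: \<eta>_def)
    also have "\<dots> = (\<Prod>k<degree p. [:- \<eta> k, 1:])"
      unfolding N(7)[symmetric] by (rule split[symmetric])
    finally show ?thesis using N(1) 1(1) 2(1) by (intro exI[of _ "N * (N1 * N2)"]) auto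
  qed
qed

section \<open>Projection from a point off the curve, and resultants of forms\<close>

lemma homogeneous_lsub:
  assumes "homogeneous d F" shows "homogeneous d (lsub A F)"
proof -
  have l: "homogeneous 1 (lin K3 A X1 X2 X3 i)" for i
    unfolding lin_def by (intro homogeneous_add homogeneous_K3_mult homogeneous_X)
  have sum: "finite S \<Longrightarrow> (\<And>e. e \<in> S \<Longrightarrow> homogeneous d (f e)) \<Longrightarrow> homogeneous d (sum f S)" for S and f :: "nat \<times> nat \<times> nat \<Rightarrow> poly3"
    by (induction S rule: finite_induct) (auto intro: homogeneous_0 homogeneous_add)
  show ?thesis unfolding lsub_def ev3_expand[OF comm_ring_hom_K3]
  proof (rule sum[OF finite_exponents], clarify)
    fix i j k assume "(i,j,k) \<in> exponents F"
    then have d: "d = i * 1 + j * 1 + k * 1" using assms by (auto simp: homogeneous_def)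
    show "homogeneous d (K3 (coeff3 F (i, j, k)) * lin K3 A X1 X2 X3 1 ^ i * lin K3 A X1 X2 X3 2 ^ j * lin K3 A X1 X2 X3 3 ^ k)"
      unfolding d by (intro homogeneous_mult homogeneous_power homogeneous_K3_mult l)
  qed
qed

text \<open>A monomial of degree d that contains the d-th power of the third coordinate is that
  power. A form is therefore monic in the third coordinate, up to a constant, as soon as it does not
  vanish at (0, 0, 1).\<close>

lemma homogeneous_top_coeff:
  assumes "homogeneous d F"
  shows "degree F \<le> d" "coeff F d = [:[:coeff3 F (0,0,d):]:]" "ev3 (\<lambda>c. c) 0 0 1 F = coeff3 F (0,0,d)"
proof -
  have c: "coeff (coeff (coeff F k) j) i = 0" if "i + j + k \<noteq> d" for i j k
    using assms that by (auto simp: homogeneous_iff coeff3_def)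
  show "degree F \<le> d"
    by (rule degree_le) (metis (no_types, lifting) c coeff_0 leading_coeff_0_iff less_not_refl trans_less_add2)
  show "coeff F d = [:[:coeff3 F (0,0,d):]:]"
  proof (rule poly_eqI, rule poly_eqI)
    fix j i show "coeff (coeff (coeff F d) j) i = coeff (coeff [:[:coeff3 F (0,0,d):]:] j) i"
      using c[of i j d] by (cases i; cases j) (auto simp: coeff3_def)
  qed
  have "ev3 (\<lambda>c. c) 0 0 1 F = (\<Sum>e\<in>exponents F. if e = (0,0,d) then coeff3 F e else 0)"
    unfolding ev3_expand[OF comm_ring_hom_id]
    using assms by (intro sum.cong refl) (auto simp: homogeneous_def power_0_left split: if_splits)
  also have "\<dots> = coeff3 F (0,0,d)"
    using finite_exponents[of F] by (simp add: exponents_eq)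
  finally show "ev3 (\<lambda>c. c) 0 0 1 F = coeff3 F (0,0,d)" .
qed

lemma ev2_eq_0D:
  assumes "\<And>x y. x \<noteq> 0 \<Longrightarrow> ev2 (\<lambda>c. c) x y f = 0" shows "f = 0"
proof (rule poly_eqI)
  fix j
  have "poly (coeff f j) x = 0" if "x \<noteq> 0" for x
  proof -
    have "poly (map_poly (ev1 (\<lambda>c. c) x) f) y = 0" for y using assms[OF that, of y] by (simp add: ev2_def)
    then have "map_poly (ev1 (\<lambda>c. c) x) f = 0" by (simp add: poly_eq_poly_eq_iff[symmetric] fun_eq_iff)
    then have "coeff (map_poly (ev1 (\<lambda>c. c) x) f) j = 0" by simp
    then show ?thesis by (simp add: coeff_map_poly ev1_def)
  qed
  then have "- {0} \<subseteq> {x. poly (coeff f j) x = 0}" by auto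
  moreover have "infinite (- {0::complex})" by (simp add: infinite_UNIV_char_0 Compl_eq_Diff_UNIV)
  ultimately have "infinite {x. poly (coeff f j) x = 0}" using finite_subset by blast
  then show "coeff f j = coeff 0 j" using poly_roots_finite by auto
qed

lemma complex_poly_split:
  fixes p :: "complex poly" assumes "lead_coeff p = 1"
  obtains y where "p = (\<Prod>k<degree p. [:- y k, 1:])"
proof -
  obtain S where S: "size S = degree p" "p = smult (lead_coeff p) (\<Prod>x\<in>#S. [:-x,1:])"
    using alg_closed_imp_factorization[of p] assms by (metis leading_coeff_0_iff zero_neq_one)
  obtain l where l: "mset l = S" using ex_mset by blast
  have len: "length l = degree p" using S l by auto
  have "p = (\<Prod>x\<leftarrow>l. [:-x,1:])" using S(2) assms l by (simp flip: prod_mset_prod_list)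
  also have "\<dots> = (\<Prod>k<degree p. [:- (l ! k), 1:])" by (simp add: prod.list_conv_set_nth len lessThan_atLeast0)
  finally show ?thesis by (rule that)
qed

text \<open>An element of least degree in the ideal of \<open>P\<close> and \<open>Q\<close> divides
  both by Euclidean division, hence is a unit.\<close>

lemma irreducible_bezout:
  fixes P Q :: "'a::field poly"
  assumes P: "irreducible P" and Q: "\<not> P dvd Q" shows "\<exists>s r. s * P + r * Q = 1"
proof -
  define I where "I = {g. g \<noteq> 0 \<and> (\<exists>s r. g = s * P + r * Q)}"
  have "\<exists>s r. P = s * P + r * Q" by (rule exI[of _ 1], rule exI[of _ 0]) simp
  then have "P \<in> I" using P unfolding I_def by auto
  then obtain g where g: "g \<in> I" "\<And>g'. g' \<in> I \<Longrightarrow> degree g \<le> degree g'"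
    using ex_has_least_nat[of "\<lambda>g. g \<in> I" P degree] by blast
  then obtain s r where sr: "g = s * P + r * Q" "g \<noteq> 0" by (auto simp: I_def)
  have dvd: "g dvd f" if f: "\<exists>s r. f = s * P + r * Q" for f
  proof (rule ccontr)
    assume "\<not> g dvd f"
    then have ne: "f mod g \<noteq> 0" by (simp add: dvd_eq_mod_eq_0)
    obtain s' r' where f': "f = s' * P + r' * Q" using f by blast
    have "f mod g = f - g * (f div g)" by (metis minus_mult_div_eq_mod)
    also have "\<dots> = (s' - s * (f div g)) * P + (r' - r * (f div g)) * Q" by (subst f', subst sr(1)) (simp add: algebra_simps)
    finally have "f mod g \<in> I" using ne by (auto simp: I_def)
    then have "degree g \<le> degree (f mod g)" by (rule g(2))
    then show False using degree_mod_less'[OF sr(2) ne] by simp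
  qed
  have "g dvd P" by (rule dvd) (rule exI[of _ 1], rule exI[of _ 0], simp)
  moreover have gQ: "g dvd Q" by (rule dvd) (rule exI[of _ 0], rule exI[of _ 1], simp)
  ultimately have "g dvd 1" using P Q by (metis Factorial_Ring.irreducibleD' dvd_trans)
  then obtain u where "1 = g * u" by (metis dvdE)
  then have "(u * s) * P + (u * r) * Q = 1" using sr(1) by (simp add: algebra_simps)
  then show ?thesis by blast
qed

text \<open>\<open>A\<close> is a change of coordinates with inverse \<open>B\<close>. Its last
  column is the centre of projection; the centre lies off \<open>C\<close> so that the equation
  becomes monic in the third coordinate.\<close>

locale plane_chart =
  fixes C :: poly3 and d :: nat and A B :: "complex^3^3"
  assumes hom: "homogeneous d C" and irr: "irreducible C" and d0: "0 < d"
    and AB: "A ** B = mat 1" and BA: "B ** A = mat 1"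
    and vertex: "eval3 C (A *v vector [0,0,1]) \<noteq> 0"
begin

definition "\<kappa> = eval3 C (A *v vector [0,0,1])"
lemma kappa0: "\<kappa> \<noteq> 0" using vertex by (simp add: \<kappa>_def)

lemma ev3_lsub_complex: "ev3 (\<lambda>c. c) x y z (lsub A F) = eval3 F (A *v vector [x,y,z])"
  by (simp add: ev3_lsub[OF comm_ring_hom_id] lin_complex eval3_ev3)

lemma CA: "degree (lsub A C) = d" "coeff (lsub A C) d = [:[:\<kappa>:]:]"
proof -
  note h = homogeneous_lsub[OF hom, of A]
  have "coeff3 (lsub A C) (0,0,d) = \<kappa>"
    using homogeneous_top_coeff(3)[OF h] by (simp add: ev3_lsub_complex \<kappa>_def)
  then show c: "coeff (lsub A C) d = [:[:\<kappa>:]:]" using homogeneous_top_coeff(2)[OF h] by simp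
  show "degree (lsub A C) = d" 
    by (intro antisym homogeneous_top_coeff(1)[OF h] le_degree) (simp add: c kappa0)
qed

definition "monic_eq = smult [:[:1 / \<kappa>:]:] (lsub A C)"

lemma monic_eq: "degree monic_eq = d" "lead_coeff monic_eq = 1" "lsub A C = smult [:[:\<kappa>:]:] monic_eq"
proof -
  have k: "[:[:\<kappa>:]:] * [:[:1 / \<kappa>:]:] = (1 :: complex poly poly)" "[:[:1 / \<kappa>:]:] * [:[:\<kappa>:]:] = (1 :: complex poly poly)"
    using kappa0 by (simp_all add: one_pCons)
  show "lsub A C = smult [:[:\<kappa>:]:] monic_eq" by (simp only: monic_eq_def smult_smult k smult_1_left)
  show "degree monic_eq = d" using kappa0 CA(1) by (simp add: monic_eq_def)
  then show "lead_coeff monic_eq = 1" by (simp only: monic_eq_def coeff_smult CA k)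
qed

lemma map_poly_monic_eq:
  assumes "comm_ring_hom h" shows "map_poly h (lsub A C) = smult (h [:[:\<kappa>:]:]) (map_poly h monic_eq)"
    "degree (map_poly h monic_eq) = d" "lead_coeff (map_poly h monic_eq) = 1"
proof -
  interpret h: comm_ring_hom h by fact
  show "map_poly h (lsub A C) = smult (h [:[:\<kappa>:]:]) (map_poly h monic_eq)"
    by (subst monic_eq(3), rule poly_eqI) (simp only: coeff_map_poly h.hom_zero coeff_smult h.hom_mult)
  show "degree (map_poly h monic_eq) = d" "lead_coeff (map_poly h monic_eq) = 1"
    using map_poly_hom_props(2,3)[OF assms monic_eq(2)] monic_eq by auto
qed

text \<open>Up to a constant, the resultant with respect to the third coordinate: a binary form
  whose zeros are the lines through the centre that carry a common zero of \<open>C\<close> and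
  \<open>G\<close>.\<close>

definition "Res G = poly_norm monic_eq (lsub A G)"

lemma Res_split:
  fixes \<iota> :: "complex \<Rightarrow> 'r::idom"
  assumes "comm_ring_hom \<iota>" "map_poly (ev2 \<iota> x y) monic_eq = (\<Prod>k<d. [:- \<eta> k, 1:])"
  shows "ev2 \<iota> x y (Res G) = (\<Prod>k<d. ev3 \<iota> x y (\<eta> k) (lsub A G))"
  unfolding Res_def poly_norm_hom[OF ev2_hom[OF assms(1)] monic_eq(2)] assms(2) poly_norm_split
  by (simp add: ev3_def)

lemma complex_split:
  obtains \<eta> where "map_poly (ev2 (\<lambda>c. c) x y) monic_eq = (\<Prod>k<d. [:- \<eta> k, 1:])"
    "\<And>z. eval3 C (A *v vector [x,y,z]) = \<kappa> * (\<Prod>k<d. z - \<eta> k)"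
proof -
  note h = ev2_hom[OF comm_ring_hom_id]
  obtain \<eta> where \<eta>: "map_poly (ev2 (\<lambda>c. c) x y) monic_eq = (\<Prod>k<d. [:- \<eta> k, 1:])"
    using complex_poly_split[OF map_poly_monic_eq(3)[OF h]] map_poly_monic_eq(2)[OF h] by metis
  have "eval3 C (A *v vector [x,y,z]) = \<kappa> * (\<Prod>k<d. z - \<eta> k)" for z
    unfolding ev3_lsub_complex[symmetric] ev3_def map_poly_monic_eq(1)[OF h] \<eta>
    by (simp add: poly_prod ev_simps[OF comm_ring_hom_id])
  with \<eta> show ?thesis by (rule that)
qed

lemma Res_zeroD:
  assumes "ev2 (\<lambda>c. c) x y (Res G) = 0"
  obtains z where "eval3 C (A *v vector [x,y,z]) = 0" "eval3 G (A *v vector [x,y,z]) = 0"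
proof -
  obtain \<eta> where \<eta>: "map_poly (ev2 (\<lambda>c. c) x y) monic_eq = (\<Prod>k<d. [:- \<eta> k, 1:])"
    "\<And>z. eval3 C (A *v vector [x,y,z]) = \<kappa> * (\<Prod>k<d. z - \<eta> k)" using complex_split by metis
  obtain k where "k < d" "eval3 G (A *v vector [x,y,\<eta> k]) = 0"
    using assms Res_split[OF comm_ring_hom_id \<eta>(1), of G] by (auto simp: ev3_lsub_complex)
  then show ?thesis using \<eta>(2)[of "\<eta> k"] by (intro that[of "\<eta> k"]) auto
qed

text \<open>Scaling the first two coordinates by \<open>t\<close> scales the roots by
  \<open>t\<close>, so each factor of the product over the roots acquires t^e.\<close>

lemma Res_scale:
  assumes G: "homogeneous e G" and t: "t \<noteq> 0"
  shows "ev2 (\<lambda>c. c) (t * x) (t * y) (Res G) = t ^ (d * e) * ev2 (\<lambda>c. c) x y (Res G)"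
proof -
  note h = ev2_hom[OF comm_ring_hom_id]
  obtain \<eta> where \<eta>: "map_poly (ev2 (\<lambda>c. c) x y) monic_eq = (\<Prod>k<d. [:- \<eta> k, 1:])"
    "\<And>z. eval3 C (A *v vector [x,y,z]) = \<kappa> * (\<Prod>k<d. z - \<eta> k)" using complex_split by metis
  have "poly (map_poly (ev2 (\<lambda>c. c) (t*x) (t*y)) monic_eq) z = poly (\<Prod>k<d. [:- (t * \<eta> k), 1:]) z" for z
  proof -
    have "\<kappa> * poly (map_poly (ev2 (\<lambda>c. c) (t*x) (t*y)) monic_eq) z = ev3 (\<lambda>c. c) (t*x) (t*y) (t*(z/t)) (lsub A C)"
      using t unfolding ev3_def map_poly_monic_eq(1)[OF h] by (simp add: ev_simps[OF comm_ring_hom_id])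
    also have "\<dots> = t ^ d * (\<kappa> * (\<Prod>k<d. z/t - \<eta> k))"
      unfolding ev3_scale[OF comm_ring_hom_id homogeneous_lsub[OF hom]] by (simp add: ev3_lsub_complex \<eta>(2))
    also have "\<dots> = \<kappa> * (\<Prod>k<d. t * (z/t - \<eta> k))" by (simp add: prod.distrib)
    also have "\<dots> = \<kappa> * (\<Prod>k<d. z - t * \<eta> k)" using t by (simp add: algebra_simps)
    finally show ?thesis using kappa0 by (simp add: poly_prod)
  qed
  then have "map_poly (ev2 (\<lambda>c. c) (t*x) (t*y)) monic_eq = (\<Prod>k<d. [:- (t * \<eta> k), 1:])"
    by (simp add: poly_eq_poly_eq_iff[symmetric] fun_eq_iff)
  from Res_split[OF comm_ring_hom_id this, of G]
  have "ev2 (\<lambda>c. c) (t * x) (t * y) (Res G) = (\<Prod>k<d. t ^ e * ev3 (\<lambda>c. c) x y (\<eta> k) (lsub A G))"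
    by (simp add: ev3_scale[OF comm_ring_hom_id homogeneous_lsub[OF G]])
  also have "\<dots> = t ^ (d * e) * ev2 (\<lambda>c. c) x y (Res G)"
    using Res_split[OF comm_ring_hom_id \<eta>(1), of G] by (simp add: prod.distrib power_mult[symmetric] mult.commute)
  finally show ?thesis .
qed

text \<open>The two dehomogenizations of the binary form \<open>Res G\<close>, in t = y/x and in
  x/y.\<close>

definition "\<rho> G = ev2 (\<lambda>c. [:c:]) 1 [:0,1:] (Res G)"
definition "\<sigma> G = ev2 (\<lambda>c. [:c:]) [:0,1:] 1 (Res G)"

lemma comm_ring_hom_poly: "comm_ring_hom (\<lambda>p::complex poly. poly p x)"
  by unfold_locales simp_all

lemma poly_rho: "poly (\<rho> G) x = ev2 (\<lambda>c. c) 1 x (Res G)"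
  and poly_sigma: "poly (\<sigma> G) x = ev2 (\<lambda>c. c) x 1 (Res G)"
  unfolding \<rho>_def \<sigma>_def
  by (simp_all add: hom_ev2[OF comm_ring_hom_const_poly[OF comm_ring_hom_id] comm_ring_hom_poly[of x]])

lemma rho_sigma: "homogeneous e G \<Longrightarrow> x \<noteq> 0 \<Longrightarrow> poly (\<rho> G) x = x ^ (d * e) * poly (\<sigma> G) (1 / x)"
  using Res_scale[of e G x "1/x" 1] by (simp add: poly_rho poly_sigma)

lemma poly_eq_nonzeroI:
  fixes p q :: "complex poly" assumes "\<And>x. x \<noteq> 0 \<Longrightarrow> poly p x = poly q x" shows "p = q"
proof (rule ccontr)
  assume "p \<noteq> q"
  then have "finite {x. poly (p - q) x = 0}" by (intro poly_roots_finite) simp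
  moreover have "- {0} \<subseteq> {x. poly (p - q) x = 0}" using assms by auto
  moreover have "infinite (- {0::complex})" by (simp add: infinite_UNIV_char_0 Compl_eq_Diff_UNIV)
  ultimately show False using finite_subset by blast
qed

text \<open>Homogeneity of \<open>Res G\<close> is available for its values only. The bound comes
  from comparing \<open>\<rho>\<close> with the reflection of \<open>\<sigma>\<close> as
  polynomials.\<close>

lemma degree_rho: assumes "homogeneous e G" shows "degree (\<rho> G) \<le> d * e"
proof (cases "\<rho> G = 0")
  case False
  have "monom 1 (degree (\<sigma> G)) * \<rho> G = monom 1 (d * e) * reflect_poly (\<sigma> G)"
  proof (rule poly_eq_nonzeroI)
    fix x :: complex assume "x \<noteq> 0"
    then show "poly (monom 1 (degree (\<sigma> G)) * \<rho> G) x = poly (monom 1 (d * e) * reflect_poly (\<sigma> G)) x"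
      using rho_sigma[OF assms] by (simp add: poly_monom poly_reflect_poly_nz inverse_eq_divide)
  qed
  then have "degree (monom 1 (degree (\<sigma> G)) * \<rho> G) = degree (monom 1 (d * e) * reflect_poly (\<sigma> G))" by simp
  also have "\<dots> \<le> d * e + degree (reflect_poly (\<sigma> G))"
    using degree_mult_le[of "monom 1 (d * e)" "reflect_poly (\<sigma> G)"] by (simp add: degree_monom_eq)
  finally have "degree (\<sigma> G) + degree (\<rho> G) \<le> d * e + degree (reflect_poly (\<sigma> G))"
    using False by (simp add: degree_mult_eq degree_monom_eq monom_eq_0_iff)
  then show ?thesis using degree_reflect_poly_le[of "\<sigma> G"] by linarith
qed simp

text \<open>Without zeros off the line y = 0 the polynomial \<open>\<sigma>\<close> has no root and
  is constant; the whole intersection then sits at t = 0.\<close>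

lemma rho_eq_monom:
  assumes "homogeneous e G" "\<And>x. ev2 (\<lambda>c. c) x 1 (Res G) \<noteq> 0"
  obtains c where "c \<noteq> 0" "\<rho> G = monom c (d * e)"
proof -
  have "constant (poly (\<sigma> G))"
    using fundamental_theorem_of_algebra[of "\<sigma> G"] assms(2) by (auto simp: poly_sigma)
  then obtain c where c: "\<sigma> G = [:c:]" by (metis constant_degree degree_eq_zeroE)
  have "\<rho> G = monom c (d * e)"
    by (rule poly_eq_nonzeroI) (simp add: rho_sigma[OF assms(1)] c poly_monom)
  moreover have "c \<noteq> 0" using assms(2)[of 0] poly_sigma[of G 0] c by simp
  ultimately show ?thesis by (rule that[rotated])
qed

text \<open>If the resultant has no zero at any (x, 1), then \<open>\<rho>\<close> is a monomial of
  positive degree d*e and vanishes at t = 0, which gives the zero (1, 0).\<close>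

lemma common_zero:
  assumes G: "homogeneous e G" "0 < e"
  obtains v where "v \<noteq> 0" "eval3 C v = 0" "eval3 G v = 0"
proof -
  have "\<exists>x y. (x,y) \<noteq> (0,0) \<and> ev2 (\<lambda>c. c) x y (Res G) = 0"
  proof (rule ccontr)
    assume no: "\<not> ?thesis"
    then have "ev2 (\<lambda>c. c) x 1 (Res G) \<noteq> 0" for x by (metis prod.inject zero_neq_one)
    then obtain c where "\<rho> G = monom c (d * e)" using rho_eq_monom[OF G(1)] by metis
    then have "poly (\<rho> G) 0 = 0" using G d0 by (simp add: poly_monom)
    then show False using no by (metis poly_rho prod.inject zero_neq_one)
  qed
  then obtain x y where xy: "(x,y) \<noteq> (0,0)" "ev2 (\<lambda>c. c) x y (Res G) = 0" by blast
  then obtain z where z: "eval3 C (A *v vector [x,y,z]) = 0" "eval3 G (A *v vector [x,y,z]) = 0" using Res_zeroD by blast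
  have "A *v vector [x,y,z] \<noteq> 0"
  proof
    assume "A *v vector [x,y,z] = 0"
    then have "B *v (A *v vector [x,y,z]) = 0" by simp
    then have "vector [x,y,z] = (0 :: complex^3)" by (simp add: matrix_vector_mul_assoc BA)
    then have "(vector [x,y,z] :: complex^3) $ 1 = 0" "(vector [x,y,z] :: complex^3) $ 2 = 0" by (simp_all only: zero_index)
    then show False using xy by (simp add: vector_3)
  qed
  then show ?thesis using z by (rule that)
qed

text \<open>By Gauss's lemma \<open>C\<close> stays irreducible over the field of fractions of the
  first two variables. A Bezout identity there excludes a common root of \<open>C\<close> and
  \<open>G\<close> in the algebraic closure, where the norm is a product over the roots of
  \<open>C\<close>.\<close>

lemma Res_nonzero:
  assumes "\<not> C dvd G" shows "Res G \<noteq> 0"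
proof
  assume 0: "Res G = 0"
  define \<phi> :: "complex poly poly \<Rightarrow> complex poly poly fract alg_closure" where "\<phi> x = to_ac (to_fract x)" for x
  have tf: "comm_ring_hom (to_fract :: complex poly poly \<Rightarrow> _)" by unfold_locales simp_all
  have ta: "comm_ring_hom (to_ac :: complex poly poly fract \<Rightarrow> _)" by unfold_locales (simp_all add: to_ac_add to_ac_mult)
  have ph: "comm_ring_hom \<phi>" unfolding \<phi>_def[abs_def] by (rule comm_ring_hom_comp[OF ta tf])
  note m = map_poly_monic_eq[OF ph]
  obtain S where S: "size S = d" "map_poly \<phi> monic_eq = (\<Prod>x\<in>#S. [:-x,1:])"
    using alg_closed_imp_factorization[of "map_poly \<phi> monic_eq"] m(2,3) by (metis leading_coeff_0_iff smult_1_left zero_neq_one)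
  obtain l where l: "mset l = S" using ex_mset by blast
  have len: "length l = d" using S l by auto
  have "map_poly \<phi> monic_eq = (\<Prod>x\<leftarrow>l. [:-x,1:])" using S(2) l by (simp flip: prod_mset_prod_list)
  also have "\<dots> = (\<Prod>k<d. [:- (l ! k), 1:])" by (simp add: prod.list_conv_set_nth len lessThan_atLeast0)
  finally have split: "map_poly \<phi> monic_eq = (\<Prod>k<d. [:- (l ! k), 1:])" .
  have "\<phi> (Res G) = (\<Prod>k<d. poly (map_poly \<phi> (lsub A G)) (l ! k))"
    unfolding Res_def poly_norm_hom[OF ph monic_eq(2)] split poly_norm_split ..
  then obtain k where k: "k < d" "poly (map_poly \<phi> (lsub A G)) (l ! k) = 0"
    using 0 by (auto simp: \<phi>_def)
  have k': "poly (map_poly \<phi> monic_eq) (l ! k) = 0" using k(1) unfolding split by (auto simp: poly_prod)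
  define P Q where "P = map_poly to_fract (lsub A C)" and "Q = map_poly to_fract (lsub A G)"
  have ac: "map_poly to_ac (map_poly to_fract F) = map_poly \<phi> F" for F :: poly3
    by (rule poly_eqI) (simp add: coeff_map_poly \<phi>_def)
  have irrA: "irreducible (lsub A C)" by (rule lsub_irreducible[OF BA AB irr])
  then have irrP: "irreducible P" "content (lsub A C) = 1"
    using nonconst_poly_irreducible_iff[of "lsub A C"] CA(1) d0 by (auto simp: P_def)
  have "\<not> P dvd Q" using fract_poly_dvdD[of "lsub A C" "lsub A G"] irrP(2) lsub_dvd[OF AB, of C G] assms
    by (auto simp: P_def Q_def)
  then obtain s r where "s * P + r * Q = 1" using irreducible_bezout[OF irrP(1)] by blast
  then have "map_poly to_ac (s * P + r * Q) = 1" by (simp add: map_poly_1')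
  moreover have "map_poly to_ac (s * P + r * Q) = map_poly to_ac s * map_poly \<phi> (lsub A C) + map_poly to_ac r * map_poly \<phi> (lsub A G)"
  proof -
    interpret ta: comm_ring_hom "to_ac :: complex poly poly fract \<Rightarrow> _" by (rule ta)
    interpret mm: map_poly_comm_ring_hom "to_ac :: complex poly poly fract \<Rightarrow> _" ..
    show ?thesis by (simp add: mm.hom_add mm.hom_mult P_def Q_def ac)
  qed
  ultimately have "poly (map_poly to_ac s * map_poly \<phi> (lsub A C) + map_poly to_ac r * map_poly \<phi> (lsub A G)) (l ! k) = 1" by simp
  then show False using k k' unfolding m(1) by simp
qed

lemma rho_nonzero: assumes "homogeneous e G" "\<not> C dvd G" shows "\<rho> G \<noteq> 0"
proof
  assume 0: "\<rho> G = 0"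
  have "Res G = 0"
  proof (rule ev2_eq_0D)
    fix x y :: complex assume "x \<noteq> 0"
    then show "ev2 (\<lambda>c. c) x y (Res G) = 0"
      using Res_scale[OF assms(1), of x 1 "y/x"] poly_rho[of G "y/x"] 0 by simp
  qed
  then show False using Res_nonzero assms by blast
qed

end

section \<open>Puiseux roots over t = 0 and orders of forms along them\<close>

locale branches = plane_chart +
  fixes N :: nat and \<eta> :: "nat \<Rightarrow> complex fps"
  assumes N0: "0 < N"
    and split: "map_poly (ev2 fps_const 1 (fps_X ^ N)) monic_eq = (\<Prod>k<d. [:- \<eta> k, 1:])"
begin

text \<open>The restriction of \<open>G\<close> to the arc X -> (1, X^N, \<eta>_k(X)) of the chart.
  Conjugate roots parametrize the same branch and are counted separately.\<close>

definition place :: "nat \<Rightarrow> poly3 \<Rightarrow> complex fps" where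
  "place k G = ev3 fps_const 1 (fps_X ^ N) (\<eta> k) (lsub A G)"

definition val :: "nat \<Rightarrow> poly3 \<Rightarrow> nat" where "val k G = subdegree (place k G)"

definition center :: "nat \<Rightarrow> complex^3" where "center k = A *v vector [1, 0, fps_nth (\<eta> k) 0]"

lemma place_hom: "comm_ring_hom (place k)"
  unfolding place_def[abs_def] by (intro comm_ring_hom_comp[OF ev3_hom lsub_hom] comm_ring_hom_fps_const)

lemma place_expand: "place k G = ev3 fps_const (lin fps_const A 1 (fps_X ^ N) (\<eta> k) 1)
    (lin fps_const A 1 (fps_X ^ N) (\<eta> k) 2) (lin fps_const A 1 (fps_X ^ N) (\<eta> k) 3) G"
  unfolding place_def by (rule ev3_lsub[OF comm_ring_hom_fps_const])

lemma comm_ring_hom_fps_nth_0: "comm_ring_hom (\<lambda>f::complex fps. fps_nth f 0)"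
  by unfold_locales simp_all

lemma place_nth_0: "fps_nth (place k G) 0 = eval3 G (center k)"
  unfolding place_def hom_ev3[OF comm_ring_hom_fps_const comm_ring_hom_fps_nth_0]
  using N0 by (simp add: center_def fps_X_power_nth flip: ev3_lsub_complex)

lemma center_nonzero: "center k \<noteq> 0"
proof
  assume "center k = 0"
  then have "B *v (center k) = 0" by simp
  then have "vector [1, 0, fps_nth (\<eta> k) 0] = (0 :: complex^3)" by (simp add: center_def matrix_vector_mul_assoc BA)
  then have "(vector [1, 0, fps_nth (\<eta> k) 0] :: complex^3) $ 1 = 0" by (simp only: zero_index)
  then show False by (simp add: vector_3)
qed

lemma place_C: assumes "k < d" shows "place k C = 0"
proof -
  have "poly (\<Prod>k<d. [:- \<eta> k, 1:]) (\<eta> k) = 0" using assms by (auto simp: poly_prod)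
  then show ?thesis
    unfolding place_def ev3_def map_poly_monic_eq(1)[OF ev2_hom[OF comm_ring_hom_fps_const]] split by simp
qed

text \<open>The product over all roots is the resultant, which is a polynomial in t = X^N. So the
  orders along the roots add up to N times the order of \<open>\<rho>\<close> at 0.\<close>

lemma prod_place: "(\<Prod>k<d. place k G) = poly (map_poly fps_const (\<rho> G)) (fps_X ^ N)"
proof -
  have h: "comm_ring_hom (ev1 fps_const (fps_X ^ N :: complex fps))" by (rule ev1_hom[OF comm_ring_hom_fps_const])
  interpret h: comm_ring_hom "ev1 fps_const (fps_X ^ N :: complex fps)" by (rule h)
  have "ev1 fps_const (fps_X ^ N) (\<rho> G) = ev2 fps_const 1 (fps_X ^ N) (Res G)"
    unfolding \<rho>_def hom_ev2[OF comm_ring_hom_const_poly[OF comm_ring_hom_id] h]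
    by (simp add: ev_simps[OF comm_ring_hom_fps_const])
  also have "\<dots> = (\<Prod>k<d. place k G)"
    using Res_split[OF comm_ring_hom_fps_const split, of G] by (simp add: place_def)
  finally show ?thesis by (simp add: ev1_def)
qed

lemma poly_fps_X_power:
  "poly (map_poly fps_const p) (fps_X ^ N) = fps_subst N (Abs_fps (coeff p))"
proof -
  interpret s: comm_ring_hom "fps_subst N" by (rule fps_subst_hom[OF N0])
  have "poly (map_poly fps_const p) fps_X = Abs_fps (coeff p)"
  proof (induction p)
    case (pCons a p)
    have "Abs_fps (coeff (pCons a p)) = fps_const a + fps_X * Abs_fps (coeff p)"
      by (rule fps_ext) (simp add: coeff_pCons split: nat.split)
    then show ?case using pCons by (simp add: map_poly_hom_pCons[OF comm_ring_hom_fps_const])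
  qed (simp add: fps_eq_iff)
  moreover have "fps_subst N (poly (map_poly fps_const p) fps_X) = poly (map_poly fps_const p) (fps_X ^ N)"
  proof -
    have "map_poly (fps_subst N) (map_poly fps_const p) = map_poly fps_const p"
      by (rule poly_eqI) (simp add: coeff_map_poly fps_subst_const)
    then show ?thesis by (metis s.poly_map_poly fps_subst_X[OF N0])
  qed
  ultimately show ?thesis by simp
qed

lemma place_nonzero:
  assumes "homogeneous e G" "\<not> C dvd G" "k < d" shows "place k G \<noteq> 0"
proof
  assume "place k G = 0"
  then have "(\<Prod>k<d. place k G) = 0" using assms(3) by auto
  then have "Abs_fps (coeff (\<rho> G)) = 0"
    unfolding prod_place poly_fps_X_power fps_subst_def using N0 by (simp add: fps_compose_eq_0_iff fps_X_power_nth)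
  then have "coeff (\<rho> G) i = 0" for i by (metis fps_nth_Abs_fps fps_zero_nth)
  then have "\<rho> G = 0" by (intro poly_eqI) simp
  then show False using rho_nonzero[OF assms(1,2)] by simp
qed

lemma sum_val:
  assumes "homogeneous e G" "\<not> C dvd G"
  shows "(\<Sum>k<d. val k G) = N * subdegree (Abs_fps (coeff (\<rho> G)))"
proof -
  have "subdegree (\<Prod>k\<in>S. place k G) = (\<Sum>k\<in>S. val k G)" if "S \<subseteq> {..<d}" for S
  proof -
    have "finite S" using that finite_subset by blast
    then show ?thesis using that
    proof (induction S rule: finite_induct)
      case (insert k S)
      have "place k G \<noteq> 0" "(\<Prod>k\<in>S. place k G) \<noteq> 0"
        using place_nonzero[OF assms] insert by auto
      then show ?case using insert by (simp add: val_def)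
    qed simp
  qed
  from this[of "{..<d}"] show ?thesis
    unfolding prod_place poly_fps_X_power using N0 by (simp add: fps_subst_subdegree)
qed

text \<open>Only common zeros over t = 0 are counted here, hence an inequality;
  \<open>bezout_eq\<close> covers the case where there are no others.\<close>

lemma bezout_le:
  assumes "homogeneous e G" "\<not> C dvd G"
  shows "(\<Sum>k<d. val k G) \<le> N * (d * e)"
proof -
  have "subdegree (Abs_fps (coeff (\<rho> G))) \<le> degree (\<rho> G)"
    by (rule subdegree_leI) (simp add: rho_nonzero[OF assms])
  then show ?thesis using degree_rho[OF assms(1)] unfolding sum_val[OF assms] by (meson le_trans mult_le_mono2)
qed

lemma bezout_eq:
  assumes "homogeneous e G" "\<not> C dvd G"
    and "\<And>x z. eval3 C (A *v vector [x,1,z]) = 0 \<Longrightarrow> eval3 G (A *v vector [x,1,z]) \<noteq> 0"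
  shows "(\<Sum>k<d. val k G) = N * (d * e)"
proof -
  have "ev2 (\<lambda>c. c) x 1 (Res G) \<noteq> 0" for x using Res_zeroD[of x 1 G] assms(3) by metis
  then obtain c where c: "c \<noteq> 0" "\<rho> G = monom c (d * e)" using rho_eq_monom[OF assms(1)] by metis
  have "subdegree (Abs_fps (coeff (\<rho> G))) = d * e" using c by (intro subdegreeI) (auto simp: c)
  then show ?thesis by (simp add: sum_val[OF assms(1,2)])
qed

lemma card_le_sum_val:
  "eval3 G (center k) \<noteq> 0 \<Longrightarrow> val k G = 0"
  by (simp add: val_def place_nth_0[symmetric])

text \<open>Setting X = 0 in the Puiseux factorization gives the factorization of the fibre over t =
  0, so each point of that fibre is the centre of a root.\<close>

lemma exists_center:
  assumes "eval3 C (A *v vector [1,0,z]) = 0" obtains k where "k < d" "fps_nth (\<eta> k) 0 = z"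
proof -
  have m: "map_poly (\<lambda>f. fps_nth f 0) (map_poly (ev2 fps_const 1 (fps_X ^ N)) monic_eq) = map_poly (ev2 (\<lambda>c. c) 1 0) monic_eq"
  proof (rule poly_eqI)
    fix n
    interpret h: comm_ring_hom "ev2 fps_const 1 (fps_X ^ N :: complex fps)" by (rule ev2_hom[OF comm_ring_hom_fps_const])
    interpret g: comm_ring_hom "ev2 (\<lambda>c::complex. c) 1 0" by (rule ev2_hom[OF comm_ring_hom_id])
    show "coeff (map_poly (\<lambda>f. fps_nth f 0) (map_poly (ev2 fps_const 1 (fps_X ^ N)) monic_eq)) n = coeff (map_poly (ev2 (\<lambda>c. c) 1 0) monic_eq) n"
      using hom_ev2[OF comm_ring_hom_fps_const comm_ring_hom_fps_nth_0, of 1 "fps_X ^ N" "coeff monic_eq n"] N0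
      by (simp add: coeff_map_poly fps_X_power_nth)
  qed
  interpret n: comm_ring_hom "\<lambda>f::complex fps. fps_nth f 0" by (rule comm_ring_hom_fps_nth_0)
  interpret mn: map_poly_comm_ring_hom "\<lambda>f::complex fps. fps_nth f 0" ..
  have "map_poly (ev2 (\<lambda>c. c) 1 0) monic_eq = (\<Prod>k<d. [:- fps_nth (\<eta> k) 0, 1:])"
    unfolding m[symmetric] split by (simp add: mn.hom_prod map_poly_hom_pCons[OF comm_ring_hom_fps_nth_0])
  moreover have "poly (map_poly (ev2 (\<lambda>c. c) 1 0) monic_eq) z = 0"
    using assms kappa0 unfolding ev3_lsub_complex[symmetric] ev3_def map_poly_monic_eq(1)[OF ev2_hom[OF comm_ring_hom_id]]
    by (simp add: ev_simps[OF comm_ring_hom_id])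
  ultimately obtain k where "k < d" "z - fps_nth (\<eta> k) 0 = 0" by (auto simp: poly_prod)
  then show ?thesis by (intro that[of k]) auto
qed

end

lemma (in plane_chart) exists_branches: obtains N \<eta> where "branches C d A B N \<eta>"
proof -
  define p where "p = map_poly (ev2 fps_const 1 fps_X) monic_eq"
  have h: "comm_ring_hom (ev2 fps_const 1 (fps_X :: complex fps))" by (rule ev2_hom[OF comm_ring_hom_fps_const])
  obtain N \<eta> where N: "0 < N" "map_poly (fps_subst N) p = (\<Prod>k<degree p. [:- \<eta> k, 1:])"
    using puiseux[of p] map_poly_monic_eq(3)[OF h] unfolding p_def by blast
  have "map_poly (fps_subst N) p = map_poly (ev2 fps_const 1 (fps_X ^ N)) monic_eq"
  proof (rule poly_eqI)
    fix n
    interpret h: comm_ring_hom "ev2 fps_const 1 (fps_X ^ N :: complex fps)" by (rule ev2_hom[OF comm_ring_hom_fps_const])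
    interpret g: comm_ring_hom "ev2 fps_const 1 (fps_X :: complex fps)" by (rule ev2_hom[OF comm_ring_hom_fps_const])
    interpret s: comm_ring_hom "fps_subst N" by (rule fps_subst_hom[OF N(1)])
    show "coeff (map_poly (fps_subst N) p) n = coeff (map_poly (ev2 fps_const 1 (fps_X ^ N)) monic_eq) n"
      using hom_ev2[OF comm_ring_hom_fps_const s.comm_ring_hom_axioms, of 1 fps_X "coeff monic_eq n"]
      by (simp add: coeff_map_poly p_def fps_subst_const fps_subst_X[OF N(1)])
  qed
  then have "branches C d A B N \<eta>"
    using N map_poly_monic_eq(2)[OF h] by unfold_locales (simp_all add: p_def)
  then show ?thesis by (rule that)
qed

subsection \<open>The ring of formal power series inside the Laurent series\<close>

text \<open>The valuation ring of the Laurent series; \<open>residue0\<close> is its residue map and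
  is multiplicative on regular elements.\<close>

definition regular :: "complex fls \<Rightarrow> bool" where "regular y \<longleftrightarrow> (\<exists>f. y = fps_to_fls f)"
definition residue0 :: "complex fls \<Rightarrow> complex" where "residue0 y = fls_nth y 0"

lemma fps_to_fls_hom: "comm_ring_hom (fps_to_fls :: complex fps \<Rightarrow> _)"
  by unfold_locales (simp_all add: fps_to_fls_plus fls_times_fps_to_fls)

lemma regular_subring: "subring_set {y. regular y}"
proof -
  have "regular (- x)" if "regular x" for x using that unfolding regular_def by (metis fps_to_fls_uminus)
  moreover have "regular (x + y)" "regular (x * y)" if "regular x" "regular y" for x y
    using that unfolding regular_def by (metis fps_to_fls_plus, metis fls_times_fps_to_fls)
  moreover have "regular 1" unfolding regular_def by (rule exI[of _ 1]) simp
  ultimately show ?thesis by (simp add: subring_set_def)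
qed

lemma residue0_fps: "residue0 (fps_to_fls f) = fps_nth f 0"
  by (simp add: residue0_def)

lemma residue0_add: "regular x \<Longrightarrow> regular y \<Longrightarrow> residue0 (x + y) = residue0 x + residue0 y"
  by (simp add: residue0_def)
lemma residue0_mult: "regular x \<Longrightarrow> regular y \<Longrightarrow> residue0 (x * y) = residue0 x * residue0 y"
  unfolding regular_def by (auto simp: residue0_fps fls_times_fps_to_fls[symmetric])
lemma residue0_1: "residue0 1 = 1" by (simp add: residue0_def)

lemma regular_iff: "regular y \<longleftrightarrow> 0 \<le> fls_subdegree y"
  unfolding regular_def using fls_subdegree_fls_to_fps_gt0 fls_regpart_to_fls_trivial by metis

lemma regular_divide:
  assumes "regular x" "regular y" "residue0 y \<noteq> 0" shows "regular (x / y)"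
proof -
  have "fls_nth y 0 \<noteq> 0" using assms(3) by (simp add: residue0_def)
  then have "fls_subdegree y \<le> 0" by (rule fls_subdegree_leI)
  moreover have "y \<noteq> 0" using assms(3) by (auto simp: residue0_def)
  ultimately have "fls_subdegree (x / y) = fls_subdegree x - fls_subdegree y" if "x \<noteq> 0"
    using that by (simp add: fls_divide_subdegree)
  then show ?thesis using assms \<open>fls_subdegree y \<le> 0\<close> by (cases "x = 0") (auto simp: regular_iff)
qed

lemma regular_or_inverse: "regular y \<or> regular (1 / y)"
proof (cases "y = 0")
  case False
  then have "fls_subdegree (1 / y) = - fls_subdegree y" by (simp add: fls_divide_subdegree)
  then show ?thesis by (auto simp: regular_iff)
qed (simp add: regular_iff)

text \<open>A valuation ring is integrally closed: if \<open>z\<close> is not regular then 1/z is,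
  and the equation divided by z^(n - 1) expresses \<open>z\<close> through regular elements.\<close>

lemma int_over_regular:
  assumes A: "\<And>x. x \<in> A \<Longrightarrow> regular x" and z: "int_over A z" shows "regular z"
proof (rule ccontr)
  assume n: "\<not> regular z"
  then have w: "regular (1 / z)" "z \<noteq> 0" using regular_or_inverse[of z] by (auto simp: regular_iff)
  obtain n a where a: "\<forall>i<n. a i \<in> A" "z ^ n + (\<Sum>i<n. a i * z ^ i) = 0" using z unfolding int_over_def by blast
  have n0: "n \<noteq> 0" using a(2) by (metis add.right_neutral lessThan_0 power_0 sum.empty zero_neq_one)
  then obtain m where m: "n = Suc m" using not0_implies_Suc by blast
  have "z ^ n = - (\<Sum>i<n. a i * z ^ i)" using a(2) by (simp add: eq_neg_iff_add_eq_0)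
  then have "z * z ^ m = - (\<Sum>i<n. a i * z ^ i)" by (simp add: m)
  then have "z = - (\<Sum>i<n. a i * z ^ i) / z ^ m" using w(2) by (metis nonzero_mult_div_cancel_right power_not_zero)
  also have "\<dots> = (\<Sum>i<n. (- a i) * (1/z) ^ (m - i))"
    unfolding minus_divide_left sum_divide_distrib sum_negf[symmetric]
  proof (intro sum.cong refl)
    fix i assume "i \<in> {..<n}"
    then have "z ^ m = z ^ i * z ^ (m - i)" using m by (simp flip: power_add)
    then show "- (a i * z ^ i) / z ^ m = - a i * (1 / z) ^ (m - i)" using w(2) by (simp add: power_divide)
  qed
  also have "regular \<dots>"
  proof -
    note R = regular_subring
    have pow: "regular ((1/z) ^ k)" for k
    proof (induction k)
      case (Suc k)
      then show ?case unfolding power_Suc using subring_setD(4)[OF R, of "1/z" "(1/z)^k"] w(1) by simp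
    qed (use subring_setD(1)[OF R] in simp)
    have "(\<Sum>i<n. (- a i) * (1/z) ^ (m - i)) \<in> {y. regular y}"
      using a(1) A pow by (intro subring_set_sum[OF R] subring_setD(4)[OF R] subring_setD(2)[OF R]) auto
    then show ?thesis by simp
  qed
  finally show False using n by simp
qed

subsection \<open>Rings embedded in a field\<close>

abbreviation type_ring :: "'a::comm_ring_1 ring" where "type_ring \<equiv> ring_of_type_algebra"

lemma type_ring_simps: "carrier type_ring = UNIV" "x \<otimes>\<^bsub>type_ring\<^esub> y = x * y" "x \<oplus>\<^bsub>type_ring\<^esub> y = x + y"
  "\<one>\<^bsub>type_ring\<^esub> = 1" "\<zero>\<^bsub>type_ring\<^esub> = 0"
  by (simp_all add: ring_of_type_algebra_def)

lemma type_ring_pow: "x [^]\<^bsub>type_ring\<^esub> (n::nat) = x ^ n"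
proof -
  interpret ring type_ring by (rule ring_from_type_algebra)
  show ?thesis by (induction n) (simp_all add: type_ring_simps mult.commute)
qed

lemma type_ring_finsum: "finsum type_ring f {..<n::nat} = (\<Sum>i<n. f i)"
proof -
  interpret ring type_ring by (rule ring_from_type_algebra)
  show ?thesis
  proof (induction n)
    case (Suc n)
    have "finsum type_ring f (insert n {..<n}) = f n + finsum type_ring f {..<n}"
      by (subst finsum_insert) (auto simp: type_ring_simps)
    then show ?case using Suc by (simp add: lessThan_Suc add.commute)
  qed (simp add: type_ring_simps)
qed

text \<open>Moves integrality from the ring record to a field type; injectivity of
  \<open>\<Theta>\<close> brings equations in the image back.\<close>

lemma int_over_hom:
  fixes \<Theta> :: "'b \<Rightarrow> 'a::field"
  assumes h: "ring_hom_ring K type_ring \<Theta>" and inj: "inj_on \<Theta> (carrier K)"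
    and A0: "A0 \<subseteq> carrier K" and z: "z \<in> carrier K"
  shows "z \<in> integral_closure K A0 \<longleftrightarrow> int_over (\<Theta> ` A0) (\<Theta> z)"
proof -
  interpret h: ring_hom_ring K type_ring \<Theta> by (rule h)
  have eq: "(z [^]\<^bsub>K\<^esub> n \<oplus>\<^bsub>K\<^esub> (\<Oplus>\<^bsub>K\<^esub>i\<in>{..<n}. a i \<otimes>\<^bsub>K\<^esub> z [^]\<^bsub>K\<^esub> i) = \<zero>\<^bsub>K\<^esub>)
     \<longleftrightarrow> (\<Theta> z) ^ n + (\<Sum>i<n. \<Theta> (a i) * \<Theta> z ^ i) = 0" if a: "\<forall>i<n::nat. a i \<in> A0" for n a
  proof -
    have aK: "a i \<in> carrier K" if "i < n" for i using a A0 that by auto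
    have c: "(\<lambda>i. a i \<otimes>\<^bsub>K\<^esub> z [^]\<^bsub>K\<^esub> i) \<in> {..<n} \<rightarrow> carrier K"
      using aK z by (intro Pi_I h.R.m_closed h.R.nat_pow_closed) simp_all
    then have s: "(\<Oplus>\<^bsub>K\<^esub>i\<in>{..<n}. a i \<otimes>\<^bsub>K\<^esub> z [^]\<^bsub>K\<^esub> i) \<in> carrier K" by (rule h.R.finsum_closed)
    have "\<Theta> (\<Oplus>\<^bsub>K\<^esub>i\<in>{..<n}. a i \<otimes>\<^bsub>K\<^esub> z [^]\<^bsub>K\<^esub> i) = (\<Sum>i<n. \<Theta> (a i \<otimes>\<^bsub>K\<^esub> z [^]\<^bsub>K\<^esub> i))"
      unfolding UnivPoly.ring_hom_ring.hom_finsum[OF h c] type_ring_finsum comp_def ..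
    also have "\<dots> = (\<Sum>i<n. \<Theta> (a i) * \<Theta> z ^ i)"
      using aK z by (intro sum.cong refl) (simp only: h.hom_mult h.hom_nat_pow h.R.nat_pow_closed type_ring_simps type_ring_pow lessThan_iff)
    finally have th: "\<Theta> (z [^]\<^bsub>K\<^esub> n \<oplus>\<^bsub>K\<^esub> (\<Oplus>\<^bsub>K\<^esub>i\<in>{..<n}. a i \<otimes>\<^bsub>K\<^esub> z [^]\<^bsub>K\<^esub> i)) = (\<Theta> z) ^ n + (\<Sum>i<n. \<Theta> (a i) * \<Theta> z ^ i)"
      using s z by (simp only: h.hom_add h.hom_nat_pow h.R.nat_pow_closed type_ring_simps type_ring_pow)
    have z0: "\<Theta> y = 0 \<longleftrightarrow> y = \<zero>\<^bsub>K\<^esub>" if "y \<in> carrier K" for y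
    proof -
      have "\<Theta> \<zero>\<^bsub>K\<^esub> = 0" using h.hom_zero by (simp only: type_ring_simps)
      then show ?thesis using inj_onD[OF inj, of y "\<zero>\<^bsub>K\<^esub>"] that h.R.zero_closed by metis
    qed
    have carr: "z [^]\<^bsub>K\<^esub> n \<oplus>\<^bsub>K\<^esub> (\<Oplus>\<^bsub>K\<^esub>i\<in>{..<n}. a i \<otimes>\<^bsub>K\<^esub> z [^]\<^bsub>K\<^esub> i) \<in> carrier K"
      using s z by (intro h.R.add.m_closed h.R.nat_pow_closed)
    show ?thesis using z0[OF carr] unfolding th by (rule sym)
  qed
  show ?thesis
  proof
    assume "z \<in> integral_closure K A0"
    then obtain n a where na: "\<forall>i<n::nat. a i \<in> A0" "z [^]\<^bsub>K\<^esub> n \<oplus>\<^bsub>K\<^esub> (\<Oplus>\<^bsub>K\<^esub>i\<in>{..<n}. a i \<otimes>\<^bsub>K\<^esub> z [^]\<^bsub>K\<^esub> i) = \<zero>\<^bsub>K\<^esub>"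
      unfolding integral_closure_def by blast
    have "\<Theta> z ^ n + (\<Sum>i<n. \<Theta> (a i) * \<Theta> z ^ i) = 0" using eq[OF na(1)] na(2) by simp
    then show "int_over (\<Theta> ` A0) (\<Theta> z)" unfolding int_over_def
      using na(1) by (intro exI[of _ n] exI[of _ "\<lambda>i. \<Theta> (a i)"]) auto
  next
    assume "int_over (\<Theta> ` A0) (\<Theta> z)"
    then obtain n b where nb: "\<forall>i<n::nat. b i \<in> \<Theta> ` A0" "\<Theta> z ^ n + (\<Sum>i<n. b i * \<Theta> z ^ i) = 0"
      unfolding int_over_def by blast
    have "\<forall>i. \<exists>x. i < n \<longrightarrow> x \<in> A0 \<and> b i = \<Theta> x" using nb(1) by blast
    then obtain a where a: "\<forall>i<n. a i \<in> A0 \<and> b i = \<Theta> (a i)" by (rule choice[THEN exE]) blast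
    have "(\<Sum>i<n. \<Theta> (a i) * \<Theta> z ^ i) = (\<Sum>i<n. b i * \<Theta> z ^ i)" by (intro sum.cong refl) (simp add: a)
    then have "\<Theta> z ^ n + (\<Sum>i<n. \<Theta> (a i) * \<Theta> z ^ i) = 0" using nb(2) by simp
    moreover have aA: "\<forall>i<n. a i \<in> A0" using a by blast
    ultimately have "z [^]\<^bsub>K\<^esub> n \<oplus>\<^bsub>K\<^esub> (\<Oplus>\<^bsub>K\<^esub>i\<in>{..<n}. a i \<otimes>\<^bsub>K\<^esub> z [^]\<^bsub>K\<^esub> i) = \<zero>\<^bsub>K\<^esub>"
      using eq[OF aA] by simp
    then show "z \<in> integral_closure K A0" unfolding integral_closure_def
      using aA z by (intro CollectI conjI exI[of _ n] exI[of _ a])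
  qed
qed

text \<open>An embedding of \<open>K\<close> into the Laurent series under which \<open>A0\<close> becomes a ring of power series
  containing the constants yields a maximal ideal of the integral closure of \<open>A0\<close>.\<close>

locale laurent_place =
  fixes K :: "'b ring" and A0 :: "'b set" and \<Theta> :: "'b \<Rightarrow> complex fls"
  assumes hom: "ring_hom_ring K type_ring \<Theta>" and inj: "inj_on \<Theta> (carrier K)"
    and A0: "A0 \<subseteq> carrier K" and sub: "subring_set (\<Theta> ` A0)"
    and const: "fls_const c \<in> \<Theta> ` A0" and reg: "\<And>x. x \<in> A0 \<Longrightarrow> regular (\<Theta> x)"
begin

sublocale h: ring_hom_ring K type_ring \<Theta> by (rule hom)

definition "IC = integral_closure K A0"
definition "M = {x \<in> IC. residue0 (\<Theta> x) = 0}"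

lemma IC_iff: "z \<in> IC \<longleftrightarrow> z \<in> carrier K \<and> int_over (\<Theta> ` A0) (\<Theta> z)"
  using int_over_hom[OF hom inj A0, of z] unfolding IC_def by (auto simp: integral_closure_def)

lemma IC_regular: "z \<in> IC \<Longrightarrow> regular (\<Theta> z)"
  using int_over_regular[of "\<Theta> ` A0"] reg unfolding IC_iff by blast

lemma IC_subring: "subring IC K"
proof (rule h.R.subringI)
  note s = subring_set_int_over[OF sub]
  show "IC \<subseteq> carrier K" by (auto simp: IC_iff)
  show "\<one>\<^bsub>K\<^esub> \<in> IC" using subring_setD(1)[OF s] h.hom_one by (simp add: IC_iff type_ring_simps)
  fix x assume x: "x \<in> IC"
  have "\<Theta> (\<ominus>\<^bsub>K\<^esub> x) + \<Theta> x = 0"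
  proof -
    have xK: "x \<in> carrier K" using x by (simp add: IC_iff)
    show ?thesis using h.hom_add[OF h.R.add.inv_closed[OF xK] xK] h.hom_zero unfolding h.R.l_neg[OF xK] type_ring_simps by simp
  qed
  then have "\<Theta> (\<ominus>\<^bsub>K\<^esub> x) = - \<Theta> x" by (simp only: eq_neg_iff_add_eq_0)
  then show "\<ominus>\<^bsub>K\<^esub> x \<in> IC" using x subring_setD(2)[OF s] by (auto simp: IC_iff)
  fix y assume y: "y \<in> IC"
  show "x \<otimes>\<^bsub>K\<^esub> y \<in> IC" using x y subring_setD(4)[OF s] by (auto simp: IC_iff h.hom_mult type_ring_simps)
  show "x \<oplus>\<^bsub>K\<^esub> y \<in> IC" using x y subring_setD(3)[OF s] by (auto simp: IC_iff h.hom_add type_ring_simps)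
qed

lemma A0_subset_IC: "A0 \<subseteq> IC"
  using A0 int_over_base[OF sub] by (auto simp: IC_iff)

text \<open>\<open>M\<close> is the kernel of the residue map. An element with residue c \<noteq> 0,
  multiplied by the element of \<open>A0\<close> that maps to 1/c, has residue 1 and so differs from
  1 by an element of \<open>M\<close>.\<close>

lemma M_maximal: "maximalideal M (K\<lparr>carrier := IC\<rparr>)"
proof -
  define R where "R = K\<lparr>carrier := IC\<rparr>"
  have ringR: "ring R" unfolding R_def by (rule h.R.subring_is_ring[OF IC_subring])
  have ICc: "x \<in> IC \<Longrightarrow> x \<in> carrier K" for x by (simp add: IC_iff)
  have hr: "ring_hom_ring R (type_ring :: complex ring) (\<lambda>x. residue0 (\<Theta> x))"
  proof (rule ring_hom_ringI[OF ringR ring_from_type_algebra])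
    fix x y assume "x \<in> carrier R" "y \<in> carrier R"
    then have xy: "x \<in> IC" "y \<in> IC" by (simp_all add: R_def)
    show "residue0 (\<Theta> (x \<otimes>\<^bsub>R\<^esub> y)) = residue0 (\<Theta> x) \<otimes>\<^bsub>type_ring\<^esub> residue0 (\<Theta> y)"
      using xy by (simp add: R_def h.hom_mult ICc type_ring_simps residue0_mult IC_regular)
    show "residue0 (\<Theta> (x \<oplus>\<^bsub>R\<^esub> y)) = residue0 (\<Theta> x) \<oplus>\<^bsub>type_ring\<^esub> residue0 (\<Theta> y)"
      using xy by (simp add: R_def h.hom_add ICc type_ring_simps residue0_add IC_regular)
  qed (use h.hom_one in \<open>auto simp: R_def type_ring_simps residue0_1\<close>)
  interpret r: ring_hom_ring R "type_ring :: complex ring" "\<lambda>x. residue0 (\<Theta> x)" by (rule hr)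
  have MR: "M = a_kernel R type_ring (\<lambda>x. residue0 (\<Theta> x))"
    unfolding a_kernel_def' M_def R_def type_ring_simps by simp
  have "maximalideal M R"
  proof (rule maximalidealI)
    show "ideal M R" unfolding MR by (rule r.kernel_is_ideal)
    have "residue0 (\<Theta> \<one>\<^bsub>R\<^esub>) = 1" using r.hom_one by (simp only: type_ring_simps)
    then have "\<one>\<^bsub>R\<^esub> \<notin> M" by (simp add: M_def)
    then show "carrier R \<noteq> M" using r.R.one_closed by metis
    fix J assume J: "ideal J R" "M \<subseteq> J" "J \<subseteq> carrier R"
    interpret J: ideal J R by (rule J)
    show "J = M \<or> J = carrier R"
    proof (cases "J \<subseteq> M")
      case False
      then obtain x where x: "x \<in> J" "x \<notin> M" by blast
      define c where "c = residue0 (\<Theta> x)"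
      have xIC: "x \<in> IC" using x J(3) by (auto simp: R_def)
      then have c0: "c \<noteq> 0" using x(2) by (auto simp: M_def c_def)
      obtain k where k: "k \<in> A0" "\<Theta> k = fls_const (1 / c)" using const[of "1 / c"] by auto
      have kc: "k \<in> carrier R" using k A0_subset_IC by (auto simp: R_def)
      define y where "y = k \<otimes>\<^bsub>R\<^esub> x"
      have yJ: "y \<in> J" unfolding y_def using x(1) kc by (rule J.I_l_closed)
      have "residue0 (\<Theta> k) = 1 / c" by (simp add: k residue0_def)
      moreover have "residue0 (\<Theta> y) = residue0 (\<Theta> k) * residue0 (\<Theta> x)"
        unfolding y_def using r.hom_mult[OF kc, of x] subsetD[OF J(3) x(1)] by (simp only: type_ring_simps)
      ultimately have ry: "residue0 (\<Theta> y) = 1" using c0 by (simp add: c_def)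
      have yR: "y \<in> carrier R" using yJ J(3) by blast
      have ny: "\<ominus>\<^bsub>R\<^esub> y \<in> carrier R" using yR by simp
      have z: "residue0 (\<Theta> \<zero>\<^bsub>R\<^esub>) = 0" using r.hom_zero by (simp only: type_ring_simps)
      have "1 + residue0 (\<Theta> (\<ominus>\<^bsub>R\<^esub> y)) = 0"
        using r.hom_add[OF yR ny] unfolding r.R.r_neg[OF yR] type_ring_simps z ry by (rule sym)
      then have rny: "residue0 (\<Theta> (\<ominus>\<^bsub>R\<^esub> y)) = - 1" by (simp only: add_eq_0_iff)
      have "residue0 (\<Theta> \<one>\<^bsub>R\<^esub>) = 1" using r.hom_one by (simp only: type_ring_simps)
      then have "residue0 (\<Theta> (\<one>\<^bsub>R\<^esub> \<ominus>\<^bsub>R\<^esub> y)) = 0"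
        using r.hom_add[OF r.R.one_closed ny] rny unfolding a_minus_def type_ring_simps by simp
      moreover have "\<one>\<^bsub>R\<^esub> \<ominus>\<^bsub>R\<^esub> y \<in> carrier R" using yR by simp
      ultimately have "\<one>\<^bsub>R\<^esub> \<ominus>\<^bsub>R\<^esub> y \<in> M" by (simp add: M_def R_def)
      then have "(\<one>\<^bsub>R\<^esub> \<ominus>\<^bsub>R\<^esub> y) \<oplus>\<^bsub>R\<^esub> y \<in> J" using J(2) yJ by (intro J.a_closed) auto
      moreover have "(\<one>\<^bsub>R\<^esub> \<ominus>\<^bsub>R\<^esub> y) \<oplus>\<^bsub>R\<^esub> y = \<one>\<^bsub>R\<^esub>"
        unfolding a_minus_def r.R.add.m_assoc[OF r.R.one_closed ny yR] r.R.l_neg[OF yR] by (rule r.R.r_zero[OF r.R.one_closed])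
      ultimately have "\<one>\<^bsub>R\<^esub> \<in> J" by (simp only:)
      then have "J = carrier R" by (rule J.one_imp_carrier)
      then show ?thesis by (rule disjI2)
    next
      case True
      then show ?thesis using J(2) by (intro disjI1 equalityI)
    qed
  qed
  then show ?thesis by (simp add: R_def)
qed

end

section \<open>The function field embedded into Laurent series by each root\<close>

lemma eval3_mult: "eval3 (F * G) v = eval3 F v * eval3 G v"
  and eval3_add: "eval3 (F + G) v = eval3 F v + eval3 G v"
  and eval3_1: "eval3 1 v = 1" and eval3_K3: "eval3 (K3 c) v = c"
  by (simp_all add: eval3_def K3_def)

definition point :: "complex^3 \<Rightarrow> proj_point" where "point v = range (\<lambda>c. c *s v)"

lemma eval3_scale: "homogeneous e G \<Longrightarrow> eval3 G (c *s v) = c ^ e * eval3 G v"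
  by (simp add: eval3_ev3 ev3_scale[OF comm_ring_hom_id])

lemma point_in_plane: "v \<noteq> 0 \<Longrightarrow> point v \<in> proj_plane"
  by (auto simp: proj_plane_def point_def)

lemma point_zero_locus: "homogeneous e G \<Longrightarrow> v \<noteq> 0 \<Longrightarrow> point v \<in> zero_locus G \<longleftrightarrow> eval3 G v = 0"
proof -
  assume h: "homogeneous e G" "v \<noteq> 0"
  have "v \<in> point v" unfolding point_def by (intro image_eqI[of _ _ 1]) simp_all
  then show ?thesis using h point_in_plane[OF h(2)] by (auto simp: zero_locus_def point_def eval3_scale)
qed

context branches
begin

lemma prime_C: "prime_elem C" using irr by (simp add: irreducible_imp_prime_elem_gcd)

lemma dvd_multD: "C dvd G * H \<Longrightarrow> C dvd G \<or> C dvd H" using prime_C by (rule prime_elem_dvd_multD)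

lemma place_eq_0_iff: "homogeneous e G \<Longrightarrow> k < d \<Longrightarrow> place k G = 0 \<longleftrightarrow> C dvd G"
proof
  assume "homogeneous e G" "k < d" "place k G = 0" then show "C dvd G" using place_nonzero by blast
next
  interpret p: comm_ring_hom "place k" by (rule place_hom)
  assume "k < d" "C dvd G" then show "place k G = 0" using place_C by (auto simp: p.hom_mult)
qed

definition "lplace k G = fps_to_fls (place k G)"

lemma lplace_hom: "comm_ring_hom (lplace k)"
  unfolding lplace_def[abs_def] by (rule comm_ring_hom_comp[OF fps_to_fls_hom place_hom])

lemma lplace_eq_0_iff: "homogeneous e G \<Longrightarrow> k < d \<Longrightarrow> lplace k G = 0 \<longleftrightarrow> C dvd G"
  by (simp add: lplace_def place_eq_0_iff)

definition adm :: "nat \<Rightarrow> poly3 \<Rightarrow> poly3 \<Rightarrow> bool" where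
  "adm e G H \<longleftrightarrow> homogeneous e G \<and> homogeneous e H \<and> \<not> C dvd H"

text \<open>A fraction has many admissible representatives; that the value is the same for all of
  them is the content of \<open>theta_Fract\<close>.\<close>

definition \<theta> :: "nat \<Rightarrow> poly3 fract \<Rightarrow> complex fls" where
  "\<theta> k z = (THE y. \<exists>G H e. z = Fract G H \<and> adm e G H \<and> y = lplace k G / lplace k H)"

lemma theta_Fract:
  assumes k: "k < d" and a: "adm e G H" shows "\<theta> k (Fract G H) = lplace k G / lplace k H"
  unfolding \<theta>_def
proof (rule the_equality)
  show "\<exists>G' H' e. Fract G H = Fract G' H' \<and> adm e G' H' \<and> lplace k G / lplace k H = lplace k G' / lplace k H'"
    using a by blast
  fix y assume "\<exists>G' H' e. Fract G H = Fract G' H' \<and> adm e G' H' \<and> y = lplace k G' / lplace k H'"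
  then obtain G' H' e' where b: "Fract G H = Fract G' H'" "adm e' G' H'" "y = lplace k G' / lplace k H'" by blast
  interpret p: comm_ring_hom "lplace k" by (rule lplace_hom)
  have "H \<noteq> 0" "H' \<noteq> 0" using a b(2) by (auto simp: adm_def)
  then have "G * H' = G' * H" using b(1) by (simp add: eq_fract)
  then have "lplace k G * lplace k H' = lplace k G' * lplace k H" by (simp flip: p.hom_mult)
  moreover have "lplace k H \<noteq> 0" "lplace k H' \<noteq> 0"
    using a b(2) k lplace_eq_0_iff unfolding adm_def by blast+
  ultimately show "y = lplace k G / lplace k H" unfolding b(3) by (simp add: frac_eq_eq)
qed

abbreviation "LR \<equiv> generic_local_ring C"

lemma LR_carrier: "z \<in> carrier LR \<longleftrightarrow> (\<exists>G H e. z = Fract G H \<and> adm e G H)"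
  by (auto simp: generic_local_ring_def adm_def)

lemma LR_ops: "x \<otimes>\<^bsub>LR\<^esub> y = x * y" "x \<oplus>\<^bsub>LR\<^esub> y = x + y" "\<one>\<^bsub>LR\<^esub> = 1" "\<zero>\<^bsub>LR\<^esub> = 0"
  by (simp_all add: generic_local_ring_def ring_of_type_algebra_def)

lemma adm_add_mult:
  assumes "adm e G H" "adm e' G' H'"
  shows "adm (e + e') (G * G') (H * H')" "adm (e + e') (G * H' + G' * H) (H * H')"
    "Fract G H * Fract G' H' = Fract (G * G') (H * H')" "Fract G H + Fract G' H' = Fract (G * H' + G' * H) (H * H')"
proof -
  have n: "\<not> C dvd H * H'" using assms dvd_multD by (auto simp: adm_def)
  show "adm (e + e') (G * G') (H * H')" using assms n by (auto simp: adm_def homogeneous_mult)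
  have "homogeneous (e + e') (G' * H)" using assms homogeneous_mult[of e' G' e H] by (simp add: adm_def add.commute)
  then show "adm (e + e') (G * H' + G' * H) (H * H')"
    using assms n by (auto simp: adm_def homogeneous_mult intro!: homogeneous_add)
  have "H \<noteq> 0" "H' \<noteq> 0" using assms by (auto simp: adm_def)
  then show "Fract G H * Fract G' H' = Fract (G * G') (H * H')" "Fract G H + Fract G' H' = Fract (G * H' + G' * H) (H * H')"
    by simp_all
qed

lemma adm_uminus: "adm e G H \<Longrightarrow> adm e (- G) H" by (simp add: adm_def homogeneous_uminus)

lemma not_C_dvd_1: "\<not> C dvd 1" using irr by (simp add: Factorial_Ring.irreducible_def)

lemma adm_const: "adm 0 (K3 c) 1" by (simp add: adm_def homogeneous_K3 homogeneous_1 not_C_dvd_1)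

lemma LR_ring: "ring LR"
proof -
  interpret t: ring "type_ring :: poly3 fract ring" by (rule ring_from_type_algebra)
  have "subring (carrier LR) (type_ring :: poly3 fract ring)"
  proof (rule t.subringI)
    show "\<one>\<^bsub>type_ring\<^esub> \<in> carrier LR"
      using adm_const[of 1] unfolding LR_carrier type_ring_simps K3_1 One_fract_def by blast
    fix x assume "x \<in> carrier LR"
    then obtain G H e where x: "x = Fract G H" "adm e G H" by (auto simp: LR_carrier)
    have "\<ominus>\<^bsub>type_ring\<^esub> x = - x"
      by (rule t.minus_equality) (simp_all add: type_ring_simps)
    then show "\<ominus>\<^bsub>type_ring\<^esub> x \<in> carrier LR" using adm_uminus[OF x(2)] x(1) by (auto simp: LR_carrier)
    fix y assume "y \<in> carrier LR"
    then obtain G' H' e' where y: "y = Fract G' H'" "adm e' G' H'" by (auto simp: LR_carrier)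
    show "x \<otimes>\<^bsub>type_ring\<^esub> y \<in> carrier LR" "x \<oplus>\<^bsub>type_ring\<^esub> y \<in> carrier LR"
      unfolding type_ring_simps LR_carrier x(1) y(1) adm_add_mult(3,4)[OF x(2) y(2)]
      using adm_add_mult(1,2)[OF x(2) y(2)] by blast+
  qed (simp add: type_ring_simps)
  then have "ring (type_ring \<lparr>carrier := carrier LR\<rparr> :: poly3 fract ring)" by (rule t.subring_is_ring)
  then show ?thesis by (simp add: generic_local_ring_def)
qed

lemma theta_hom: assumes k: "k < d" shows "ring_hom_ring LR type_ring (\<theta> k)"
proof (rule ring_hom_ringI[OF LR_ring ring_from_type_algebra])
  interpret p: comm_ring_hom "lplace k" by (rule lplace_hom)
  fix x y assume "x \<in> carrier LR" "y \<in> carrier LR"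
  then obtain G H e G' H' e' where x: "x = Fract G H" "adm e G H" and y: "y = Fract G' H'" "adm e' G' H'"
    by (auto simp: LR_carrier)
  have n: "lplace k H \<noteq> 0" "lplace k H' \<noteq> 0" using x y k lplace_eq_0_iff unfolding adm_def by blast+
  note t = theta_Fract[OF k x(2)] theta_Fract[OF k y(2)]
  show "\<theta> k (x \<otimes>\<^bsub>LR\<^esub> y) = \<theta> k x \<otimes>\<^bsub>type_ring\<^esub> \<theta> k y"
    unfolding LR_ops type_ring_simps x(1) y(1) adm_add_mult(3)[OF x(2) y(2)] t theta_Fract[OF k adm_add_mult(1)[OF x(2) y(2)]]
    by (simp add: p.hom_mult)
  show "\<theta> k (x \<oplus>\<^bsub>LR\<^esub> y) = \<theta> k x \<oplus>\<^bsub>type_ring\<^esub> \<theta> k y"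
    unfolding LR_ops type_ring_simps x(1) y(1) adm_add_mult(4)[OF x(2) y(2)] t theta_Fract[OF k adm_add_mult(2)[OF x(2) y(2)]]
    using n by (simp add: p.hom_mult p.hom_add add_frac_eq)
next
  interpret p: comm_ring_hom "lplace k" by (rule lplace_hom)
  show "\<theta> k \<one>\<^bsub>LR\<^esub> = \<one>\<^bsub>type_ring\<^esub>"
    unfolding LR_ops type_ring_simps One_fract_def using theta_Fract[OF k adm_const[of 1]] by (simp add: K3_1)
qed (simp add: type_ring_simps)

text \<open>A form restricts to zero on a root exactly if \<open>C\<close> divides it. The kernel is
  therefore the same for all \<open>k\<close>, and every root embeds the same function
  field.\<close>

lemma theta_kernel: assumes k: "k < d" shows "a_kernel LR type_ring (\<theta> k) = generic_max_ideal C"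
proof -
  have "z \<in> a_kernel LR type_ring (\<theta> k) \<longleftrightarrow> (\<exists>G H e. z = Fract G H \<and> adm e G H \<and> C dvd G)" for z
  proof -
    have "\<theta> k (Fract G H) = 0 \<longleftrightarrow> C dvd G" if "adm e G H" for G H e
      using that lplace_eq_0_iff[of e G k] lplace_eq_0_iff[of e H k] k by (simp add: theta_Fract[OF k that]) (simp add: adm_def)
    then show ?thesis unfolding a_kernel_def' mem_Collect_eq LR_carrier type_ring_simps by blast
  qed
  then show ?thesis unfolding generic_max_ideal_def adm_def by blast
qed

abbreviation "FF \<equiv> function_field C"

definition "fr G H = generic_max_ideal C +>\<^bsub>LR\<^esub> Fract G H"
definition Theta :: "nat \<Rightarrow> poly3 fract set \<Rightarrow> complex fls" where "Theta k Z = the_elem (\<theta> k ` Z)"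

lemma FF_eq: "k < d \<Longrightarrow> FF = LR Quot (a_kernel LR type_ring (\<theta> k))"
  by (simp add: function_field_def theta_kernel)

lemma FF_carrier: "Z \<in> carrier FF \<longleftrightarrow> (\<exists>G H e. adm e G H \<and> Z = fr G H)"
proof -
  have "Z \<in> carrier FF \<longleftrightarrow> (\<exists>x\<in>carrier LR. Z = generic_max_ideal C +>\<^bsub>LR\<^esub> x)"
    by (auto simp: function_field_def FactRing_def A_RCOSETS_def')
  then show ?thesis unfolding fr_def Bex_def LR_carrier by blast
qed

lemma Theta_fr: assumes k: "k < d" and a: "adm e G H" shows "Theta k (fr G H) = lplace k G / lplace k H"
proof -
  have "Fract G H \<in> carrier LR" using a by (auto simp: LR_carrier)
  then show ?thesis
    using ring_hom_ring.the_elem_simp[OF theta_hom[OF k]] theta_Fract[OF k a]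
    by (simp add: Theta_def fr_def theta_kernel[OF k])
qed

lemma FF_ring: "ring FF"
  using ideal.quotient_is_ring[OF ring_hom_ring.kernel_is_ideal[OF theta_hom[OF d0]]] FF_eq[OF d0] by simp

lemma Theta_hom: assumes "k < d" shows "ring_hom_ring FF type_ring (Theta k)"
  using ring_hom_ring.the_elem_hom[OF theta_hom[OF assms]] FF_eq[OF assms] unfolding Theta_def[abs_def]
  by (intro ring_hom_ringI2[OF FF_ring ring_from_type_algebra]) simp

lemma Theta_inj: assumes "k < d" shows "inj_on (Theta k) (carrier FF)"
  using ring_hom_ring.the_elem_inj[OF theta_hom[OF assms]] FF_eq[OF assms] unfolding Theta_def[abs_def] inj_on_def by simp

lemma curve_local_ring_point:
  "curve_local_ring C (point v) = {fr G H | G H e. homogeneous e G \<and> homogeneous e H \<and> eval3 H v \<noteq> 0}"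
proof -
  have "(\<exists>u\<in>point v. eval3 H u \<noteq> 0) \<longleftrightarrow> eval3 H v \<noteq> 0" if "homogeneous e H" for H e
  proof
    show "eval3 H v \<noteq> 0" if "\<exists>u\<in>point v. eval3 H u \<noteq> 0"
      using that eval3_scale[OF \<open>homogeneous e H\<close>] by (auto simp: point_def)
    have "v \<in> point v" unfolding point_def by (intro image_eqI[of _ _ 1]) simp_all
    then show "\<exists>u\<in>point v. eval3 H u \<noteq> 0" if "eval3 H v \<noteq> 0" using that by blast
  qed
  then show ?thesis unfolding curve_local_ring_def fr_def by blast
qed

lemma place_C_center: "k < d \<Longrightarrow> eval3 C (center k) = 0"
  using place_nth_0[of k C] place_C[of k] by simp

lemma not_dvd_center: assumes "k < d" "eval3 H (center k) \<noteq> 0" shows "\<not> C dvd H"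
proof
  interpret p: comm_ring_hom "place k" by (rule place_hom)
  assume "C dvd H"
  then have "place k H = 0" using place_C[OF assms(1)] by (auto simp: p.hom_mult)
  then show False using place_nth_0[of k H] assms(2) by simp
qed

lemma lplace_regular: "regular (lplace k G)" "residue0 (lplace k G) = eval3 G (center k)"
  by (auto simp: lplace_def regular_def residue0_fps place_nth_0)

text \<open>A denominator that does not vanish at the centre restricts to a power series with
  nonzero constant term, so elements of the local ring stay regular.\<close>

lemma laurent_place: assumes k: "k < d"
  shows "laurent_place FF (curve_local_ring C (point (center k))) (Theta k)"
proof -
  interpret p: comm_ring_hom "lplace k" by (rule lplace_hom)
  define A0 where "A0 = {(G, H) | G H e. homogeneous e G \<and> homogeneous e H \<and> eval3 H (center k) \<noteq> 0}"
  have cl: "curve_local_ring C (point (center k)) = (\<lambda>(G,H). fr G H) ` A0"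
    unfolding curve_local_ring_point A0_def by auto
  have clE: "\<exists>G H. x = fr G H \<and> (G,H) \<in> A0" if "x \<in> curve_local_ring C (point (center k))" for x
    using that unfolding curve_local_ring_point A0_def by blast
  have adm: "\<exists>e. adm e G H" if "(G,H) \<in> A0" for G H
    using that not_dvd_center[OF k] unfolding A0_def adm_def by blast
  have th: "Theta k (fr G H) = lplace k G / lplace k H" if "(G,H) \<in> A0" for G H
    using adm[OF that] Theta_fr[OF k] by blast
  have img: "Theta k ` curve_local_ring C (point (center k)) = {lplace k G / lplace k H | G H. (G,H) \<in> A0}"
    unfolding cl using th by force
  have n0: "lplace k H \<noteq> 0" if "(G,H) \<in> A0" for G H
    using that not_dvd_center[OF k] lplace_eq_0_iff[OF _ k] unfolding A0_def by blast
  have c: "(K3 c, 1) \<in> A0" for c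
    using homogeneous_K3[of c] homogeneous_1 unfolding A0_def by (auto simp: eval3_1)
  have cc: "lplace k (K3 c) = fls_const c" for c
    unfolding lplace_def place_expand by (simp add: ev_simps[OF comm_ring_hom_fps_const])
  show ?thesis
  proof (rule laurent_place.intro)
    show "ring_hom_ring FF type_ring (Theta k)" by (rule Theta_hom[OF k])
    show "inj_on (Theta k) (carrier FF)" by (rule Theta_inj[OF k])
    show "curve_local_ring C (point (center k)) \<subseteq> carrier FF"
      using clE adm unfolding FF_carrier subset_eq by blast
    have mem: "fls_const c \<in> Theta k ` curve_local_ring C (point (center k))" for c
      unfolding img using c[of c] cc[of c] by (intro CollectI exI[of _ "K3 c"] exI[of _ 1]) simp
    then show "fls_const c \<in> Theta k ` curve_local_ring C (point (center k))" for c .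
    show "regular (Theta k x)" if xc: "x \<in> curve_local_ring C (point (center k))" for x
    proof -
      obtain G H where x: "x = fr G H" "(G,H) \<in> A0" using clE[OF xc] by blast
      then have "residue0 (lplace k H) \<noteq> 0" by (auto simp: lplace_regular A0_def)
      then show ?thesis unfolding x(1) th[OF x(2)] by (intro regular_divide lplace_regular)
    qed
    show "subring_set (Theta k ` curve_local_ring C (point (center k)))"
      unfolding subring_set_def
    proof (intro conjI ballI)
      show "1 \<in> Theta k ` curve_local_ring C (point (center k))" using mem[of 1] by simp
      fix x assume "x \<in> Theta k ` curve_local_ring C (point (center k))"
      then obtain G H e where x: "x = lplace k G / lplace k H" "(G,H) \<in> A0"
        "homogeneous e G" "homogeneous e H" "eval3 H (center k) \<noteq> 0" unfolding img by (auto simp: A0_def)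
      have "(- G, H) \<in> A0" using x homogeneous_uminus unfolding A0_def by blast
      then show "- x \<in> Theta k ` curve_local_ring C (point (center k))"
        unfolding img x(1) by (intro CollectI exI[of _ "- G"] exI[of _ H]) (simp add: p.hom_uminus)
      fix y assume "y \<in> Theta k ` curve_local_ring C (point (center k))"
      then obtain G' H' e' where y: "y = lplace k G' / lplace k H'" "(G',H') \<in> A0"
        "homogeneous e' G'" "homogeneous e' H'" "eval3 H' (center k) \<noteq> 0" unfolding img by (auto simp: A0_def)
      have "eval3 (H * H') (center k) = eval3 H (center k) * eval3 H' (center k)"
        by (rule eval3_mult)
      then have e: "eval3 (H * H') (center k) \<noteq> 0" using x(5) y(5) by simp
      have hHH: "homogeneous (e + e') (H * H')" using x y homogeneous_mult by blast
      have "(G * G', H * H') \<in> A0" using x y e hHH homogeneous_mult[OF x(3) y(3)] unfolding A0_def by blast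
      then show "x * y \<in> Theta k ` curve_local_ring C (point (center k))"
        unfolding img x(1) y(1) by (intro CollectI exI[of _ "G * G'"] exI[of _ "H * H'"]) (simp add: p.hom_mult)
      have "homogeneous (e + e') (G * H' + G' * H)"
        using homogeneous_mult[OF x(3) y(4)] homogeneous_mult[OF y(3) x(4)] by (intro homogeneous_add) (simp_all add: add.commute)
      then have "(G * H' + G' * H, H * H') \<in> A0" using e hHH unfolding A0_def by blast
      then show "x + y \<in> Theta k ` curve_local_ring C (point (center k))"
        unfolding img x(1) y(1) using n0[OF x(2)] n0[OF y(2)]
        by (intro CollectI exI[of _ "G * H' + G' * H"] exI[of _ "H * H'"]) (simp add: p.hom_mult p.hom_add add_frac_eq)
    qed
  qed
qed

text \<open>The point of the normalization that the \<open>k\<close>-th root singles out over its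
  centre.\<close>

definition "Mideal k = laurent_place.M FF (curve_local_ring C (point (center k))) (Theta k)"

lemma Mideal_normalization:
  assumes "k < d" shows "(point (center k), Mideal k) \<in> normalization C"
proof -
  interpret l: laurent_place FF "curve_local_ring C (point (center k))" "Theta k" by (rule laurent_place[OF assms])
  show ?thesis unfolding normalization_def Mideal_def
    using l.M_maximal place_C_center[OF assms] by (simp add: l.IC_def point_zero_locus[OF hom center_nonzero])
qed

end

section \<open>The maximal ideal determines the order along a root\<close>

lemma factor_out_X:
  fixes p :: "complex poly poly" assumes "p \<noteq> 0"
  shows "\<exists>e p'. p = smult ([:0,1:] ^ e) p' \<and> (\<exists>i. poly (coeff p' i) 0 \<noteq> 0)"
  using assms
proof (induction "degree (lead_coeff p)" arbitrary: p rule: less_induct)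
  case less
  show ?case
  proof (cases "\<exists>i. poly (coeff p i) 0 \<noteq> 0")
    case True then show ?thesis by (intro exI[of _ 0] exI[of _ p]) simp
  next
    case False
    then have "\<forall>i. [:0,1:] dvd coeff p i" by (auto simp: poly_eq_0_iff_dvd)
    then have "[:[:0,1:]:] dvd p" by (simp add: const_poly_dvd_iff)
    then obtain q where q: "p = smult [:0,1:] q" by (auto simp: dvd_def)
    have q0: "q \<noteq> 0" using less(2) q by auto
    have "degree (lead_coeff q) < degree (lead_coeff p)"
      using q0 by (simp add: q degree_mult_eq leading_coeff_0_iff del: mult_pCons_left)
    from less(1)[OF this q0] obtain e p' where "q = smult ([:0,1:] ^ e) p'" "\<exists>i. poly (coeff p' i) 0 \<noteq> 0" by blast
    then show ?thesis using q by (intro exI[of _ "Suc e"] exI[of _ p']) (simp add: power_Suc del: mult_pCons_left)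
  qed
qed

context branches
begin

text \<open>The value at t = X^N: how a polynomial function of the base coordinate restricts to any
  root.\<close>

definition \<tau> :: "complex poly \<Rightarrow> complex fps" where "\<tau> a = poly (map_poly fps_const a) (fps_X ^ N)"

lemma tau_hom: "comm_ring_hom \<tau>" unfolding \<tau>_def[abs_def] by (rule comm_ring_hom_poly_map_poly[OF comm_ring_hom_fps_const])

lemma tau_nth_0: "fps_nth (\<tau> a) 0 = poly a 0"
  unfolding \<tau>_def poly_fps_X_power by (simp add: fps_subst_nth_0[OF N0] poly_0_coeff_0)

lemma tau_ev1: "\<tau> a = ev1 fps_const (fps_X ^ N) a" by (simp add: \<tau>_def ev1_def)

text \<open>\<open>P\<close> is the norm of U*H - G, an equation for G/H that need not be monic.
  Taken as a norm it has coefficients that are polynomials in t, although the roots are series in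
  X.\<close>

lemma algebraic_relation:
  assumes a: "adm e G H"
  obtains P where "P \<noteq> 0" "map_poly \<tau> P = (\<Prod>k<d. [:- place k G, place k H:])"
proof -
  define \<iota> where "\<iota> = (\<lambda>c::complex. [:[:c:]:])"
  define T U where "T = [:[:0,1::complex:]:]" and "U = [:0, 1::complex poly:]"
  have hi: "comm_ring_hom \<iota>" unfolding \<iota>_def by (intro comm_ring_hom_const_poly comm_ring_hom_id)
  note he = ev2_hom[OF hi, of 1 T]
  define g where "g = smult U (map_poly (ev2 \<iota> 1 T) (lsub A H)) - map_poly (ev2 \<iota> 1 T) (lsub A G)"
  define P where "P = poly_norm (map_poly (ev2 \<iota> 1 T) monic_eq) g"
  have ht: "comm_ring_hom (map_poly \<tau>)"
  proof -
    interpret t: comm_ring_hom \<tau> by (rule tau_hom)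
    interpret m: map_poly_comm_ring_hom \<tau> ..
    show ?thesis by (rule m.comm_ring_hom_axioms)
  qed
  interpret ht: comm_ring_hom "map_poly \<tau>" by (rule ht)
  interpret he: comm_ring_hom "ev2 \<iota> 1 T" by (rule he)
  have hc: "comm_ring_hom (\<lambda>c::complex. [:fps_const c:])" by (rule comm_ring_hom_const_poly[OF comm_ring_hom_fps_const])
  have hcc: "comm_ring_hom (\<lambda>f::complex fps. [:f:])" by (rule comm_ring_hom_const_poly[OF comm_ring_hom_id])
  interpret hcc: comm_ring_hom "\<lambda>f::complex fps. [:f:]" by (rule hcc)
  have tc: "\<tau> [:c:] = fps_const c" "\<tau> [:0,1:] = fps_X ^ N" for c
    by (simp_all add: tau_ev1 ev_simps[OF comm_ring_hom_fps_const])
  have t0: "\<tau> 0 = 0" "\<tau> 1 = 1" 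
  proof -
    interpret t: comm_ring_hom \<tau> by (rule tau_hom)
    show "\<tau> 0 = 0" "\<tau> 1 = 1" by simp_all
  qed
  have comp: "map_poly \<tau> (ev2 \<iota> 1 T f) = [:ev2 fps_const 1 (fps_X ^ N) f:]" for f
  proof -
    have "map_poly \<tau> (ev2 \<iota> 1 T f) = ev2 (\<lambda>c. [:fps_const c:]) 1 [:fps_X ^ N:] f"
      unfolding hom_ev2[OF hi ht] by (simp add: \<iota>_def T_def map_poly_hom_pCons[OF tau_hom] tc)
    also have "\<dots> = [:ev2 fps_const 1 (fps_X ^ N) f:]"
      unfolding hom_ev2[OF comm_ring_hom_fps_const hcc] one_pCons ..
    finally show ?thesis .
  qed
  have mm: "map_poly (map_poly \<tau>) (map_poly (ev2 \<iota> 1 T) F) = map_poly (\<lambda>f. [:f:]) (map_poly (ev2 fps_const 1 (fps_X ^ N)) F)" for F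
  proof -
    interpret c: comm_ring_hom "ev2 fps_const 1 (fps_X ^ N :: complex fps)" by (rule ev2_hom[OF comm_ring_hom_fps_const])
    show ?thesis by (rule poly_eqI) (simp add: coeff_map_poly comp)
  qed
  have hccp: "comm_ring_hom (map_poly (\<lambda>f::complex fps. [:f:]))"
  proof -
    interpret m: map_poly_comm_ring_hom "\<lambda>f::complex fps. [:f:]" ..
    show ?thesis by (rule m.comm_ring_hom_axioms)
  qed
  interpret hccp: comm_ring_hom "map_poly (\<lambda>f::complex fps. [:f:])" by (rule hccp)
  have split': "map_poly (map_poly \<tau>) (map_poly (ev2 \<iota> 1 T) monic_eq) = (\<Prod>k<d. [:- [:\<eta> k:], 1:])"
    unfolding mm split hccp.hom_prod
  proof (intro prod.cong refl)
    fix k show "map_poly (\<lambda>f. [:f:]) [:- \<eta> k, 1:] = [:- [:\<eta> k:], 1:]"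
      by (simp only: map_poly_hom_pCons[OF hcc] map_poly_0 minus_pCons minus_zero one_pCons)
  qed
  have mU: "map_poly \<tau> U = [:0,1:]" by (simp add: U_def map_poly_hom_pCons[OF tau_hom] t0)
  have pg: "poly (map_poly (map_poly \<tau>) g) [:\<eta> k:] = [:- place k G, place k H:]" for k
  proof -
    have ev: "poly (map_poly (\<lambda>f. [:f:]) (map_poly (ev2 fps_const 1 (fps_X ^ N)) F)) [:\<eta> k:] = [:ev3 fps_const 1 (fps_X ^ N) (\<eta> k) F:]" for F
      unfolding ev3_def by (rule hcc.poly_map_poly)
    have mg: "map_poly (map_poly \<tau>) g = smult [:0,1:] (map_poly (map_poly \<tau>) (map_poly (ev2 \<iota> 1 T) (lsub A H))) - map_poly (map_poly \<tau>) (map_poly (ev2 \<iota> 1 T) (lsub A G))"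
      unfolding g_def by (rule poly_eqI) (simp only: coeff_map_poly ht.hom_zero he.hom_zero coeff_diff coeff_smult ht.hom_minus ht.hom_mult mU)
    show ?thesis unfolding mg mm by (simp add: ev place_def ev3_def)
  qed
  have "map_poly \<tau> P = (\<Prod>k<d. [:- place k G, place k H:])"
    unfolding P_def poly_norm_hom[OF ht map_poly_monic_eq(3)[OF he.comm_ring_hom_axioms]] split' poly_norm_split pg ..
  moreover have "P \<noteq> 0"
  proof
    assume "P = 0"
    then have "(\<Prod>k<d. [:- place k G, place k H:]) = 0" unfolding calculation[symmetric] by (simp only: map_poly_0)
    then obtain k where "k < d" "[:- place k G, place k H:] = 0" unfolding prod_zero_iff[OF finite_lessThan] by blast
    then have "k < d" "place k H = 0" by simp_all
    then show False using a place_eq_0_iff unfolding adm_def by blast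
  qed
  ultimately show ?thesis by (intro that)
qed

text \<open>Forms that restrict to 1 and to t = X^N on every root: the first serves for
  homogenizing, the second carries the base coordinate.\<close>

definition "T1 = lsub B X1"
definition "T2 = lsub B X2"

lemma T_props: "homogeneous 1 T1" "homogeneous 1 T2" "place k T1 = 1" "place k T2 = fps_X ^ N"
  unfolding T1_def T2_def place_def
  by (simp_all add: homogeneous_lsub homogeneous_X(1)[unfolded One_nat_def] homogeneous_X(2)[unfolded One_nat_def] lsub_lsub[OF BA] ev_simps[OF comm_ring_hom_fps_const])

text \<open>Horner's scheme, homogenized by powers of \<open>T1\<close>. It turns the coefficients
  of the relation into elements of the local ring that look the same on all roots.\<close>

lemma lift_coefficient: "\<exists>G e. homogeneous e G \<and> (\<forall>k. place k G = \<tau> a)"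
proof (induction a)
  case 0
  have "place k 0 = 0" for k
  proof -
    interpret p: comm_ring_hom "place k" by (rule place_hom)
    show ?thesis by simp
  qed
  moreover have "\<tau> 0 = 0" by (simp add: \<tau>_def)
  ultimately show ?case by (intro exI[of _ 0]) (simp add: homogeneous_0)
next
  case (pCons c a)
  then obtain G e where G: "homogeneous e G" "\<And>k. place k G = \<tau> a" by blast
  have t: "\<tau> (pCons c a) = fps_const c + fps_X ^ N * \<tau> a"
    unfolding \<tau>_def by (simp add: map_poly_hom_pCons[OF comm_ring_hom_fps_const])
  have "homogeneous (1 + e) (T2 * G)" using homogeneous_mult[OF T_props(2) G(1)] .
  moreover have "homogeneous (1 + e) (K3 c * T1 ^ (1 + e))"
    using homogeneous_K3_mult[OF homogeneous_power[OF T_props(1), of "1 + e"], of c] by simp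
  ultimately have "homogeneous (1 + e) (K3 c * T1 ^ (1 + e) + T2 * G)" by (rule homogeneous_add[rotated])
  moreover have "place k (K3 c * T1 ^ (1 + e) + T2 * G) = \<tau> (pCons c a)" for k
  proof -
    interpret p: comm_ring_hom "place k" by (rule place_hom)
    have "place k (K3 c) = fps_const c" unfolding place_expand by (simp add: ev_simps[OF comm_ring_hom_fps_const])
    then show ?thesis by (simp add: t p.hom_add p.hom_mult p.hom_power T_props G(2) del: power_Suc)
  qed
  ultimately show ?case by blast
qed

end

context branches
begin

lemma root_of_relation:
  assumes k: "k < d" and a: "adm e G H" and P: "map_poly \<tau> P = (\<Prod>k<d. [:- place k G, place k H:])"
    and P': "P = smult ([:0,1:] ^ s) P'"
  shows "(\<Sum>i\<le>degree P'. fps_to_fls (\<tau> (coeff P' i)) * (lplace k G / lplace k H) ^ i) = 0"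
proof -
  interpret t: comm_ring_hom \<tau> by (rule tau_hom)
  define L where "L = (\<lambda>p. poly (map_poly fps_to_fls p) (lplace k G / lplace k H))"
  have hL: "comm_ring_hom L" unfolding L_def by (rule comm_ring_hom_poly_map_poly[OF fps_to_fls_hom])
  interpret L: comm_ring_hom L by (rule hL)
  have H0: "lplace k H \<noteq> 0" using a k lplace_eq_0_iff unfolding adm_def by blast
  have Lk: "L [:- place k G, place k H:] = 0"
    using H0 by (simp add: L_def map_poly_hom_pCons[OF fps_to_fls_hom] lplace_def)
  have "L (map_poly \<tau> P) = 0" unfolding P L.hom_prod using k Lk by (intro prod_zero bexI[of _ k]) simp_all
  moreover have "map_poly \<tau> P = smult (\<tau> ([:0,1:] ^ s)) (map_poly \<tau> P')"
    unfolding P' by (rule poly_eqI) (simp only: coeff_map_poly t.hom_zero coeff_smult t.hom_mult)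
  moreover have "\<tau> ([:0,1:] ^ s) \<noteq> 0"
    unfolding t.hom_power by (simp add: tau_ev1 ev_simps[OF comm_ring_hom_fps_const])
  ultimately have "L (map_poly \<tau> P') = 0"
  proof -
    assume a: "L (map_poly \<tau> P) = 0" and b: "map_poly \<tau> P = smult (\<tau> ([:0,1:] ^ s)) (map_poly \<tau> P')" and c: "\<tau> ([:0,1:] ^ s) \<noteq> 0"
    have "L (smult c q) = fps_to_fls c * L q" for c q
      using L.hom_mult[of "[:c:]" q] by (simp add: L_def map_poly_hom_pCons[OF fps_to_fls_hom])
    then have "fps_to_fls (\<tau> ([:0,1:] ^ s)) * L (map_poly \<tau> P') = 0" using a b by simp
    then show ?thesis using c by simp
  qed
  moreover have "L (map_poly \<tau> P') = (\<Sum>i\<le>degree P'. fps_to_fls (\<tau> (coeff P' i)) * (lplace k G / lplace k H) ^ i)"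
  proof -
    have "degree (map_poly fps_to_fls (map_poly \<tau> P')) \<le> degree P'"
      by (rule order_trans[OF degree_map_poly_le degree_map_poly_le])
    then have "L (map_poly \<tau> P') = (\<Sum>i\<le>degree P'. coeff (map_poly fps_to_fls (map_poly \<tau> P')) i * (lplace k G / lplace k H) ^ i)"
      unfolding L_def poly_altdef by (intro sum.mono_neutral_left) (auto simp: coeff_eq_0)
    then show ?thesis by (simp add: coeff_map_poly)
  qed
  ultimately show ?thesis by simp
qed

text \<open>As in a Pruefer ring, the function G/H is a quotient of two integral elements of which
  at least one lies outside the common maximal ideal. Given regularity at \<open>k\<close> it must
  be the denominator, and then it is a unit at \<open>l\<close> as well.\<close>

lemma regular_transfer:
  assumes k: "k < d" and l: "l < d" and c: "center k = center l" and M: "Mideal k = Mideal l"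
    and a: "adm e G H" and r: "regular (lplace k G / lplace k H)"
  shows "regular (lplace l G / lplace l H)"
proof -
  obtain P where P: "P \<noteq> 0" "map_poly \<tau> P = (\<Prod>k<d. [:- place k G, place k H:])"
    using algebraic_relation[OF a] by blast
  obtain s P' i0 where P': "P = smult ([:0,1:] ^ s) P'" "poly (coeff P' i0) 0 \<noteq> 0"
    using factor_out_X[OF P(1)] by blast
  define n where "n = degree P'"
  define z where "z m = lplace m G / lplace m H" for m
  define b where "b i = fps_to_fls (\<tau> (coeff P' i))" for i
  have rel: "(\<Sum>i\<le>n. b i * z m ^ i) = 0" if "m < d" for m
    using root_of_relation[OF that a P(2) P'(1)] by (simp add: n_def b_def z_def)
  have rb: "regular (b i)" "residue0 (b i) = poly (coeff P' i) 0" for i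
    by (auto simp: b_def regular_def residue0_fps tau_nth_0)
  have i0n: "i0 \<le> n" using P'(2) coeff_eq_0[of P' i0] unfolding n_def by (cases "i0 \<le> degree P'") auto
  have n0: "0 < n"
  proof (rule ccontr)
    assume "\<not> 0 < n"
    then have "b i0 = 0" using rel[OF k] i0n by simp
    then show False using rb(2)[of i0] P'(2) by (simp add: residue0_def)
  qed
  define A0 where "A0 = curve_local_ring C (point (center k))"
  interpret lk: laurent_place FF A0 "Theta k" unfolding A0_def by (rule laurent_place[OF k])
  interpret ll: laurent_place FF A0 "Theta l" unfolding A0_def c by (rule laurent_place[OF l])
  have MM: "lk.M = ll.M" using M by (simp only: Mideal_def A0_def c)
  have "\<forall>i. \<exists>x. homogeneous (snd x) (fst x) \<and> (\<forall>k. place k (fst x) = \<tau> (coeff P' i))"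
  proof
    fix i
    obtain G e where "homogeneous e G" "\<forall>k. place k G = \<tau> (coeff P' i)" using lift_coefficient by blast
    then show "\<exists>x. homogeneous (snd x) (fst x) \<and> (\<forall>k. place k (fst x) = \<tau> (coeff P' i))"
      by (intro exI[of _ "(G, e)"]) simp
  qed
  then obtain f where f: "\<forall>i. homogeneous (snd (f i)) (fst (f i)) \<and> (\<forall>k. place k (fst (f i)) = \<tau> (coeff P' i))"
    by (rule choice[THEN exE])
  define GG ee where "GG i = fst (f i)" and "ee i = snd (f i)" for i
  have GG: "homogeneous (ee i) (GG i)" "place k (GG i) = \<tau> (coeff P' i)" for i k
    using f unfolding GG_def ee_def by blast+
  define Y where "Y i = fr (GG i) (T1 ^ ee i)" for i
  have T1c: "eval3 T1 (center k) = 1" using place_nth_0[of k T1] by (simp add: T_props)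
  have T1p: "eval3 (T1 ^ j) (center k) = 1" for j by (induction j) (simp_all add: T1c eval3_1 eval3_mult)
  have hT: "homogeneous j (T1 ^ j)" for j using homogeneous_power[OF T_props(1), of j] by simp
  have admY: "adm (ee i) (GG i) (T1 ^ ee i)" for i
    unfolding adm_def using GG(1) hT not_dvd_center[OF k, of "T1 ^ ee i"] T1p by auto
  have YA: "Y i \<in> A0" for i
  proof -
    have "eval3 (T1 ^ ee i) (center k) \<noteq> 0" unfolding T1p by simp
    then show ?thesis unfolding A0_def curve_local_ring_point Y_def using GG(1)[of i] hT[of "ee i"] by blast
  qed
  have ThY: "Theta m (Y i) = b i" if "m < d" for m i
  proof -
    interpret p: comm_ring_hom "lplace m" by (rule lplace_hom)
    have "lplace m T1 = 1" by (simp add: lplace_def T_props)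
    moreover have "lplace m (GG i) = b i" by (simp add: lplace_def GG(2) b_def)
    ultimately show ?thesis unfolding Y_def Theta_fr[OF that admY] by (simp add: p.hom_power)
  qed
  define Z where "Z = fr G H"
  have Zc: "Z \<in> carrier FF" unfolding Z_def FF_carrier using a by blast
  have ThZ: "Theta m Z = z m" if "m < d" for m unfolding Z_def z_def by (rule Theta_fr[OF that a])
  have Yc: "Y i \<in> carrier FF" for i using YA lk.A0 by blast
  \<comment> \<open>Horner's scheme for the relation: under \<open>Theta m\<close> the element
    \<open>c i\<close> becomes b_n z^i + ... + b_(n-i+1) z, and \<open>u i\<close> adds b_(n-i), so
    c_(i+1) = u_i z. It is carried out inside the function field so that both embeddings see the
    same elements.\<close>
  define c where "c = rec_nat \<zero>\<^bsub>FF\<^esub> (\<lambda>i x. (x \<oplus>\<^bsub>FF\<^esub> Y (n - i)) \<otimes>\<^bsub>FF\<^esub> Z)"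
  define u where "u i = c i \<oplus>\<^bsub>FF\<^esub> Y (n - i)" for i
  have c0: "c 0 = \<zero>\<^bsub>FF\<^esub>" by (simp add: c_def)
  have cS: "c (Suc i) = u i \<otimes>\<^bsub>FF\<^esub> Z" for i by (simp add: c_def u_def)
  have cc: "c i \<in> carrier FF" for i
  proof (induction i)
    case 0 then show ?case unfolding c0 by (rule lk.h.R.zero_closed)
  next
    case (Suc i) then show ?case unfolding cS u_def by (intro lk.h.R.m_closed lk.h.R.add.m_closed Yc Zc)
  qed
  have uc: "u i \<in> carrier FF" for i unfolding u_def by (intro lk.h.R.add.m_closed cc Yc)
  have hm: "Theta m (u i) = Theta m (c i) + b (n - i)" "Theta m (c (Suc i)) = Theta m (u i) * z m" if m: "m < d" for m i
  proof -
    interpret t: ring_hom_ring FF type_ring "Theta m" by (rule Theta_hom[OF m])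
    show "Theta m (u i) = Theta m (c i) + b (n - i)"
      unfolding u_def t.hom_add[OF cc Yc] ThY[OF m] type_ring_simps ..
    show "Theta m (c (Suc i)) = Theta m (u i) * z m"
      unfolding cS t.hom_mult[OF uc Zc] ThZ[OF m] type_ring_simps ..
  qed
  have Tc: "Theta m (c i) = (\<Sum>j<i. b (n - j) * z m ^ (i - j))" if m: "m < d" for m i
  proof (induction i)
    case 0
    interpret t: ring_hom_ring FF type_ring "Theta m" by (rule Theta_hom[OF m])
    show ?case unfolding c0 t.hom_zero type_ring_simps by simp
  next
    case (Suc i)
    have "(\<Sum>j<i. b (n - j) * z m ^ (Suc i - j)) = (\<Sum>j<i. b (n - j) * z m ^ (i - j)) * z m"
      unfolding sum_distrib_right by (intro sum.cong refl) (simp add: Suc_diff_le mult_ac)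
    then show ?case unfolding hm(2)[OF m] hm(1)[OF m] Suc by (simp add: distrib_right)
  qed
  have cIC: "c i \<in> lk.IC" if "i \<le> n" for i
    unfolding lk.IC_iff Tc[OF k]
  proof (intro conjI cc int_over_horner[OF lk.sub])
    show "b i \<in> Theta k ` A0" for i using ThY[OF k] YA by (metis imageI)
  qed (use rel[OF k] that n0 in auto)
  have uIC: "u i \<in> lk.IC" if "i \<le> n" for i
    unfolding u_def using lk.A0_subset_IC YA by (intro subringE(7)[OF lk.IC_subring] cIC[OF that]) blast
  \<comment> \<open>If all of these lay in the ideal, every b_i would have residue 0: b_n, ..., b_1
    through the \<open>u i\<close>, and b_0 through c_n = - b_0. But t was divided out of the
    relation until some coefficient was nonzero at t = 0.\<close>
  have "\<exists>i<n. c (Suc i) \<notin> lk.M \<or> u i \<notin> lk.M"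
  proof (rule ccontr)
    assume no: "\<not> ?thesis"
    have rc: "residue0 (Theta k (c i)) = 0" if "i \<le> n" for i
    proof (cases i)
      case 0 show ?thesis unfolding 0 Tc[OF k] by (simp add: residue0_def)
    next
      case (Suc j) then show ?thesis using no that unfolding lk.M_def by auto
    qed
    have co: "poly (coeff P' (n - i)) 0 = 0" if "i < n" for i
    proof -
      have "residue0 (Theta k (u i)) = 0" using no that unfolding lk.M_def by auto
      then have "residue0 (Theta k (c i)) + residue0 (b (n - i)) = 0"
        unfolding hm(1)[OF k] using that by (subst (asm) residue0_add[OF lk.IC_regular[OF cIC] rb(1)]) simp_all
      then show ?thesis using rc[of i] that rb(2) by simp
    qed
    have "Theta k (c n) = - b 0"
    proof -
      have "(\<Sum>i\<le>n. b i * z k ^ i) = (\<Sum>i<n. b (n - i) * z k ^ (n - i)) + b 0"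
      proof -
        have "(\<Sum>i\<le>n. b i * z k ^ i) = (\<Sum>i\<le>n. b (n - i) * z k ^ (n - i))"
          by (rule sum.reindex_bij_witness[of _ "\<lambda>i. n - i" "\<lambda>i. n - i"]) auto
        then show ?thesis by (simp add: lessThan_Suc_atMost[symmetric])
      qed
      then have "Theta k (c n) + b 0 = 0" unfolding Tc[OF k] using rel[OF k] by simp
      then show ?thesis by (simp only: eq_neg_iff_add_eq_0)
    qed
    then have "residue0 (b 0) = 0" using rc[of n] by (simp add: residue0_def)
    then have "poly (coeff P' i0) 0 = 0"
      using rb(2)[of 0] co[of "n - i0"] i0n n0 by (cases "i0 = 0") auto
    then show False using P'(2) by simp
  qed
  then obtain i where i: "i < n" "c (Suc i) \<notin> lk.M \<or> u i \<notin> lk.M" by blast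
  have IC2: "c (Suc i) \<in> lk.IC" "u i \<in> lk.IC" using cIC[of "Suc i"] uIC[of i] i(1) by auto
  \<comment> \<open>As z is regular at \<open>k\<close>, the residue of c_(i+1) = u_i z vanishes
    with that of u_i.\<close>
  have uM: "u i \<notin> lk.M"
  proof
    assume um: "u i \<in> lk.M"
    then have "residue0 (Theta k (u i)) = 0" unfolding lk.M_def by simp
    then have "residue0 (Theta k (c (Suc i))) = 0"
      unfolding hm(2)[OF k] using residue0_mult[OF lk.IC_regular[OF IC2(2)], of "z k"] r by (simp add: z_def)
    then have "c (Suc i) \<in> lk.M" using IC2(1) unfolding lk.M_def by simp
    then show False using i(2) um by blast
  qed
  then have ru: "residue0 (Theta l (u i)) \<noteq> 0" using IC2(2) unfolding MM ll.M_def by simp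
  have regs: "regular (Theta l (c (Suc i)))" "regular (Theta l (u i))" 
    using ll.IC_regular IC2 by blast+
  have "Theta l (u i) \<noteq> 0" using ru by (auto simp: residue0_def)
  then have "z l = Theta l (c (Suc i)) / Theta l (u i)" unfolding hm(2)[OF l] by simp
  then show ?thesis using regular_divide[OF regs ru] by (simp add: z_def)
qed

text \<open>Orders are turned into regularity by the function G^N / T2^g, made homogeneous by powers
  of \<open>T1\<close>: its order on a root is N times the order of \<open>G\<close> minus N*g, and
  g is chosen to make this 0 at \<open>k\<close>.\<close>

lemma val_le_transfer:
  assumes k: "k < d" and l: "l < d" and c: "center k = center l" and M: "Mideal k = Mideal l"
    and G: "homogeneous e G" "\<not> C dvd G"
  shows "val k G \<le> val l G"
proof -
  define g where "g = val k G"
  define G' H' where "G' = G ^ N * T1 ^ g" and "H' = T2 ^ g * T1 ^ (N * e)"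
  have h: "homogeneous (N * e + g) G'" "homogeneous (g + N * e) H'"
    using homogeneous_mult[OF homogeneous_power[OF G(1), of N] homogeneous_power[OF T_props(1), of g]]
      homogeneous_mult[OF homogeneous_power[OF T_props(2), of g] homogeneous_power[OF T_props(1), of "N * e"]]
    by (simp_all add: G'_def H'_def)
  have pl: "place m G' = place m G ^ N" "place m H' = fps_X ^ (N * g)" for m
  proof -
    interpret p: comm_ring_hom "place m" by (rule place_hom)
    show "place m G' = place m G ^ N" "place m H' = fps_X ^ (N * g)"
      by (simp_all add: G'_def H'_def p.hom_mult p.hom_power T_props power_mult)
  qed
  have "place k H' \<noteq> 0" by (simp add: pl)
  then have "\<not> C dvd H'" using place_eq_0_iff[OF h(2) k] by simp
  then have a: "adm (N * e + g) G' H'" using h by (simp add: adm_def add.commute)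
  have sd: "fls_subdegree (lplace m G' / lplace m H') = int (N * val m G) - int (N * g)" if "m < d" for m
  proof -
    have "place m G \<noteq> 0" using place_nonzero[OF G that] .
    then show ?thesis by (simp add: lplace_def pl fls_divide_subdegree fls_subdegree_fls_to_fps val_def subdegree_power fps_X_power_subdegree)
  qed
  have "regular (lplace k G' / lplace k H')" unfolding regular_iff sd[OF k] by (simp add: g_def)
  then have "regular (lplace l G' / lplace l H')" by (rule regular_transfer[OF k l c M a])
  then have "N * g \<le> N * val l G" unfolding regular_iff sd[OF l] by linarith
  then show ?thesis using N0 by (simp add: g_def)
qed

lemma val_eq:
  assumes "k < d" "l < d" "center k = center l" "Mideal k = Mideal l" "homogeneous e G" "\<not> C dvd G"
  shows "val k G = val l G"
  using val_le_transfer[OF assms(1-4)] val_le_transfer[OF assms(2,1) assms(3,4)[symmetric]] assms(5,6) by (meson antisym)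

end

subsection \<open>Directional derivatives and nodes\<close>

definition dird :: "complex^3 \<Rightarrow> poly3 \<Rightarrow> poly3" where
  "dird a F = K3 (a $ 1) * partial_deriv 1 F + K3 (a $ 2) * partial_deriv 2 F + K3 (a $ 3) * partial_deriv 3 F"

lemma homogeneous_dird: "homogeneous d F \<Longrightarrow> homogeneous (d - 1) (dird a F)"
  unfolding dird_def by (intro homogeneous_add homogeneous_K3_mult partial_deriv_homogeneous)

lemma dird_add: "dird (a + b) F = dird a F + dird b F"
proof -
  interpret k: comm_ring_hom K3 by (rule comm_ring_hom_K3)
  show ?thesis by (simp add: dird_def k.hom_add algebra_simps)
qed
lemma dird_scale: "dird (c *s a) F = K3 c * dird a F"
proof -
  interpret k: comm_ring_hom K3 by (rule comm_ring_hom_K3)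
  show ?thesis by (simp add: dird_def k.hom_mult algebra_simps)
qed
lemma eval3_dird: "eval3 (dird a F) v = (\<Sum>i\<in>UNIV. a $ i * eval3 (partial_deriv i F) v)"
  by (simp add: dird_def eval3_add eval3_mult eval3_K3 sum_3)

lemma eval3_dird_self: "homogeneous d F \<Longrightarrow> eval3 (dird v F) v = of_nat d * eval3 F v"
  unfolding eval3_dird sum_3 using euler_ev3[of d F "\<lambda>c. c" "v $ 1" "v $ 2" "v $ 3", OF _ comm_ring_hom_id]
  by (simp add: eval3_ev3)

lemma eval3_dird_scale_point: "homogeneous d F \<Longrightarrow> eval3 (dird a F) (c *s v) = c ^ (d - 1) * eval3 (dird a F) v"
  by (rule eval3_scale[OF homogeneous_dird])

text \<open>At a common zero of \<open>F\<close> and \<open>G\<close>, the only surviving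
  second-order terms of the product are the mixed products of first derivatives of \<open>F\<close>
  and \<open>G\<close>.\<close>

lemma hessian_product:
  assumes "eval3 F v = 0" "eval3 G v = 0"
  shows "(\<Sum>i\<in>UNIV. \<Sum>j\<in>UNIV. eval3 (partial_deriv i (partial_deriv j (F * G * H))) v * w $ i * w $ j) / 2
     = eval3 H v * eval3 (dird w F) v * eval3 (dird w G) v"
proof -
  have "eval3 (partial_deriv i (partial_deriv j (F * G * H))) v =
     eval3 H v * (eval3 (partial_deriv i F) v * eval3 (partial_deriv j G) v + eval3 (partial_deriv j F) v * eval3 (partial_deriv i G) v)" for i j
    using assms by (simp add: derivation_mult[OF derivation_partial_deriv] derivation_add[OF derivation_partial_deriv] eval3_add eval3_mult algebra_simps)
  then have "(\<Sum>i\<in>UNIV. \<Sum>j\<in>UNIV. eval3 (partial_deriv i (partial_deriv j (F * G * H))) v * w $ i * w $ j)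
     = 2 * (eval3 H v * eval3 (dird w F) v * eval3 (dird w G) v)"
    unfolding eval3_dird by (simp add: sum_3 algebra_simps)
  then show ?thesis by simp
qed

definition dot3 :: "complex^3 \<Rightarrow> complex^3 \<Rightarrow> complex" where "dot3 a w = (\<Sum>i\<in>UNIV. a $ i * w $ i)"

lemma dot3_add: "dot3 a (x + y) = dot3 a x + dot3 a y" by (simp add: dot3_def algebra_simps sum.distrib)

lemma dot3_eq_0D: assumes "\<And>w. dot3 a w = 0" shows "a = 0"
proof -
  have "a $ i = 0" for i
    using assms[of "axis i 1"] by (simp add: dot3_def axis_def if_distrib cong: if_cong)
  then show ?thesis by (simp add: Finite_Cartesian_Product.vec_eq_iff)
qed

lemma divide_cross: "(n::'a::field) \<noteq> 0 \<Longrightarrow> n * x = m * y \<Longrightarrow> x = y / n * m"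
proof -
  assume n: "n \<noteq> 0" and e: "n * x = m * y"
  have "x = (n * x) / n" using n by simp
  also have "\<dots> = y / n * m" unfolding e by simp
  finally show ?thesis .
qed

text \<open>A vector annihilated by both linear forms is parallel to their cross product.\<close>

lemma cross_parallel:
  fixes a1 :: complex
  assumes "a1 * x1 + a2 * x2 + a3 * x3 = 0" "b1 * x1 + b2 * x2 + b3 * x3 = 0"
  shows "(a2 * b3 - a3 * b2) * x2 = (a3 * b1 - a1 * b3) * x1" "(a3 * b1 - a1 * b3) * x3 = (a1 * b2 - a2 * b1) * x2"
    "(a1 * b2 - a2 * b1) * x1 = (a2 * b3 - a3 * b2) * x3"
proof -
  have "(a2 * b3 - a3 * b2) * x2 - (a3 * b1 - a1 * b3) * x1 = b3 * (a1 * x1 + a2 * x2 + a3 * x3) - a3 * (b1 * x1 + b2 * x2 + b3 * x3)"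
    "(a3 * b1 - a1 * b3) * x3 - (a1 * b2 - a2 * b1) * x2 = b1 * (a1 * x1 + a2 * x2 + a3 * x3) - a1 * (b1 * x1 + b2 * x2 + b3 * x3)"
    "(a1 * b2 - a2 * b1) * x1 - (a2 * b3 - a3 * b2) * x3 = b2 * (a1 * x1 + a2 * x2 + a3 * x3) - a2 * (b1 * x1 + b2 * x2 + b3 * x3)"
    by (simp_all add: algebra_simps)
  then show "(a2 * b3 - a3 * b2) * x2 = (a3 * b1 - a1 * b3) * x1" "(a3 * b1 - a1 * b3) * x3 = (a1 * b2 - a2 * b1) * x2"
    "(a1 * b2 - a2 * b1) * x1 = (a2 * b3 - a3 * b2) * x3"
    unfolding assms by simp_all
qed

lemma kernel_unique:
  assumes ind: "a \<noteq> b" "vec.independent {a, b :: complex^3}"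
    and u: "dot3 a u = 0" "dot3 b u = 0" "u \<noteq> 0" and s: "dot3 a s = 0" "dot3 b s = 0"
  shows "\<exists>c. s = c *s u"
proof -
  define n where "n = (vector [a$2 * b$3 - a$3 * b$2, a$3 * b$1 - a$1 * b$3, a$1 * b$2 - a$2 * b$1] :: complex^3)"
  have nn: "n $ 1 = a$2 * b$3 - a$3 * b$2" "n $ 2 = a$3 * b$1 - a$1 * b$3" "n $ 3 = a$1 * b$2 - a$2 * b$1"
    by (simp_all add: n_def vector_3)
  have par: "n $ i * x $ j = n $ j * x $ i" if "dot3 a x = 0" "dot3 b x = 0" for x i j
  proof -
    have "a$1 * x$1 + a$2 * x$2 + a$3 * x$3 = 0" "b$1 * x$1 + b$2 * x$2 + b$3 * x$3 = 0"
      using that unfolding dot3_def sum_3 by (simp_all only:)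
    note z = cross_parallel[OF this, folded nn]
    have "\<forall>i j. n $ i * x $ j = n $ j * x $ i" unfolding forall_3
      by (intro conjI refl z z[symmetric])
    then show ?thesis by blast
  qed
  have "n \<noteq> 0"
  proof
    assume "n = 0"
    then have "n $ 1 = 0" "n $ 2 = 0" "n $ 3 = 0" by simp_all
    then have m: "a$2 * b$3 = a$3 * b$2" "a$3 * b$1 = a$1 * b$3" "a$1 * b$2 = a$2 * b$1"
      unfolding nn by (simp_all only: right_minus_eq)
    have "a \<noteq> 0" using ind(2) by (metis insertI1 vec.dependent_zero)
    then obtain i where i: "a $ i \<noteq> 0" by (auto simp: Finite_Cartesian_Product.vec_eq_iff)
    have cross: "\<forall>i j. a $ i * b $ j = b $ i * a $ j"
      unfolding forall_3 by (intro conjI; metis m mult.commute)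
    have "b $ j = b $ i / a $ i * a $ j" for j
    proof (rule divide_cross[OF i])
      show "a $ i * b $ j = a $ j * b $ i" using cross[rule_format, of i j] by (metis mult.commute)
    qed
    then obtain t where "\<And>j. b $ j = t * a $ j" by blast
    then have e: "b = t *s a" by (simp add: Finite_Cartesian_Product.vec_eq_iff)
    define S where "S = {a, b} - {b}"
    have "t *s a \<in> vec.span S"
      using ind(1) unfolding S_def by (intro vec.span_scale vec.span_base) simp
    then have "b \<in> vec.span S" by (rule ssubst[OF e])
    then have "b \<in> vec.span ({a, b} - {b})" unfolding S_def .
    then show False using ind(2) unfolding vec.dependent_def by blast
  qed
  then obtain i where i: "n $ i \<noteq> 0" by (auto simp: Finite_Cartesian_Product.vec_eq_iff)
  have "u $ j = u $ i / n $ i * n $ j" "s $ j = s $ i / n $ i * n $ j" for j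
    by (rule divide_cross[OF i par[OF u(1,2)]], rule divide_cross[OF i par[OF s]])
  then obtain y z where yz: "\<And>j. u $ j = y * n $ j" "\<And>j. s $ j = z * n $ j" by blast
  have "y \<noteq> 0"
  proof
    assume "y = 0"
    then have "u = 0" using yz(1) by (simp add: Finite_Cartesian_Product.vec_eq_iff)
    then show False using u(3) by blast
  qed
  then have "s = (z / y) *s u" using yz by (simp add: Finite_Cartesian_Product.vec_eq_iff)
  then show ?thesis by blast
qed

text \<open>The Hessian at the node is H(v) dF dG and also a product of two independent linear
  forms. Hence H(v) \<noteq> 0, and the common kernel of dF and dG is the line of v itself, which
  belongs to it by Euler's relation: the two components are transversal.\<close>

lemma node_kernel:
  assumes F: "homogeneous e F" "homogeneous e' G" "homogeneous e'' H" and v: "v \<noteq> 0" "eval3 F v = 0" "eval3 G v = 0"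
    and node: "is_node (F * G * H) (point v)"
  shows "eval3 H v \<noteq> 0"
    and "eval3 (dird s F) v = 0 \<Longrightarrow> eval3 (dird s G) v = 0 \<Longrightarrow> \<exists>c. s = c *s v"
proof -
  obtain u where u: "u \<in> point v" "u \<noteq> 0" and ex: "\<exists>a b :: complex ^ 3. a \<noteq> b \<and> vec.independent {a, b} \<and>
           (\<forall>w. (\<Sum>i\<in>UNIV. \<Sum>j\<in>UNIV. eval3 (partial_deriv i (partial_deriv j (F * G * H))) u * w $ i * w $ j) / 2
                = (\<Sum>i\<in>UNIV. a $ i * w $ i) * (\<Sum>i\<in>UNIV. b $ i * w $ i))"
    using node[unfolded is_node_def] by (elim conjE bexE)
  from ex obtain a b where ab: "a \<noteq> b" "vec.independent {a, b :: complex^3}"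
    and q: "\<forall>w. (\<Sum>i\<in>UNIV. \<Sum>j\<in>UNIV. eval3 (partial_deriv i (partial_deriv j (F * G * H))) u * w $ i * w $ j) / 2 = dot3 a w * dot3 b w"
    unfolding dot3_def by (elim exE conjE)
  obtain c where c: "u = c *s v" using u(1) by (auto simp: point_def)
  have c0: "c \<noteq> 0" using u(2) c by auto
  have z: "eval3 F u = 0" "eval3 G u = 0" unfolding c eval3_scale[OF F(1)] eval3_scale[OF F(2)] v(2,3) by simp_all
  define f g where "f w = eval3 (dird w F) u" and "g w = eval3 (dird w G) u" for w
  have lin: "f (x + y) = f x + f y" "g (x + y) = g x + g y" for x y
    by (simp_all add: f_def g_def dird_add eval3_add)
  have q': "dot3 a w * dot3 b w = eval3 H u * f w * g w" for w
    using spec[OF q, of w] unfolding hessian_product[OF z] f_def g_def by (rule sym)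
  \<comment> \<open>Polarization of the two expressions for the quadratic form; it gives access to
    its radical.\<close>
  have pol: "dot3 a x * dot3 b y + dot3 a y * dot3 b x = eval3 H u * (f x * g y + f y * g x)" for x y
      proof -
    have "dot3 a x * dot3 b y + dot3 a y * dot3 b x = (dot3 a x + dot3 a y) * (dot3 b x + dot3 b y) - dot3 a x * dot3 b x - dot3 a y * dot3 b y"
      by (simp add: algebra_simps)
    also have "\<dots> = eval3 H u * (f x + f y) * (g x + g y) - eval3 H u * f x * g x - eval3 H u * f y * g y"
      using q'[of "x + y", unfolded dot3_add lin] q'[of x] q'[of y] by (simp only:)
    finally show ?thesis by (simp add: algebra_simps)
  qed
  have "0 \<notin> {a, b}" using ab(2) vec.dependent_zero by blast
  then have nz: "a \<noteq> 0" "b \<noteq> 0" by auto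
  \<comment> \<open>A vector killed by dF and dG up to the factor H(u) is in the radical of the
    product of the two linear forms, and since both forms are nonzero it is in both kernels.\<close>
  have key: "dot3 a x = 0 \<and> dot3 b x = 0" if x: "eval3 H u * f x = 0" "eval3 H u * g x = 0" for x
  proof -
    have s: "dot3 a x * dot3 b y + dot3 a y * dot3 b x = 0" for y
    proof -
      have "eval3 H u * (f x * g y + f y * g x) = eval3 H u * f x * g y + f y * (eval3 H u * g x)" by (simp add: algebra_simps)
      then show ?thesis unfolding pol using x by simp
    qed
    have xx: "dot3 a x * dot3 b x = 0" using s[of x] by (simp only: mult_2[symmetric] mult_eq_0_iff) simp
    show ?thesis
    proof (cases "dot3 a x = 0")
      case True
      have "dot3 b x = 0"
      proof (rule ccontr)
        assume bx: "dot3 b x \<noteq> 0"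
        have "dot3 a y = 0" for y
        proof -
          have "dot3 a y * dot3 b x = 0" using s[of y] unfolding True by simp
          then show ?thesis using bx by simp
        qed
        then have "a = 0" by (rule dot3_eq_0D)
        then show False using nz(1) by blast
      qed
      then show ?thesis using True by simp
    next
      case False
      then have bx: "dot3 b x = 0" using xx by simp
      have "dot3 b y = 0" for y
      proof -
        have "dot3 a x * dot3 b y = 0" using s[of y] unfolding bx by simp
        then show ?thesis using False by simp
      qed
      then have "b = 0" by (rule dot3_eq_0D)
      then show ?thesis using nz(2) by blast
    qed
  qed
  have H0: "eval3 H u \<noteq> 0"
  proof
    assume h: "eval3 H u = 0"
    have "dot3 a x = 0" for x using key[of x] unfolding h by simp
    then have "a = 0" by (rule dot3_eq_0D)
    then show False using nz(1) by blast
  qed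
  then show "eval3 H v \<noteq> 0" unfolding c eval3_scale[OF F(3)] by simp
  assume s: "eval3 (dird s F) v = 0" "eval3 (dird s G) v = 0"
  have fs: "f s = 0" "g s = 0" unfolding f_def g_def c using s
    by (simp_all add: eval3_dird_scale_point[OF F(1)] eval3_dird_scale_point[OF F(2)])
  have fu: "f u = 0" "g u = 0" unfolding f_def g_def using z by (simp_all add: eval3_dird_self[OF F(1)] eval3_dird_self[OF F(2)])
  have "dot3 a u = 0" "dot3 b u = 0" "dot3 a s = 0" "dot3 b s = 0" using key[of u] key[of s] fs fu by simp_all
  then obtain c' where "s = c' *s u" using kernel_unique[OF ab _ _ u(2)] by blast
  then have "s = (c' * c) *s v" by (simp add: c)
  then show "\<exists>c. s = c *s v" by blast
qed

subsection \<open>Orders of forms along a branch\<close>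

context branches
begin

text \<open>The columns of \<open>A\<close>: \<open>\<pp>\<close> and \<open>\<oo>\<close> span the
  line over t = 0, \<open>\<oo>\<close> is the projection centre, and \<open>\<ww>\<close> is the
  direction in which t moves.\<close>

definition "\<pp> = A *v vector [1,0,0]"
definition "\<ww> = A *v vector [0,1,0]"
definition "\<oo> = A *v vector [0,0,1]"

lemma A_vector: "A *v vector [x,y,z] = x *s \<pp> + y *s \<ww> + z *s \<oo>"
  by (simp add: \<pp>_def \<ww>_def \<oo>_def Finite_Cartesian_Product.vec_eq_iff matrix_vector_mult_def sum_3 vector_3 algebra_simps)

lemma A_basis: "\<pp> $ i = A $ i $ 1" "\<ww> $ i = A $ i $ 2" "\<oo> $ i = A $ i $ 3"
  by (simp_all add: \<pp>_def \<ww>_def \<oo>_def matrix_vector_mult_def sum_3 vector_3)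

lemma A_injective: assumes "x *s \<pp> + y *s \<ww> + z *s \<oo> = x' *s \<pp> + y' *s \<ww> + z' *s \<oo>" shows "x = x'" "y = y'" "z = z'"
proof -
  have "A *v vector [x,y,z] = A *v vector [x',y',z']" using assms by (simp only: A_vector)
  then have "B *v (A *v vector [x,y,z]) = B *v (A *v vector [x',y',z'])" by simp
  then have v: "(vector [x,y,z] :: complex^3) = vector [x',y',z']" by (simp add: matrix_vector_mul_assoc BA)
  show "x = x'" "y = y'" "z = z'"
    using arg_cong[OF v, of "\<lambda>v. v $ 1"] arg_cong[OF v, of "\<lambda>v. v $ 2"] arg_cong[OF v, of "\<lambda>v. v $ 3"] by (simp_all add: vector_3)
qed

lemma center_eq: "center k = \<pp> + fps_nth (\<eta> k) 0 *s \<oo>" by (simp add: center_def A_vector)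

lemma place_dird: "place k (dird a F) = fps_const (a $ 1) * place k (partial_deriv 1 F) + fps_const (a $ 2) * place k (partial_deriv 2 F) + fps_const (a $ 3) * place k (partial_deriv 3 F)"
proof -
  interpret p: comm_ring_hom "place k" by (rule place_hom)
  have "place k (K3 c) = fps_const c" for c unfolding place_expand by (simp add: ev_simps[OF comm_ring_hom_fps_const])
  then show ?thesis by (simp add: dird_def p.hom_add p.hom_mult)
qed

lemma place_chain: "fps_deriv (place k F) = of_nat N * fps_X ^ (N - 1) * place k (dird \<ww> F) + fps_deriv (\<eta> k) * place k (dird \<oo> F)"
proof -
  define l where "l i = lin fps_const A 1 (fps_X ^ N) (\<eta> k) i" for i
  have dl: "fps_deriv (l i) = fps_const (\<ww> $ i) * (of_nat N * fps_X ^ (N - 1)) + fps_const (\<oo> $ i) * fps_deriv (\<eta> k)" for i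
    by (simp add: l_def lin_def A_basis fps_deriv_power fps_of_nat)
  have "fps_deriv (place k F) = fps_deriv (l 1) * place k (partial_deriv 1 F) + fps_deriv (l 2) * place k (partial_deriv 2 F) + fps_deriv (l 3) * place k (partial_deriv 3 F)"
    unfolding place_expand l_def by (rule chain_rule_ev3[OF derivation_fps_deriv comm_ring_hom_fps_const]) simp
  then show ?thesis unfolding dl place_dird by (simp add: algebra_simps)
qed

lemma place_euler: assumes "homogeneous e F"
  shows "place k (dird \<pp> F) + fps_X ^ N * place k (dird \<ww> F) + \<eta> k * place k (dird \<oo> F) = of_nat e * place k F"
  unfolding place_dird using euler_ev3[OF assms comm_ring_hom_fps_const, of "lin fps_const A 1 (fps_X ^ N) (\<eta> k) 1"
      "lin fps_const A 1 (fps_X ^ N) (\<eta> k) 2" "lin fps_const A 1 (fps_X ^ N) (\<eta> k) 3", folded place_expand]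
  by (simp add: lin_def A_basis algebra_simps)

text \<open>Since \<open>C\<close> vanishes on the root, the chain rule expresses the derivative
  along \<open>\<ww>\<close> by the one along \<open>\<oo>\<close>, and Euler's relation then does
  the same for \<open>\<pp>\<close>. The polar at the centre thus becomes a multiple of the
  derivative along \<open>\<oo>\<close>.\<close>

lemma place_dird_center:
  assumes "k < d"
  shows "of_nat N * place k (dird (center k) C) = place k (dird \<oo> C) * (fps_X * fps_deriv (\<eta> k) - of_nat N * (\<eta> k - fps_const (fps_nth (\<eta> k) 0)))"
proof -
  have XN: "fps_X * fps_X ^ (N - 1) = (fps_X ^ N :: complex fps)" using N0 by (metis Suc_pred' power_Suc)
  have 1: "of_nat N * (fps_X * fps_X ^ (N - 1)) * place k (dird \<ww> C) + fps_X * fps_deriv (\<eta> k) * place k (dird \<oo> C) = 0"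
    using arg_cong[OF place_chain[of k C], of "\<lambda>x. fps_X * x"] place_C[OF assms] by (simp add: algebra_simps)
  have 2: "place k (dird \<pp> C) = - (fps_X ^ N * place k (dird \<ww> C) + \<eta> k * place k (dird \<oo> C))"
    using place_euler[OF hom, of k] place_C[OF assms] by (simp add: algebra_simps eq_neg_iff_add_eq_0)
  interpret p: comm_ring_hom "place k" by (rule place_hom)
  have K: "place k (K3 c) = fps_const c" for c unfolding place_expand by (simp add: ev_simps[OF comm_ring_hom_fps_const])
  have "place k (dird (center k) C) = place k (dird \<pp> C) + fps_const (fps_nth (\<eta> k) 0) * place k (dird \<oo> C)"
    by (simp add: center_eq dird_add dird_scale p.hom_add p.hom_mult K)
  also have "of_nat N * \<dots> = - (of_nat N * (fps_X ^ N * place k (dird \<ww> C))) - of_nat N * (\<eta> k * place k (dird \<oo> C))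
      + of_nat N * (fps_const (fps_nth (\<eta> k) 0) * place k (dird \<oo> C))"
    unfolding 2 by (simp add: algebra_simps)
  also have "of_nat N * (fps_X ^ N * place k (dird \<ww> C)) = - (fps_X * fps_deriv (\<eta> k) * place k (dird \<oo> C))"
    using 1 unfolding XN by (simp add: eq_neg_iff_add_eq_0 mult.assoc)
  finally show ?thesis by (simp add: algebra_simps)
qed

text \<open>The derivative towards the projection centre is the derivative with respect to the third
  coordinate; at one of the roots it is the product of the differences with the others.\<close>

lemma place_dird_o:
  assumes "k < d"
  shows "place k (dird \<oo> C) = fps_const \<kappa> * (\<Prod>l\<in>{..<d} - {k}. \<eta> k - \<eta> l)"
proof -
  define \<iota> where "\<iota> = (\<lambda>c::complex. [:fps_const c:])"
  have hi: "comm_ring_hom \<iota>" unfolding \<iota>_def by (rule comm_ring_hom_const_poly[OF comm_ring_hom_fps_const])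
  have hk: "comm_ring_hom (\<lambda>q. poly q (\<eta> k))" by unfold_locales simp_all
  define L where "L i = lin \<iota> A 1 [:fps_X ^ N:] [:0,1:] i" for i
  have Lk: "poly (L i) (\<eta> k) = lin fps_const A 1 (fps_X ^ N) (\<eta> k) i" for i by (simp add: L_def lin_def \<iota>_def)
  have evk: "poly (ev3 \<iota> (L 1) (L 2) (L 3) F) (\<eta> k) = place k F" for F
    unfolding hom_ev3[OF hi hk] Lk place_expand by (simp add: \<iota>_def)
  have dL: "pderiv (L i) = [:fps_const (\<oo> $ i):]" for i
    by (simp add: L_def lin_def \<iota>_def A_basis pderiv_add pderiv_mult pderiv_pCons)
  have "ev3 \<iota> (L 1) (L 2) (L 3) C = map_poly (ev2 fps_const 1 (fps_X ^ N)) (lsub A C)"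
  proof -
    have hm: "comm_ring_hom (map_poly (ev2 fps_const 1 (fps_X ^ N :: complex fps)))"
    proof -
      interpret e: comm_ring_hom "ev2 fps_const 1 (fps_X ^ N :: complex fps)" by (rule ev2_hom[OF comm_ring_hom_fps_const])
      interpret m: map_poly_comm_ring_hom "ev2 fps_const 1 (fps_X ^ N :: complex fps)" ..
      show ?thesis by (rule m.comm_ring_hom_axioms)
    qed
    interpret hm: comm_ring_hom "map_poly (ev2 fps_const 1 (fps_X ^ N :: complex fps))" by (rule hm)
    interpret e: comm_ring_hom "ev2 fps_const 1 (fps_X ^ N :: complex fps)" by (rule ev2_hom[OF comm_ring_hom_fps_const])
    have c: "map_poly (ev2 fps_const 1 (fps_X ^ N)) (K3 c) = \<iota> c" for c
      by (simp add: K3_def \<iota>_def map_poly_hom_pCons[OF e.comm_ring_hom_axioms] ev_simps[OF comm_ring_hom_fps_const])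
    have x: "map_poly (ev2 fps_const 1 (fps_X ^ N)) X1 = [:1:]" "map_poly (ev2 fps_const 1 (fps_X ^ N)) X2 = [:fps_X ^ N:]"
      "map_poly (ev2 fps_const 1 (fps_X ^ N)) X3 = [:0,1:]"
      by (simp_all add: X1_def X2_def X3_def map_poly_hom_pCons[OF e.comm_ring_hom_axioms] ev_simps[OF comm_ring_hom_fps_const])
    have l: "map_poly (ev2 fps_const 1 (fps_X ^ N)) (lin K3 A X1 X2 X3 i) = L i" for i
      by (simp add: lin_def L_def hm.hom_add hm.hom_mult c x one_pCons)
    show ?thesis unfolding lsub_def hom_ev3[OF comm_ring_hom_K3 hm] l c ..
  qed
  also have "\<dots> = smult (fps_const \<kappa>) (\<Prod>l<d. [:- \<eta> l, 1:])"
    unfolding map_poly_monic_eq(1)[OF ev2_hom[OF comm_ring_hom_fps_const]] split by (simp add: ev_simps[OF comm_ring_hom_fps_const])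
  finally have eq: "ev3 \<iota> (L 1) (L 2) (L 3) C = smult (fps_const \<kappa>) (\<Prod>l<d. [:- \<eta> l, 1:])" .
  have "place k (dird \<oo> C) = poly (pderiv (ev3 \<iota> (L 1) (L 2) (L 3) C)) (\<eta> k)"
  proof -
    have "pderiv (ev3 \<iota> (L 1) (L 2) (L 3) C) = pderiv (L 1) * ev3 \<iota> (L 1) (L 2) (L 3) (partial_deriv 1 C)
       + pderiv (L 2) * ev3 \<iota> (L 1) (L 2) (L 3) (partial_deriv 2 C) + pderiv (L 3) * ev3 \<iota> (L 1) (L 2) (L 3) (partial_deriv 3 C)"
      by (rule chain_rule_ev3[OF derivation_pderiv hi]) (simp add: \<iota>_def pderiv_pCons)
    then show ?thesis unfolding dL by (simp add: evk place_dird)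
  qed
  also have "\<dots> = fps_const \<kappa> * poly (pderiv (\<Prod>l<d. [:- \<eta> l, 1:])) (\<eta> k)" unfolding eq by (simp add: pderiv_smult)
  also have "poly (pderiv (\<Prod>l<d. [:- \<eta> l, 1:])) (\<eta> k) = (\<Sum>j<d. poly (\<Prod>l\<in>{..<d} - {j}. [:- \<eta> l, 1:]) (\<eta> k))"
    by (simp add: pderiv_prod pderiv_pCons poly_sum)
  also have "\<dots> = (\<Sum>j\<in>{k}. poly (\<Prod>l\<in>{..<d} - {j}. [:- \<eta> l, 1:]) (\<eta> k))"
    using assms by (intro sum.mono_neutral_right) (auto simp: poly_prod prod_zero_iff)
  also have "\<dots> = (\<Prod>l\<in>{..<d} - {k}. \<eta> k - \<eta> l)" by (simp add: poly_prod)
  finally show ?thesis .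
qed

end

context branches
begin

lemma fps_X_power_dvd_iff: "fps_X ^ n dvd (f :: complex fps) \<longleftrightarrow> f = 0 \<or> n \<le> subdegree f"
proof
  assume "fps_X ^ n dvd f"
  then obtain g where "f = fps_X ^ n * g" by (rule dvdE)
  then show "f = 0 \<or> n \<le> subdegree f" by (cases "g = 0") (auto simp: subdegree_mult fps_X_power_subdegree)
next
  assume "f = 0 \<or> n \<le> subdegree f"
  then show "fps_X ^ n dvd f" by (metis dvd_0_right dvd_triv_right fps_shift_times_fps_X_power)
qed

lemma place_taylor:
  assumes u: "u dvd g" "u dvd h"
  shows "u\<^sup>2 dvd ev3 fps_const (lin fps_const A 1 x y 1 + (fps_const (\<ww> $ 1) * g + fps_const (\<oo> $ 1) * h))
      (lin fps_const A 1 x y 2 + (fps_const (\<ww> $ 2) * g + fps_const (\<oo> $ 2) * h))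
      (lin fps_const A 1 x y 3 + (fps_const (\<ww> $ 3) * g + fps_const (\<oo> $ 3) * h)) F
    - ev3 fps_const (lin fps_const A 1 x y 1) (lin fps_const A 1 x y 2) (lin fps_const A 1 x y 3) F
    - (g * ev3 fps_const (lin fps_const A 1 x y 1) (lin fps_const A 1 x y 2) (lin fps_const A 1 x y 3) (dird \<ww> F)
     + h * ev3 fps_const (lin fps_const A 1 x y 1) (lin fps_const A 1 x y 2) (lin fps_const A 1 x y 3) (dird \<oo> F))"
proof -
  define E where "E = ev3 fps_const (lin fps_const A 1 x y 1) (lin fps_const A 1 x y 2) (lin fps_const A 1 x y 3)"
  interpret E: comm_ring_hom E unfolding E_def by (rule ev3_hom[OF comm_ring_hom_fps_const])
  have K: "E (K3 c) = fps_const c" for c by (simp add: E_def ev_simps[OF comm_ring_hom_fps_const])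
  have dvd: "u dvd fps_const (\<ww> $ i) * g + fps_const (\<oo> $ i) * h" for i using u by (intro dvd_add dvd_mult)
  have s: "g * E (dird \<ww> F) + h * E (dird \<oo> F) = (fps_const (\<ww> $ 1) * g + fps_const (\<oo> $ 1) * h) * E (partial_deriv 1 F)
     + (fps_const (\<ww> $ 2) * g + fps_const (\<oo> $ 2) * h) * E (partial_deriv 2 F) + (fps_const (\<ww> $ 3) * g + fps_const (\<oo> $ 3) * h) * E (partial_deriv 3 F)"
    by (simp add: dird_def E.hom_add E.hom_mult K algebra_simps)
  show ?thesis
    using taylor_ev3[OF comm_ring_hom_fps_const dvd[of 1] dvd[of 2] dvd[of 3], of "lin fps_const A 1 x y 1" "lin fps_const A 1 x y 2" "lin fps_const A 1 x y 3" F]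
    unfolding E_def[symmetric] s .
qed

lemma lin_shift: "lin fps_const A 1 (x + g) (y + h) i = lin fps_const A 1 x y i + (fps_const (\<ww> $ i) * g + fps_const (\<oo> $ i) * h)"
  by (simp add: lin_def A_basis algebra_simps)

lemma ev3_const_point: "ev3 fps_const (lin fps_const A 1 0 (fps_const c) 1) (lin fps_const A 1 0 (fps_const c) 2) (lin fps_const A 1 0 (fps_const c) 3) F
   = fps_const (eval3 F (\<pp> + c *s \<oo>))"
proof -
  have l: "lin fps_const A 1 0 (fps_const c) i = fps_const ((\<pp> + c *s \<oo>) $ i)" for i
    by (simp add: lin_def A_basis mult.commute)
  show ?thesis unfolding l eval3_ev3 hom_ev3[OF comm_ring_hom_id comm_ring_hom_fps_const] ..
qed

lemma place_lin: "place k F = ev3 fps_const (lin fps_const A 1 (0 + fps_X ^ N) (fps_const c + (\<eta> k - fps_const c)) 1)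
    (lin fps_const A 1 (0 + fps_X ^ N) (fps_const c + (\<eta> k - fps_const c)) 2) (lin fps_const A 1 (0 + fps_X ^ N) (fps_const c + (\<eta> k - fps_const c)) 3) F"
  by (simp add: place_expand)

text \<open>Both displacements X^N and \<eta>_k - c are divisible by X^w, so second-order terms
  start at X^(2*w) and the coefficient of X^w is the derivative along the leading
  displacement.\<close>

lemma place_first_order:
  assumes "w \<le> N" "0 < w" "fps_X ^ w dvd \<eta> k - fps_const c" "eval3 F (\<pp> + c *s \<oo>) = 0"
  shows "fps_nth (place k F) w = eval3 (dird (fps_nth (fps_X ^ N) w *s \<ww> + fps_nth (\<eta> k) w *s \<oo>) F) (\<pp> + c *s \<oo>)"
proof -
  have "fps_X ^ w dvd (fps_X ^ N :: complex fps)" using assms(1) by (rule le_imp_power_dvd)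
  from place_taylor[OF this assms(3), of 0 "fps_const c" F, folded lin_shift, folded place_lin, unfolded ev3_const_point assms(4)]
  obtain r where r: "place k F - fps_const 0 - (fps_X ^ N * fps_const (eval3 (dird \<ww> F) (\<pp> + c *s \<oo>)) + (\<eta> k - fps_const c) * fps_const (eval3 (dird \<oo> F) (\<pp> + c *s \<oo>)))
      = (fps_X ^ w)\<^sup>2 * r" by (rule dvdE)
  have "fps_nth ((fps_X ^ w)\<^sup>2 * r) w = 0" using assms(2) by (simp add: fps_X_power_mult_nth flip: power_mult)
  then have "fps_nth (place k F - fps_const 0 - (fps_X ^ N * fps_const (eval3 (dird \<ww> F) (\<pp> + c *s \<oo>)) + (\<eta> k - fps_const c) * fps_const (eval3 (dird \<oo> F) (\<pp> + c *s \<oo>)))) w = 0"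
    unfolding r .
  then have "fps_nth (place k F) w = fps_nth (fps_X ^ N) w * eval3 (dird \<ww> F) (\<pp> + c *s \<oo>) + fps_nth (\<eta> k) w * eval3 (dird \<oo> F) (\<pp> + c *s \<oo>)"
    using assms(2) by (simp add: algebra_simps)
  then show ?thesis by (simp add: dird_add dird_scale eval3_add eval3_mult eval3_K3)
qed

text \<open>The contact of the root with a generic line through its centre. The order of the zero
  series is 0 by convention, so a constant root is treated apart; then only t moves and the contact
  is N.\<close>

definition "lord k = (if \<eta> k = fps_const (fps_nth (\<eta> k) 0) then N else min N (subdegree (\<eta> k - fps_const (fps_nth (\<eta> k) 0))))"

lemma lord_props: "lord k \<le> N" "0 < lord k" "fps_X ^ lord k dvd \<eta> k - fps_const (fps_nth (\<eta> k) 0)"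
  "fps_nth (fps_X ^ N) (lord k) \<noteq> (0::complex) \<or> fps_nth (\<eta> k) (lord k) \<noteq> 0"
proof -
  define h where "h = \<eta> k - fps_const (fps_nth (\<eta> k) 0)"
  have h0: "fps_nth h 0 = 0" by (simp add: h_def)
  have hz: "\<eta> k = fps_const (fps_nth (\<eta> k) 0) \<longleftrightarrow> h = 0" by (simp add: h_def)
  have sd: "h \<noteq> 0 \<Longrightarrow> 0 < subdegree h" using h0 by (metis gr0I nth_subdegree_nonzero)
  have l: "lord k = (if h = 0 then N else min N (subdegree h))" unfolding lord_def hz h_def ..
  show "lord k \<le> N" "0 < lord k" using N0 sd by (auto simp: l)
  show "fps_X ^ lord k dvd \<eta> k - fps_const (fps_nth (\<eta> k) 0)"
    unfolding fps_X_power_dvd_iff h_def[symmetric] by (auto simp: l)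
  show "fps_nth (fps_X ^ N) (lord k) \<noteq> (0::complex) \<or> fps_nth (\<eta> k) (lord k) \<noteq> 0"
  proof (cases "lord k = N")
    case True then show ?thesis by (simp add: fps_X_power_nth)
  next
    case False
    then have "lord k = subdegree h" "h \<noteq> 0" by (auto simp: l split: if_splits)
    then have "fps_nth h (lord k) \<noteq> 0" "0 < lord k" using nth_subdegree_nonzero sd by auto
    then show ?thesis by (simp add: h_def)
  qed
qed

text \<open>The leading displacement is not proportional to the centre, so by transversality one of
  the two differentials is nonzero on it, and that form vanishes only to order \<open>lord\<close>,
  at most.\<close>

lemma val_min_le_lord:
  assumes "eval3 F (center k) = 0" "eval3 G (center k) = 0"
    and ker: "\<And>s. eval3 (dird s F) (center k) = 0 \<Longrightarrow> eval3 (dird s G) (center k) = 0 \<Longrightarrow> \<exists>c. s = c *s center k"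
  shows "val k F \<le> lord k \<or> val k G \<le> lord k"
proof -
  define s where "s = fps_nth (fps_X ^ N) (lord k) *s \<ww> + fps_nth (\<eta> k) (lord k) *s \<oo>"
  have "\<not> (\<exists>c. s = c *s center k)"
  proof
    assume "\<exists>c. s = c *s center k"
    then obtain c where "s = c *s center k" by blast
    then have e: "0 *s \<pp> + fps_nth (fps_X ^ N) (lord k) *s \<ww> + fps_nth (\<eta> k) (lord k) *s \<oo> = c *s \<pp> + 0 *s \<ww> + (c * fps_nth (\<eta> k) 0) *s \<oo>"
      by (simp add: s_def center_eq vector_add_ldistrib vector_smult_assoc)
    from A_injective[OF e] show False using lord_props(4)[of k] by auto
  qed
  then have "eval3 (dird s F) (center k) \<noteq> 0 \<or> eval3 (dird s G) (center k) \<noteq> 0" using ker by blast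
  then have "fps_nth (place k F) (lord k) \<noteq> 0 \<or> fps_nth (place k G) (lord k) \<noteq> 0"
    using place_first_order[OF lord_props(1,2,3)[of k], of F] place_first_order[OF lord_props(1,2,3)[of k], of G] assms(1,2)
    unfolding s_def center_eq by simp
  then show ?thesis unfolding val_def using subdegree_leI by blast
qed

text \<open>As \<open>F\<close> has nonzero derivative towards the projection centre, its values on
  two roots with equal centre differ by a unit times the difference of the roots.\<close>

lemma root_difference:
  assumes k: "fps_nth (\<eta> k) 0 = fps_nth (\<eta> l) 0" and g: "eval3 (dird \<oo> F) (center l) \<noteq> 0"
    and a: "fps_X ^ a dvd place k F" "fps_X ^ a dvd place l F"
  shows "fps_X ^ a dvd \<eta> k - \<eta> l"
proof -
  define h where "h = \<eta> k - \<eta> l"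
  have h0: "fps_nth h 0 = 0" using k by (simp add: h_def)
  have pl: "place k F = ev3 fps_const (lin fps_const A 1 (fps_X ^ N + 0) (\<eta> l + h) 1) (lin fps_const A 1 (fps_X ^ N + 0) (\<eta> l + h) 2) (lin fps_const A 1 (fps_X ^ N + 0) (\<eta> l + h) 3) F"
    by (simp add: place_expand h_def)
  from place_taylor[OF dvd_0_right dvd_refl, of h "fps_X ^ N" "\<eta> l" F, folded lin_shift, folded pl, folded place_expand]
  obtain r where "place k F - place l F - (0 * place l (dird \<ww> F) + h * place l (dird \<oo> F)) = h\<^sup>2 * r" by (rule dvdE)
  then have e: "place k F - place l F = h * (place l (dird \<oo> F) + h * r)" by (simp add: algebra_simps power2_eq_square)
  have "fps_nth (place l (dird \<oo> F) + h * r) 0 \<noteq> 0" using g h0 by (simp add: place_nth_0)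
  then have "is_unit (place l (dird \<oo> F) + h * r)" by (simp add: fps_is_unit_iff)
  moreover have "fps_X ^ a dvd h * (place l (dird \<oo> F) + h * r)" using a by (simp flip: e)
  ultimately show ?thesis unfolding h_def[symmetric] by (simp add: dvd_mult_unit_iff)
qed

end

lemma eval3_linear:
  assumes F: "homogeneous 1 F"
  shows "eval3 (dird a F) v = eval3 F a" "eval3 F (x + y) = eval3 F x + eval3 F y" "eval3 F (c *s x) = c * eval3 F x"
proof -
  have const: "eval3 (partial_deriv i F) v = eval3 (partial_deriv i F) 0" for i v
    using eval3_scale[OF partial_deriv_homogeneous[OF F, of i], of 0 v] by simp
  have d: "eval3 (dird a F) v = eval3 F a" for a v
  proof -
    have "eval3 (dird a F) v = eval3 (dird a F) a" unfolding eval3_dird const[of _ v] const[of _ a] ..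
    then show ?thesis using eval3_dird_self[OF F, of a] by simp
  qed
  show "eval3 (dird a F) v = eval3 F a" by (rule d)
  show "eval3 F (x + y) = eval3 F x + eval3 F y"
    unfolding d[symmetric, of _ 0] dird_add eval3_add ..
  show "eval3 F (c *s x) = c * eval3 F x" using eval3_scale[OF F, of c x] by simp
qed

context branches
begin

lemma dvd_degree: assumes "C dvd G" "homogeneous e G" "G \<noteq> 0" shows "d \<le> e"
proof -
  interpret a: comm_ring_hom "lsub A" by (rule lsub_hom)
  have "lsub A C dvd lsub A G" using assms(1) by (rule a.hom_dvd)
  moreover have "lsub A G \<noteq> 0"
  proof
    interpret b: comm_ring_hom "lsub B" by (rule lsub_hom)
    assume "lsub A G = 0"
    then have "lsub B (lsub A G) = 0" by simp
    then show False using lsub_lsub[OF AB, of G] assms(3) by simp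
  qed
  ultimately have "degree (lsub A C) \<le> degree (lsub A G)" by (rule dvd_imp_degree_le)
  then show ?thesis using homogeneous_top_coeff(1)[OF homogeneous_lsub[OF assms(2), of A]] CA(1) by simp
qed

lemma X_deriv_power: "fps_X * fps_deriv (fps_X ^ n) = (of_nat n * fps_X ^ n :: complex fps)"
  by (induction n) (simp_all add: algebra_simps)

lemma X_deriv_dvd: assumes "fps_X ^ n dvd (f :: complex fps)" shows "fps_X ^ n dvd fps_X * fps_deriv f"
proof -
  obtain g where g: "f = fps_X ^ n * g" using assms by (rule dvdE)
  have "fps_X * fps_deriv f = fps_X * fps_deriv (fps_X ^ n) * g + fps_X ^ n * (fps_X * fps_deriv g)"
    unfolding g by (simp add: algebra_simps)
  also have "\<dots> = fps_X ^ n * (of_nat n * g + fps_X * fps_deriv g)"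
    unfolding X_deriv_power by (simp add: algebra_simps)
  finally show ?thesis by simp
qed

end

section \<open>Charts in which P and Q both lie over t = 0, with root values 0 and 1\<close>

locale pq_chart = branches +
  assumes Cp: "eval3 C \<pp> = 0" and Cq: "eval3 C (\<pp> + \<oo>) = 0" and d2: "2 \<le> d"
    and fibP: "\<And>M M'. (point \<pp>, M) \<in> normalization C \<Longrightarrow> (point \<pp>, M') \<in> normalization C \<Longrightarrow> M = M'"
    and fibQ: "\<And>M M'. (point (\<pp> + \<oo>), M) \<in> normalization C \<Longrightarrow> (point (\<pp> + \<oo>), M') \<in> normalization C \<Longrightarrow> M = M'"
begin

definition "\<qq> = \<pp> + \<oo>"
definition "KP = {k. k < d \<and> fps_nth (\<eta> k) 0 = 0}"
definition "KQ = {k. k < d \<and> fps_nth (\<eta> k) 0 = 1}"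
text \<open>As numbers of roots, m and n are the intersection multiplicities of \<open>C\<close>
  with the line PQ at P and Q.\<close>

definition "m = card KP"
definition "n = card KQ"

lemma K_finite: "finite KP" "finite KQ" by (simp_all add: KP_def KQ_def)

lemma center_P: "k \<in> KP \<Longrightarrow> center k = \<pp>" and center_Q: "k \<in> KQ \<Longrightarrow> center k = \<qq>"
  by (simp_all add: KP_def KQ_def center_eq \<qq>_def)

lemma pq_nonzero: "\<pp> \<noteq> 0" "\<qq> \<noteq> 0"
proof -
  have "1 *s \<pp> + 0 *s \<ww> + z *s \<oo> \<noteq> 0" for z
    using A_injective(1)[of 1 0 z 0 0 0] by auto
  from this[of 0] this[of 1] show "\<pp> \<noteq> 0" "\<qq> \<noteq> 0" by (simp_all add: \<qq>_def)
qed

lemma K_nonempty: "KP \<noteq> {}" "KQ \<noteq> {}"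
proof -
  have "eval3 C (A *v vector [1,0,0]) = 0" using Cp by (simp add: A_vector)
  then obtain k where "k < d" "fps_nth (\<eta> k) 0 = 0" by (rule exists_center)
  then show "KP \<noteq> {}" by (auto simp: KP_def)
  have "eval3 C (A *v vector [1,0,1]) = 0" using Cq by (simp add: A_vector)
  then obtain k where "k < d" "fps_nth (\<eta> k) 0 = 1" by (rule exists_center)
  then show "KQ \<noteq> {}" by (auto simp: KQ_def)
qed

lemma KPQ_disjoint: "KP \<inter> KQ = {}" by (auto simp: KP_def KQ_def)
lemma KPQ_subset: "KP \<union> KQ \<subseteq> {..<d}" by (auto simp: KP_def KQ_def)

lemma mn: "0 < m" "0 < n" "m + n \<le> d"
proof -
  show "0 < m" "0 < n" using K_nonempty K_finite by (simp_all add: m_def n_def card_gt_0_iff)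
  have "m + n = card (KP \<union> KQ)" using K_finite KPQ_disjoint by (simp add: m_def n_def card_Un_disjoint)
  also have "\<dots> \<le> d" using card_mono[OF _ KPQ_subset] by simp
  finally show "m + n \<le> d" .
qed

definition "kp = (SOME k. k \<in> KP)"
definition "kq = (SOME k. k \<in> KQ)"

lemma kp: "kp \<in> KP" and kq: "kq \<in> KQ"
  using K_nonempty unfolding kp_def kq_def by (metis ex_in_conv someI_ex)+

lemma KP_less: "k \<in> KP \<Longrightarrow> k < d" and KQ_less: "k \<in> KQ \<Longrightarrow> k < d" by (simp_all add: KP_def KQ_def)

lemma valP: assumes "k \<in> KP" "homogeneous e G" "\<not> C dvd G" shows "val k G = val kp G"
proof (rule val_eq)
  show "center k = center kp" using center_P assms(1) kp by simp
  show "Mideal k = Mideal kp"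
    using Mideal_normalization[OF KP_less[OF assms(1)]] Mideal_normalization[OF KP_less[OF kp]]
    unfolding center_P[OF assms(1)] center_P[OF kp] by (rule fibP)
qed (use assms kp KP_less in auto)

lemma valQ: assumes "k \<in> KQ" "homogeneous e G" "\<not> C dvd G" shows "val k G = val kq G"
proof (rule val_eq)
  show "center k = center kq" using center_Q assms(1) kq by simp
  show "Mideal k = Mideal kq"
    using Mideal_normalization[OF KQ_less[OF assms(1)]] Mideal_normalization[OF KQ_less[OF kq]]
    unfolding center_Q[OF assms(1)] center_Q[OF kq] \<qq>_def by (rule fibQ)
qed (use assms kq KQ_less in auto)

lemma sum_PQ:
  assumes "homogeneous e G" "\<not> C dvd G"
  shows "(\<Sum>k\<in>KP \<union> KQ. val k G) = m * val kp G + n * val kq G"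
proof -
  have "(\<Sum>k\<in>KP. val k G) = (\<Sum>k\<in>KP. val kp G)" "(\<Sum>k\<in>KQ. val k G) = (\<Sum>k\<in>KQ. val kq G)"
    using valP[OF _ assms] valQ[OF _ assms] by (auto intro: sum.cong)
  then show ?thesis unfolding sum.union_disjoint[OF K_finite KPQ_disjoint] by (simp add: m_def n_def)
qed

lemma sum_PQ_le:
  assumes "homogeneous e G" "\<not> C dvd G" shows "m * val kp G + n * val kq G \<le> N * (d * e)"
proof -
  have "(\<Sum>k\<in>KP \<union> KQ. val k G) \<le> (\<Sum>k<d. val k G)" by (rule sum_mono2[OF _ KPQ_subset]) auto
  then show ?thesis using bezout_le[OF assms] unfolding sum_PQ[OF assms] by linarith
qed

lemma sum_PQ_eq:
  assumes G: "homogeneous e G" "\<not> C dvd G"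
    and zeros: "\<And>v. v \<noteq> 0 \<Longrightarrow> eval3 C v = 0 \<Longrightarrow> eval3 G v = 0 \<Longrightarrow> (\<exists>c. v = c *s \<pp>) \<or> (\<exists>c. v = c *s \<qq>)"
  shows "m * val kp G + n * val kq G = N * (d * e)"
proof -
  have "(\<Sum>k\<in>KP \<union> KQ. val k G) = (\<Sum>k<d. val k G)"
  proof (rule sum.mono_neutral_left[OF _ KPQ_subset])
    show "\<forall>k\<in>{..<d} - (KP \<union> KQ). val k G = 0"
    proof
      fix k assume k: "k \<in> {..<d} - (KP \<union> KQ)"
      then have k': "k < d" "fps_nth (\<eta> k) 0 \<noteq> 0" "fps_nth (\<eta> k) 0 \<noteq> 1" by (auto simp: KP_def KQ_def)
      have c: "center k = 1 *s \<pp> + 0 *s \<ww> + fps_nth (\<eta> k) 0 *s \<oo>" by (simp add: center_eq)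
      have "eval3 G (center k) \<noteq> 0"
      proof
        assume "eval3 G (center k) = 0"
        then consider a where "center k = a *s \<pp>" | a where "center k = a *s \<qq>"
          using zeros[OF center_nonzero place_C_center[OF k'(1)]] by blast
        then show False
        proof cases
          case 1
          then have "1 *s \<pp> + 0 *s \<ww> + fps_nth (\<eta> k) 0 *s \<oo> = a *s \<pp> + 0 *s \<ww> + 0 *s \<oo>" using c by simp
          from A_injective(3)[OF this] show False using k' by simp
        next
          case 2
          then have "1 *s \<pp> + 0 *s \<ww> + fps_nth (\<eta> k) 0 *s \<oo> = a *s \<pp> + 0 *s \<ww> + a *s \<oo>"
            using c by (simp add: \<qq>_def vector_add_ldistrib)
          from A_injective(1,3)[OF this] show False using k' by simp
        qed
      qed
      then show "val k G = 0" by (rule card_le_sum_val)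
    qed
  qed simp
  moreover have "(\<Sum>k<d. val k G) = N * (d * e)"
  proof (rule bezout_eq[OF G])
    fix x z assume C0: "eval3 C (A *v vector [x,1,z]) = 0"
    have v: "A *v vector [x,1,z] = x *s \<pp> + 1 *s \<ww> + z *s \<oo>" by (rule A_vector)
    show "eval3 G (A *v vector [x,1,z]) \<noteq> 0"
    proof
      assume G0: "eval3 G (A *v vector [x,1,z]) = 0"
      have "A *v vector [x,1,z] \<noteq> 0" unfolding v using A_injective(2)[of x 1 z 0 0 0] by auto
      from zeros[OF this C0 G0] consider a where "A *v vector [x,1,z] = a *s \<pp>" | a where "A *v vector [x,1,z] = a *s \<qq>" by blast
      then show False
      proof cases
        case 1
        then have "x *s \<pp> + 1 *s \<ww> + z *s \<oo> = a *s \<pp> + 0 *s \<ww> + 0 *s \<oo>" using v by simp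
        from A_injective(2)[OF this] show False by simp
      next
        case 2
        then have "x *s \<pp> + 1 *s \<ww> + z *s \<oo> = a *s \<pp> + 0 *s \<ww> + a *s \<oo>" using v by (simp add: \<qq>_def vector_add_ldistrib)
        from A_injective(2)[OF this] show False by simp
      qed
    qed
  qed
  ultimately show ?thesis using sum_PQ[OF G] by simp
qed

lemma not_parallel: "\<not> (\<exists>c. \<pp> = c *s \<qq>)" "\<not> (\<exists>c. \<qq> = c *s \<pp>)" "\<not> (\<exists>c. \<oo> = c *s \<pp>)" "\<not> (\<exists>c. \<oo> = c *s \<qq>)"
proof -
  have e: "\<pp> = 1 *s \<pp> + 0 *s \<ww> + 0 *s \<oo>" "\<oo> = 0 *s \<pp> + 0 *s \<ww> + 1 *s \<oo>" "\<qq> = 1 *s \<pp> + 0 *s \<ww> + 1 *s \<oo>"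
    "c *s \<pp> = c *s \<pp> + 0 *s \<ww> + 0 *s \<oo>" "c *s \<qq> = c *s \<pp> + 0 *s \<ww> + c *s \<oo>" for c
    by (simp_all add: \<qq>_def vector_add_ldistrib)
  show "\<not> (\<exists>c. \<pp> = c *s \<qq>)" using e A_injective by (metis zero_neq_one)
  show "\<not> (\<exists>c. \<qq> = c *s \<pp>)" using e A_injective by (metis zero_neq_one)
  show "\<not> (\<exists>c. \<oo> = c *s \<pp>)" using e A_injective by (metis zero_neq_one)
  show "\<not> (\<exists>c. \<oo> = c *s \<qq>)" using e A_injective by (metis zero_neq_one)
qed

text \<open>The whole intersection number N*d*e rests on the roots at P. There are fewer than d of
  them, because some root is centred at Q, so each has order above N.\<close>

lemma only_P:
  assumes G: "homogeneous e G" "\<not> C dvd G" "0 < e"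
    and zeros: "\<And>v. v \<noteq> 0 \<Longrightarrow> eval3 C v = 0 \<Longrightarrow> eval3 G v = 0 \<Longrightarrow> \<exists>c. v = c *s \<pp>"
  shows "m * val kp G = N * (d * e)" "N < val kp G"
proof -
  have "eval3 G \<qq> \<noteq> 0" using zeros[OF pq_nonzero(2)] Cq not_parallel(2) by (auto simp: \<qq>_def)
  then have "val kq G = 0" by (intro card_le_sum_val) (simp add: center_Q[OF kq])
  then show eq: "m * val kp G = N * (d * e)" using sum_PQ_eq[OF G(1,2)] zeros by simp
  show "N < val kp G"
  proof (rule ccontr)
    assume "\<not> N < val kp G"
    then have "m * val kp G \<le> m * N" by simp
    moreover have "N * d \<le> N * (d * e)" using G(3) by simp
    ultimately have "N * d \<le> m * N" using eq by linarith
    then show False using N0 mn by (simp add: mult.commute)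
  qed
qed

lemma only_Q:
  assumes G: "homogeneous e G" "\<not> C dvd G" "0 < e"
    and zeros: "\<And>v. v \<noteq> 0 \<Longrightarrow> eval3 C v = 0 \<Longrightarrow> eval3 G v = 0 \<Longrightarrow> \<exists>c. v = c *s \<qq>"
  shows "n * val kq G = N * (d * e)" "N < val kq G"
proof -
  have "eval3 G \<pp> \<noteq> 0" using zeros[OF pq_nonzero(1)] Cp not_parallel(1) by auto
  then have "val kp G = 0" by (intro card_le_sum_val) (simp add: center_P[OF kp])
  then show eq: "n * val kq G = N * (d * e)" using sum_PQ_eq[OF G(1,2)] zeros by simp
  show "N < val kq G"
  proof (rule ccontr)
    assume "\<not> N < val kq G"
    then have "n * val kq G \<le> n * N" by simp
    moreover have "N * d \<le> N * (d * e)" using G(3) by simp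
    ultimately have "N * d \<le> n * N" using eq by linarith
    then show False using N0 mn by (simp add: mult.commute)
  qed
qed

text \<open>Both forms have order above N on the root, while transversality holds one of the orders
  down to \<open>lord\<close>, which is at most N.\<close>

lemma no_common_branch_P:
  assumes F: "homogeneous e F" "\<not> C dvd F" "0 < e" "eval3 F \<pp> = 0" "\<And>v. v \<noteq> 0 \<Longrightarrow> eval3 C v = 0 \<Longrightarrow> eval3 F v = 0 \<Longrightarrow> \<exists>c. v = c *s \<pp>"
    and G: "homogeneous e' G" "\<not> C dvd G" "0 < e'" "eval3 G \<pp> = 0" "\<And>v. v \<noteq> 0 \<Longrightarrow> eval3 C v = 0 \<Longrightarrow> eval3 G v = 0 \<Longrightarrow> \<exists>c. v = c *s \<pp>"
    and ker: "\<And>s. eval3 (dird s F) \<pp> = 0 \<Longrightarrow> eval3 (dird s G) \<pp> = 0 \<Longrightarrow> \<exists>c. s = c *s \<pp>"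
  shows False
  using val_min_le_lord[of F kp G, unfolded center_P[OF kp], OF F(4) G(4) ker] lord_props(1)[of kp]
    only_P(2)[OF F(1-3,5)] only_P(2)[OF G(1-3,5)] by linarith

end

text \<open>The bound e - 1 equals (a - 1) + (b - 1) + 1, so after subtraction the nonnegative
  quantity on the left is below 1.\<close>

lemma excess_zero:
  assumes "0 < a" "0 < b" "0 < x" "0 < y" "a + b = (e::nat)" "(a - 1) * x + (b - 1) * y < e - 1"
  shows "(a - 1) * (x - 1) + (b - 1) * (y - 1) = 0"
proof -
  obtain a' b' x' y' where "a = Suc a'" "b = Suc b'" "x = Suc x'" "y = Suc y'"
    using assms(1-4) gr0_implies_Suc by metis
  then show ?thesis using assms(5,6) by (auto simp: algebra_simps)
qed

section \<open>One component through both points, the other two through one each\<close>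

locale middle_line = pq_chart +
  fixes F1 F2 F3 :: poly3 and b1 b2 b3 :: nat
  assumes h1: "homogeneous b1 F1" and h2: "homogeneous b2 F2" and h3: "homogeneous b3 F3"
    and nd1: "\<not> C dvd F1" and nd2: "\<not> C dvd F2" and nd3: "\<not> C dvd F3"
    and b0: "0 < b1" "0 < b2" "0 < b3"
    and F1p: "eval3 F1 \<pp> = 0" and F2p: "eval3 F2 \<pp> = 0" and F2q: "eval3 F2 \<qq> = 0" and F3q: "eval3 F3 \<qq> = 0"
    and z1: "\<And>v. v \<noteq> 0 \<Longrightarrow> eval3 C v = 0 \<Longrightarrow> eval3 F1 v = 0 \<Longrightarrow> \<exists>c. v = c *s \<pp>"
    and z2: "\<And>v. v \<noteq> 0 \<Longrightarrow> eval3 C v = 0 \<Longrightarrow> eval3 F2 v = 0 \<Longrightarrow> (\<exists>c. v = c *s \<pp>) \<or> (\<exists>c. v = c *s \<qq>)"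
    and z3: "\<And>v. v \<noteq> 0 \<Longrightarrow> eval3 C v = 0 \<Longrightarrow> eval3 F3 v = 0 \<Longrightarrow> \<exists>c. v = c *s \<qq>"
    and kerP: "\<And>s. eval3 (dird s F1) \<pp> = 0 \<Longrightarrow> eval3 (dird s F2) \<pp> = 0 \<Longrightarrow> \<exists>c. s = c *s \<pp>"
    and kerQ: "\<And>s. eval3 (dird s F3) \<qq> = 0 \<Longrightarrow> eval3 (dird s F2) \<qq> = 0 \<Longrightarrow> \<exists>c. s = c *s \<qq>"
begin

definition "v1 = val kp F1"
definition "v3 = val kq F3"

lemma v1: "m * v1 = N * (d * b1)" "N < v1"
  unfolding v1_def by (rule only_P[OF h1 nd1 b0(1) z1]; assumption)+
lemma v3: "n * v3 = N * (d * b3)" "N < v3"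
  unfolding v3_def by (rule only_Q[OF h3 nd3 b0(3) z3]; assumption)+

lemma val_F2_P: assumes "k \<in> KP" shows "val k F2 \<le> lord k"
proof -
  have "val k F1 \<le> lord k \<or> val k F2 \<le> lord k"
    by (rule val_min_le_lord) (use F1p F2p kerP in \<open>simp_all only: center_P[OF assms]\<close>)
  then show ?thesis using valP[OF assms h1 nd1] v1(2) lord_props(1)[of k] unfolding v1_def by linarith
qed

lemma val_F2_Q: assumes "k \<in> KQ" shows "val k F2 \<le> lord k"
proof -
  have "val k F3 \<le> lord k \<or> val k F2 \<le> lord k"
    by (rule val_min_le_lord) (use F3q F2q kerQ in \<open>simp_all only: center_Q[OF assms]\<close>)
  then show ?thesis using valQ[OF assms h3 nd3] v3(2) lord_props(1)[of k] unfolding v3_def by linarith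
qed

text \<open>Bezout reads m*x + n*y = N*d*b2 for the orders x, y \<le> N of \<open>F2\<close>, and m
  + n \<le> d. All these are then equalities and b2 = 1; the orders reach N, and with them the
  contact \<open>lord\<close>.\<close>

lemma line: "b2 = 1" "m + n = d" "k \<in> KP \<Longrightarrow> N \<le> lord k" "k \<in> KQ \<Longrightarrow> N \<le> lord k"
proof -
  define x y where "x = val kp F2" and "y = val kq F2"
  have xy: "x \<le> N" "y \<le> N" using val_F2_P[OF kp] val_F2_Q[OF kq] lord_props(1)[of kp] lord_props(1)[of kq]
    unfolding x_def y_def by linarith+
  have eq: "m * x + n * y = N * (d * b2)" unfolding x_def y_def by (rule sum_PQ_eq[OF h2 nd2 z2])
  have le: "m * x \<le> m * N" "n * y \<le> n * N" using xy by simp_all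
  have "N * (d * b2) \<le> N * (m + n)" using eq le unfolding distrib_left mult.commute[of N m] mult.commute[of N n] by linarith
  then have c: "d * b2 \<le> m + n" using N0 by simp
  have "d * b2 \<le> d" using c mn(3) by (rule order_trans)
  then have "b2 \<le> 1" using d0 by (cases "b2 \<le> 1") (auto simp: not_le)
  then have b: "b2 = 1" using b0(2) by linarith
  have s: "m + n = d" using c mn(3) unfolding b by linarith
  have eq': "m * x + n * y = m * N + n * N" using eq arg_cong[OF s, of "\<lambda>e. N * e"] unfolding b mult_1_right distrib_left mult.commute[of N m] mult.commute[of N n] by (rule trans[OF _ sym])
  show "b2 = 1" by (rule b)
  show "m + n = d" by (rule s)
  have "m * x = m * N" "n * y = n * N" using le eq' by linarith+
  then have xN: "x = N" "y = N" using mn by simp_all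
  show "N \<le> lord k" if "k \<in> KP" using val_F2_P[OF that] valP[OF that h2 nd2] xN(1) unfolding x_def by linarith
  show "N \<le> lord k" if "k \<in> KQ" using val_F2_Q[OF that] valQ[OF that h2 nd2] xN(2) unfolding y_def by linarith
qed

lemma F2_linear: "homogeneous 1 F2" using h2 line(1) by simp

lemma F2_o: "eval3 F2 \<oo> = 0"
  using eval3_linear(2)[OF F2_linear, of \<pp> \<oo>] F2p F2q by (simp add: \<qq>_def)

text \<open>\<open>\<oo>\<close> is a point of the line \<open>F2\<close>, so it is tangent to that
  line everywhere. Were it tangent to \<open>F1\<close> at P as well, transversality would make it
  proportional to \<open>\<pp>\<close>; likewise for \<open>F3\<close> at Q.\<close>

lemma transversal: "eval3 (dird \<oo> F1) \<pp> \<noteq> 0" "eval3 (dird \<oo> F3) \<qq> \<noteq> 0"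
  using kerP[of \<oo>] kerQ[of \<oo>] not_parallel(3,4) unfolding eval3_linear(1)[OF F2_linear] using F2_o by blast+

lemma X_power_dvd_place: "a \<le> val k G \<Longrightarrow> fps_X ^ a dvd place k G"
  unfolding fps_X_power_dvd_iff val_def by simp

text \<open>Any two roots that have contact \<open>w\<close> with the same curve, smooth and
  transversal to the projection, agree to order \<open>w\<close>. Each of the card K - 1 other roots
  therefore contributes X^w to the product of differences.\<close>

lemma polar_dvd:
  assumes K: "K \<subseteq> {..<d}" "k \<in> K" and c: "\<And>l. l \<in> K \<Longrightarrow> center l = v \<and> val l F = w \<and> fps_nth (\<eta> l) 0 = y"
    and F: "eval3 (dird \<oo> F) v \<noteq> 0"
  shows "fps_X ^ ((card K - 1) * w) dvd place k (dird \<oo> C)"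
proof -
  have fin: "finite K" using K(1) finite_subset by blast
  have "fps_X ^ w dvd \<eta> k - \<eta> l" if "l \<in> K" for l
    by (rule root_difference[of k l F]) (use c K(2) that F X_power_dvd_place in auto)
  then have "(\<Prod>l\<in>K - {k}. fps_X ^ w) dvd (\<Prod>l\<in>K - {k}. \<eta> k - \<eta> l)" by (intro prod_dvd_prod) auto
  also have "\<dots> dvd (\<Prod>l\<in>{..<d} - {k}. \<eta> k - \<eta> l)" using K(1) by (intro prod_dvd_prod_subset) auto
  also have "\<dots> dvd place k (dird \<oo> C)" using K by (subst place_dird_o) auto
  finally show ?thesis using fin K(2) by (simp add: power_mult mult.commute)
qed

lemma polar_P: assumes "k \<in> KP" shows "fps_X ^ ((m - 1) * v1) dvd place k (dird \<oo> C)"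
  unfolding m_def
  by (rule polar_dvd[OF _ assms, of \<pp> F1 v1 0])
    (use center_P valP[OF _ h1 nd1] transversal(1) in \<open>auto simp: v1_def KP_def\<close>)

lemma polar_Q: assumes "k \<in> KQ" shows "fps_X ^ ((n - 1) * v3) dvd place k (dird \<oo> C)"
  unfolding n_def
  by (rule polar_dvd[OF _ assms, of \<qq> F3 v3 1])
    (use center_Q valQ[OF _ h3 nd3] transversal(2) in \<open>auto simp: v3_def KQ_def\<close>)

lemma dvd_cancel_N: assumes "a dvd of_nat N * (x :: complex fps)" shows "a dvd x"
proof -
  have "x = fps_const (1 / of_nat N) * (of_nat N * x)"
    using N0 by (simp add: fps_of_nat[symmetric] mult.assoc[symmetric])
  then show ?thesis using assms by (metis dvd_mult)
qed

lemma eta_P: assumes "k \<in> KP" shows "fps_X ^ N dvd \<eta> k"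
proof -
  have "fps_X ^ N dvd (fps_X ^ lord k :: complex fps)" using line(3)[OF assms] by (rule le_imp_power_dvd)
  also have "\<dots> dvd \<eta> k" using lord_props(3)[of k] assms by (simp add: KP_def)
  finally show ?thesis .
qed

lemma place_dird_p:
  assumes "k \<in> KP"
  shows "of_nat N * place k (dird \<pp> C) = place k (dird \<oo> C) * (fps_X * fps_deriv (\<eta> k) - of_nat N * \<eta> k)"
  using place_dird_center[OF KP_less[OF assms]] assms unfolding center_P[OF assms] by (simp add: KP_def)

lemma place_dird_p_Q:
  assumes "k \<in> KQ"
  shows "of_nat N * place k (dird \<pp> C) = place k (dird \<oo> C) * (fps_X * fps_deriv (\<eta> k) - of_nat N * \<eta> k)"
proof -
  interpret p: comm_ring_hom "place k" by (rule place_hom)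
  have "place k (dird \<qq> C) = place k (dird \<pp> C) + place k (dird \<oo> C)" by (simp add: \<qq>_def dird_add p.hom_add)
  then show ?thesis
    using place_dird_center[OF KQ_less[OF assms]] assms unfolding center_Q[OF assms] by (simp add: KQ_def algebra_simps)
qed

lemma h_polar: "homogeneous (d - 1) (dird a C)" by (rule homogeneous_dird[OF hom])

lemma nd_polar: assumes "dird a C \<noteq> 0" shows "\<not> C dvd dird a C"
  using dvd_degree[OF _ h_polar assms] d2 by auto

lemma polar_p_nonzero: "dird \<pp> C \<noteq> 0"
proof
  assume z: "dird \<pp> C = 0"
  interpret p: comm_ring_hom "place kq" by (rule place_hom)
  have "of_nat d * eval3 C \<oo> \<noteq> 0" using vertex d0 by (simp add: \<oo>_def)
  then have "dird \<oo> C \<noteq> 0" using eval3_dird_self[OF hom, of \<oo>] by (auto simp: eval3_def)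
  then have "place kq (dird \<oo> C) \<noteq> 0" using place_nonzero[OF h_polar nd_polar KQ_less[OF kq]] by blast
  moreover have "fps_X * fps_deriv (\<eta> kq) - of_nat N * \<eta> kq \<noteq> 0"
  proof
    assume "fps_X * fps_deriv (\<eta> kq) - of_nat N * \<eta> kq = 0"
    then have "fps_nth (fps_X * fps_deriv (\<eta> kq) - of_nat N * \<eta> kq) 0 = 0" by simp
    then show False using kq N0 by (simp add: KQ_def fps_of_nat[symmetric])
  qed
  ultimately show False using place_dird_p_Q[OF kq] z by simp
qed

text \<open>The polar at P has order at least (m - 1)*v1 + N on the roots at P and (n - 1)*v3 on
  those at Q. With m*v1 = N*d*b1, n*v3 = N*d*b3 and the Bezout bound N*d*(d - 1), this becomes (m -
  1)*b1 + (n - 1)*b3 < d - 1.\<close>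

lemma inequality: "(m - 1) * (b1 - 1) + (n - 1) * (b3 - 1) = 0"
proof -
  note nd = nd_polar[OF polar_p_nonzero]
  \<comment> \<open>At P the second factor of the polar has order at least N because the root has;
    at Q its constant term is -N and nothing is gained.\<close>
  have "fps_X ^ N dvd fps_X * fps_deriv (\<eta> kp) - of_nat N * \<eta> kp"
    by (intro dvd_diff X_deriv_dvd dvd_mult eta_P kp)
  then have "fps_X ^ ((m - 1) * v1) * fps_X ^ N dvd of_nat N * place kp (dird \<pp> C)"
    unfolding place_dird_p[OF kp] by (intro mult_dvd_mono polar_P kp)
  then have "fps_X ^ ((m - 1) * v1 + N) dvd place kp (dird \<pp> C)" unfolding power_add by (rule dvd_cancel_N)
  then have P: "(m - 1) * v1 + N \<le> val kp (dird \<pp> C)"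
    unfolding fps_X_power_dvd_iff val_def using place_nonzero[OF h_polar nd KP_less[OF kp]] by simp
  have "fps_X ^ ((n - 1) * v3) dvd of_nat N * place kq (dird \<pp> C)"
    unfolding place_dird_p_Q[OF kq] by (intro dvd_mult2 polar_Q kq)
  then have "fps_X ^ ((n - 1) * v3) dvd place kq (dird \<pp> C)" by (rule dvd_cancel_N)
  then have Q: "(n - 1) * v3 \<le> val kq (dird \<pp> C)"
    unfolding fps_X_power_dvd_iff val_def using place_nonzero[OF h_polar nd KQ_less[OF kq]] by simp
  have "m * ((m - 1) * v1 + N) + n * ((n - 1) * v3) \<le> N * (d * (d - 1))"
    using sum_PQ_le[OF h_polar nd] mult_le_mono2[OF P, of m] mult_le_mono2[OF Q, of n] by linarith
  also have "m * ((m - 1) * v1 + N) + n * ((n - 1) * v3) = (m - 1) * (m * v1) + m * N + (n - 1) * (n * v3)"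
    by (simp add: algebra_simps)
  also have "\<dots> = (m - 1) * (N * (d * b1)) + m * N + (n - 1) * (N * (d * b3))" by (simp only: v1(1) v3(1))
  also have "\<dots> = N * (d * ((m - 1) * b1 + (n - 1) * b3) + m)" by (simp add: algebra_simps)
  finally have "d * ((m - 1) * b1 + (n - 1) * b3) + m \<le> d * (d - 1)" using N0 by simp
  \<comment> \<open>The surplus m stems from the extra N at P and makes the inequality strict, as
    \<open>excess_zero\<close> requires.\<close>
  then have "d * ((m - 1) * b1 + (n - 1) * b3) < d * (d - 1)" using mn(1) by linarith
  then have "(m - 1) * b1 + (n - 1) * b3 < d - 1" by simp
  with mn(1,2) b0(1,3) line(2) show ?thesis by (rule excess_zero)
qed

text \<open>Both forms of degree d - 1 have order at least N*d on the m = d - 1 roots at P, which is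
  all that Bezout allows. A combination with larger order is divisible by \<open>C\<close> and hence
  zero.\<close>

lemma polar_power:
  assumes b1: "b1 = 1" and n1: "n = 1"
  obtains c where "c \<noteq> 0" "dird \<pp> C = K3 c * F1 ^ (d - 1)"
proof -
  have hF: "homogeneous 1 F1" using h1 b1 by simp
  have md: "m = d - 1" using line(2) n1 by simp
  have mv: "m * v1 = N * d" using v1(1) b1 by simp
  interpret p: comm_ring_hom "place kp" by (rule place_hom)
  define f where "f = place kp F1"
  define \<alpha> where "\<alpha> = eval3 F1 \<oo>"
  have f: "f = fps_const (eval3 F1 \<ww>) * fps_X ^ N + fps_const \<alpha> * \<eta> kp"
  proof -
    have c: "place kp (partial_deriv i F1) = fps_const (eval3 (partial_deriv i F1) 0)" for i
    proof -
      have hp: "homogeneous 0 (partial_deriv i F1)" using partial_deriv_homogeneous[OF hF, of i] by simp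
      have "place kp (partial_deriv i F1) = ev3 fps_const (0 * 0) (0 * 0) (0 * 0) (partial_deriv i F1)"
        unfolding place_expand using ev3_scale[OF comm_ring_hom_fps_const hp, of 0, symmetric] unfolding power_0 mult_1 mult_zero_left by blast
      also have "\<dots> = fps_const (eval3 (partial_deriv i F1) 0)"
        unfolding eval3_ev3 hom_ev3[OF comm_ring_hom_id comm_ring_hom_fps_const] by simp
      finally show ?thesis .
    qed
    have d: "place kp (dird a F1) = fps_const (eval3 F1 a)" for a
      unfolding place_dird c eval3_linear(1)[OF hF, of a 0, symmetric] eval3_dird sum_3 by simp
    show ?thesis using place_euler[OF hF, of kp] unfolding d F1p f_def \<alpha>_def by (simp add: mult.commute)
  qed
  have \<alpha>0: "\<alpha> \<noteq> 0" using transversal(1) unfolding eval3_linear(1)[OF hF] \<alpha>_def .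
  have f0: "f \<noteq> 0" unfolding f_def by (rule place_nonzero[OF h1 nd1 KP_less[OF kp]])
  have sf: "subdegree f = v1" by (simp add: f_def v1_def val_def)
  define D where "D = N * d"
  define G1 G2 where "G1 = dird \<pp> C" and "G2 = F1 ^ (d - 1)"
  have h: "homogeneous (d - 1) G1" "homogeneous (d - 1) G2"
    unfolding G1_def G2_def using h_polar homogeneous_power[OF hF, of "d - 1"] by simp_all
  have pG2: "place kp G2 = f ^ (d - 1)" by (simp add: G2_def p.hom_power f_def)
  have sG2: "subdegree (place kp G2) = D" unfolding pG2 D_def using sf mv md by (simp add: subdegree_power mult.commute)
  \<comment> \<open>The operator X d/dX - N kills X^N, so it acts on \<alpha>*\<eta> as on the
    restriction \<open>f\<close> of \<open>F1\<close>, whose order v1 exceeds N.\<close>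
  have "fps_const \<alpha> * (fps_X * fps_deriv (\<eta> kp) - of_nat N * \<eta> kp) = fps_X * fps_deriv f - of_nat N * f"
  proof -
    have "fps_X * fps_deriv f = fps_const (eval3 F1 \<ww>) * (fps_X * fps_deriv (fps_X ^ N)) + fps_const \<alpha> * (fps_X * fps_deriv (\<eta> kp))"
      unfolding f by (simp add: algebra_simps)
    then have e: "fps_X * fps_deriv f = fps_const (eval3 F1 \<ww>) * (of_nat N * fps_X ^ N) + fps_const \<alpha> * (fps_X * fps_deriv (\<eta> kp))"
      unfolding X_deriv_power .
    show ?thesis unfolding e unfolding f by (simp add: algebra_simps)
  qed
  moreover have "fps_X ^ v1 dvd f" unfolding fps_X_power_dvd_iff using sf by simp
  ultimately have "fps_X ^ v1 dvd fps_const \<alpha> * (fps_X * fps_deriv (\<eta> kp) - of_nat N * \<eta> kp)"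
    by (simp add: dvd_diff X_deriv_dvd)
  then have "fps_X ^ v1 dvd fps_const (1 / \<alpha>) * (fps_const \<alpha> * (fps_X * fps_deriv (\<eta> kp) - of_nat N * \<eta> kp))" by (rule dvd_mult)
  then have "fps_X ^ v1 dvd fps_X * fps_deriv (\<eta> kp) - of_nat N * \<eta> kp"
    using \<alpha>0 by (simp add: mult.assoc[symmetric])
  then have "fps_X ^ ((m - 1) * v1) * fps_X ^ v1 dvd of_nat N * place kp G1"
    unfolding G1_def place_dird_p[OF kp] by (intro mult_dvd_mono polar_P kp)
  then have "fps_X ^ ((m - 1) * v1 + v1) dvd place kp G1" unfolding power_add by (rule dvd_cancel_N)
  moreover have "(m - 1) * v1 + v1 = D" using mv mn(1) by (cases m) (simp_all add: D_def)
  ultimately have dG1: "fps_X ^ D dvd place kp G1" by simp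
  \<comment> \<open>The ratio of the coefficients at X^D, so that the difference of the two forms
    has order at least D + 1.\<close>
  define c where "c = fps_nth (place kp G1) D / fps_nth (place kp G2) D"
  have "place kp G2 \<noteq> 0" unfolding pG2 using f0 by simp
  then have nz: "fps_nth (place kp G2) D \<noteq> 0" using nth_subdegree_nonzero sG2 by metis
  define G where "G = G1 - K3 c * G2"
  have hG: "homogeneous (d - 1) G" unfolding G_def by (intro homogeneous_diff homogeneous_K3_mult h)
  have pG: "place kp G = place kp G1 - fps_const c * place kp G2"
  proof -
    have "place kp (K3 c) = fps_const c" unfolding place_expand by (simp add: ev_simps[OF comm_ring_hom_fps_const])
    then show ?thesis by (simp add: G_def p.hom_minus p.hom_mult)
  qed
  have low: "fps_nth (place kp G) i = 0" if "i \<le> D" for i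
  proof (cases "i = D")
    case True then show ?thesis using nz by (simp add: pG c_def)
  next
    case False
    then have i: "i < D" using that by simp
    have "fps_nth (place kp G1) i = 0" using dG1 i unfolding fps_X_power_dvd_iff by (auto intro: nth_less_subdegree_zero)
    moreover have "fps_nth (place kp G2) i = 0" using i sG2 by (auto intro: nth_less_subdegree_zero)
    ultimately show ?thesis by (simp add: pG)
  qed
  have "C dvd G"
  proof (rule ccontr)
    assume nd: "\<not> C dvd G"
    have "place kp G \<noteq> 0" by (rule place_nonzero[OF hG nd KP_less[OF kp]])
    then have "Suc D \<le> val kp G" unfolding val_def using low by (intro subdegree_geI) auto
    then have "m * Suc D \<le> m * val kp G" by (rule mult_le_mono2)
    also have "\<dots> \<le> N * (d * (d - 1))" using sum_PQ_le[OF hG nd] by linarith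
    also have "\<dots> = m * D" by (simp add: D_def md)
    finally show False using mn(1) by simp
  qed
  then have "G = 0" using dvd_degree[OF _ hG] d2 by (cases "G = 0") auto
  then have eq: "dird \<pp> C = K3 c * F1 ^ (d - 1)" by (simp add: G_def G1_def G2_def)
  moreover have "c \<noteq> 0" using eq polar_p_nonzero by (auto simp: K3_def)
  ultimately show ?thesis by (rule that[rotated])
qed

end

subsection \<open>Parametrized curves\<close>

lemma coeff_mult_top:
  assumes "degree p \<le> a" "degree q \<le> b"
  shows "coeff (p * q) (a + b) = coeff p a * coeff (q :: 'a::comm_ring_1 poly) b"
proof -
  have "coeff (p * q) (a + b) = (\<Sum>i\<le>a+b. coeff p i * coeff q (a + b - i))" by (rule coeff_mult)
  also have "\<dots> = (\<Sum>i\<in>{a}. coeff p i * coeff q (a + b - i))"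
  proof (rule sum.mono_neutral_right)
    show "\<forall>i\<in>{..a + b} - {a}. coeff p i * coeff q (a + b - i) = 0"
    proof
      fix i assume i: "i \<in> {..a + b} - {a}"
      then have "degree p < i \<or> degree q < a + b - i" using assms by auto
      then show "coeff p i * coeff q (a + b - i) = 0" by (auto simp: coeff_eq_0)
    qed
  qed auto
  finally show ?thesis by simp
qed

lemma degree_mult_le': "degree p \<le> a \<Longrightarrow> degree q \<le> b \<Longrightarrow> degree (p * q :: 'a::comm_ring_1 poly) \<le> a + b"
  using degree_mult_le[of p q] by linarith

lemma power_top:
  assumes "degree (p :: 'a::comm_ring_1 poly) \<le> a"
  shows "degree (p ^ n) \<le> n * a" "coeff (p ^ n) (n * a) = coeff p a ^ n"
proof (induction n)
  case (Suc n)
  show "degree (p ^ Suc n) \<le> Suc n * a" unfolding power_Suc mult_Suc by (rule degree_mult_le'[OF assms Suc(1)])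
  show "coeff (p ^ Suc n) (Suc n * a) = coeff p a ^ Suc n"
    unfolding power_Suc mult_Suc coeff_mult_top[OF assms Suc(1)] Suc(2) ..
qed simp_all

lemma comm_ring_hom_poly_const: "comm_ring_hom (\<lambda>c::complex. [:c:])"
  using comm_ring_hom_const_poly[OF comm_ring_hom_id] .

lemma poly_ev3: "poly (ev3 (\<lambda>c. [:c:]) x y z F) t = ev3 (\<lambda>c. c) (poly x t) (poly y t) (poly z t) F"
proof -
  have "comm_ring_hom (\<lambda>q::complex poly. poly q t)" by unfold_locales simp_all
  from hom_ev3[OF comm_ring_hom_poly_const this] show ?thesis by simp
qed

lemma ev3_top:
  assumes F: "homogeneous e F" and D: "degree x \<le> D" "degree y \<le> D" "degree z \<le> D"
  shows "degree (ev3 (\<lambda>c. [:c:]) x y z F) \<le> e * D"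
    and "coeff (ev3 (\<lambda>c. [:c:]) x y z F) (e * D) = ev3 (\<lambda>c. c) (coeff x D) (coeff y D) (coeff z D) F"
proof -
  have t: "degree ([:c:] * x ^ i * y ^ j * z ^ k) \<le> e * D \<and>
      coeff ([:c:] * x ^ i * y ^ j * z ^ k) (e * D) = c * coeff x D ^ i * coeff y D ^ j * coeff z D ^ k"
    if "i + j + k = e" for i j k c
  proof -
    have e: "e * D = (0 + i * D + j * D) + k * D" unfolding that[symmetric] by (simp add: distrib_right)
    have 1: "degree [:c:] \<le> 0" by simp
    have 2: "degree ([:c:] * x ^ i) \<le> 0 + i * D" by (rule degree_mult_le'[OF 1 power_top(1)[OF D(1)]])
    have 3: "degree ([:c:] * x ^ i * y ^ j) \<le> 0 + i * D + j * D" by (rule degree_mult_le'[OF 2 power_top(1)[OF D(2)]])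
    have 4: "degree ([:c:] * x ^ i * y ^ j * z ^ k) \<le> 0 + i * D + j * D + k * D" by (rule degree_mult_le'[OF 3 power_top(1)[OF D(3)]])
    show ?thesis unfolding e using 4
      unfolding coeff_mult_top[OF 3 power_top(1)[OF D(3)]] coeff_mult_top[OF 2 power_top(1)[OF D(2)]]
        coeff_mult_top[OF 1 power_top(1)[OF D(1)]] power_top(2)[OF D(1)] power_top(2)[OF D(2)] power_top(2)[OF D(3)]
      by simp
  qed
  have s: "i + j + k = e" if "(i,j,k) \<in> exponents F" for i j k using F that unfolding homogeneous_def by auto
  show "degree (ev3 (\<lambda>c. [:c:]) x y z F) \<le> e * D"
    unfolding ev3_expand[OF comm_ring_hom_poly_const]
  proof (rule degree_sum_le[OF finite_exponents], clarify)
    fix i j k assume "(i,j,k) \<in> exponents F"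
    from t[OF s[OF this]] show "degree ([:coeff3 F (i,j,k):] * x ^ i * y ^ j * z ^ k) \<le> e * D" by blast
  qed
  show "coeff (ev3 (\<lambda>c. [:c:]) x y z F) (e * D) = ev3 (\<lambda>c. c) (coeff x D) (coeff y D) (coeff z D) F"
    unfolding ev3_expand[OF comm_ring_hom_poly_const] ev3_expand[OF comm_ring_hom_id] coeff_sum
  proof (rule sum.cong[OF refl], clarify)
    fix i j k assume "(i,j,k) \<in> exponents F"
    from t[OF s[OF this]] show "coeff ([:coeff3 F (i,j,k):] * x ^ i * y ^ j * z ^ k) (e * D)
      = coeff3 F (i,j,k) * coeff x D ^ i * coeff y D ^ j * coeff z D ^ k" by blast
  qed
qed

text \<open>\<open>close_poly d e u v\<close> holds for the values of a form of degree \<open>e\<close> on two triples of polynomials of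
  degree at most \<open>d\<close> that differ by polynomials of degree at most one.\<close>

definition close_poly :: "nat \<Rightarrow> nat \<Rightarrow> complex poly \<Rightarrow> complex poly \<Rightarrow> bool" where
  "close_poly d e u v \<longleftrightarrow> degree u \<le> e * d \<and> degree v \<le> e * d \<and> (u = v \<or> degree (u - v) + d \<le> e * d + 1)"

lemma zero_or_degree_add:
  "A = 0 \<or> degree A + d \<le> k \<Longrightarrow> B = 0 \<or> degree B + d \<le> k \<Longrightarrow> A + B = 0 \<or> degree (A + B) + d \<le> k"
  using degree_add_le_max[of A B] by (cases "A = 0"; cases "B = 0") (auto simp: max_def split: if_splits)

lemma close_poly_const: "close_poly d 0 [:c:] [:c:]" by (simp add: close_poly_def)

text \<open>Write u*u' - v*v' as (u - v)*u' + v*(u' - v'): each summand has one close difference and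
  one factor of full degree.\<close>

lemma close_poly_mult:
  assumes "close_poly d e u v" "close_poly d e' u' v'" shows "close_poly d (e + e') (u * u') (v * v')"
proof -
  have D: "degree u \<le> e * d" "degree v \<le> e * d" "degree u' \<le> e' * d" "degree v' \<le> e' * d"
    using assms by (auto simp: close_poly_def)
  have eq: "u * u' - v * v' = (u - v) * u' + v * (u' - v')" by (simp add: algebra_simps)
  have a: "(u - v) * u' = 0 \<or> degree ((u - v) * u') + d \<le> (e + e') * d + 1"
    using assms(1) D(3) degree_mult_le[of "u - v" u'] unfolding close_poly_def distrib_right by auto
  have b: "v * (u' - v') = 0 \<or> degree (v * (u' - v')) + d \<le> (e + e') * d + 1"
    using assms(2) D(2) degree_mult_le[of v "u' - v'"] unfolding close_poly_def distrib_right by auto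
  have "u * u' - v * v' = 0 \<or> degree (u * u' - v * v') + d \<le> (e + e') * d + 1"
    unfolding eq using a b by (rule zero_or_degree_add)
  then show ?thesis
    unfolding close_poly_def distrib_right using degree_mult_le'[OF D(1,3)] degree_mult_le'[OF D(2,4)] by auto
qed

lemma close_poly_power: "close_poly d 1 u v \<Longrightarrow> close_poly d n (u ^ n) (v ^ n)"
proof (induction n)
  case 0 show ?case using close_poly_const[of d 1] by (simp add: one_pCons)
next
  case (Suc n)
  show ?case using close_poly_mult[OF Suc(2) Suc(1)[OF Suc(2)]] by simp
qed

lemma close_poly_sum:
  assumes "finite S" "\<And>s. s \<in> S \<Longrightarrow> close_poly d e (f s) (g s)" shows "close_poly d e (sum f S) (sum g S)"
  using assms
proof (induction S rule: finite_induct)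
  case empty show ?case by (simp add: close_poly_def)
next
  case (insert s S)
  have a: "close_poly d e (f s) (g s)" "close_poly d e (sum f S) (sum g S)" using insert by auto
  have eq: "f s + sum f S - (g s + sum g S) = (f s - g s) + (sum f S - sum g S)" by simp
  have "f s + sum f S - (g s + sum g S) = 0 \<or> degree (f s + sum f S - (g s + sum g S)) + d \<le> e * d + 1"
    unfolding eq by (rule zero_or_degree_add) (use a in \<open>auto simp: close_poly_def\<close>)
  then have "f s + sum f S = g s + sum g S \<or> degree (f s + sum f S - (g s + sum g S)) + d \<le> e * d + 1"
    unfolding right_minus_eq .
  then show ?case using insert(1,2) a by (auto simp: close_poly_def intro: degree_add_le)
qed

lemma close_poly_ev3:
  assumes F: "homogeneous e F" and c: "close_poly d 1 x x'" "close_poly d 1 y y'" "close_poly d 1 z z'"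
  shows "close_poly d e (ev3 (\<lambda>c. [:c:]) x y z F) (ev3 (\<lambda>c. [:c:]) x' y' z' F)"
  unfolding ev3_expand[OF comm_ring_hom_poly_const]
proof (rule close_poly_sum[OF finite_exponents], clarify)
  fix i j k assume "(i,j,k) \<in> exponents F"
  then have e: "e = 0 + i + j + k" using F unfolding homogeneous_def by auto
  show "close_poly d e ([:coeff3 F (i,j,k):] * x ^ i * y ^ j * z ^ k) ([:coeff3 F (i,j,k):] * x' ^ i * y' ^ j * z' ^ k)"
    unfolding e by (intro close_poly_mult close_poly_const close_poly_power c)
qed

lemma poly_single_root:
  assumes "\<And>t. poly G t = 0 \<Longrightarrow> t = 0" shows "G = monom (lead_coeff G :: complex) (degree G)"
proof -
  have G0: "G \<noteq> 0" using assms[of 1] by auto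
  obtain H where H: "G = [:- 0, 1:] ^ Polynomial.order 0 G * H" "\<not> [:- 0, 1:] dvd H" using order_decomp[OF G0] by blast
  have "poly H t \<noteq> 0" for t
  proof
    assume z: "poly H t = 0"
    then have "poly G t = 0" using arg_cong[OF H(1), of "\<lambda>g. poly g t"] by simp
    then show False using assms H(2) z by (auto simp: dvd_iff_poly_eq_0)
  qed
  then have "constant (poly H)" using fundamental_theorem_of_algebra[of H] by blast
  then have "degree H = 0" by (simp add: constant_degree)
  then obtain h where h: "H = [:h:]" by (rule degree_eq_zeroE)
  have G: "G = monom h (Polynomial.order 0 G)" using H(1) h by (simp add: monom_altdef)
  have "h \<noteq> 0" using G0 H(1) h by auto
  then have "degree G = Polynomial.order 0 G" "lead_coeff G = h" using arg_cong[OF G, of degree] arg_cong[OF G, of "\<lambda>g. coeff g (Polynomial.order 0 G)"]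
    by (simp_all add: degree_monom_eq)
  then show ?thesis using G by simp
qed

text \<open>\<open>F\<close> restricted to the graph t -> q + W(t)*p + t*r has full degree b*d
  because F(p) \<noteq> 0, and its only possible zero is t = 0, so it is a monomial. This leaves two
  free constants in \<open>W\<close>, and then contradicts transversality at q.\<close>

lemma no_high_contact:
  assumes F: "homogeneous b F" and b: "2 \<le> b" "b < d" and W: "degree W = d" "coeff W 0 = 0"
    and Fp: "eval3 F p \<noteq> 0" and zero: "\<And>t. eval3 F (q + poly W t *s p + t *s r) = 0 \<Longrightarrow> t = 0"
    and tangent: "eval3 (dird p F) q \<noteq> 0"
  shows False
proof -
  define x where "x i = [:q $ i, r $ i:] + smult (p $ i) W" for i
  define G where "G = ev3 (\<lambda>c. [:c:]) (x 1) (x 2) (x 3) F"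
  define \<alpha> where "\<alpha> = coeff W d"
  have d0: "d \<noteq> 0" using b by simp
  have \<alpha>: "\<alpha> \<noteq> 0" using W(1) d0 unfolding \<alpha>_def by (metis degree_0 leading_coeff_0_iff)
  have lin: "degree [:s, t:] \<le> 1" for s t :: complex by simp
  have cx: "coeff (x i) d = p $ i * \<alpha>" for i
    using b by (simp add: x_def \<alpha>_def coeff_eq_0[of "[:q $ i, r $ i:]" d])
  have dx: "degree (x i) \<le> d" for i unfolding x_def
    by (rule degree_add_le) (use b W(1) degree_smult_le[of "p $ i" W] in auto)
  have dW: "degree (smult (p $ i) W) \<le> d" for i using W(1) degree_smult_le[of "p $ i" W] by simp
  define \<beta> where "\<beta> = eval3 F p"
  have pv: "ev3 (\<lambda>c. c) (p $ 1 * s) (p $ 2 * s) (p $ 3 * s) F = s ^ b * \<beta>" for s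
    using eval3_scale[OF F, of s p] unfolding eval3_ev3 \<beta>_def by (simp add: mult.commute)
  have G: "degree G \<le> b * d" "coeff G (b * d) = \<alpha> ^ b * \<beta>"
    unfolding G_def using ev3_top[OF F dx[of 1] dx[of 2] dx[of 3]] unfolding cx pv by auto
  have "G = monom (lead_coeff G) (degree G)"
  proof (rule poly_single_root)
    fix t assume "poly G t = 0"
    then have "eval3 F (q + poly W t *s p + t *s r) = 0"
      unfolding G_def poly_ev3 eval3_ev3 by (simp add: x_def algebra_simps)
    then show "t = 0" by (rule zero)
  qed
  moreover have "degree G = b * d" using G le_degree[of G "b * d"] \<alpha> Fp by (simp add: \<beta>_def)
  ultimately have Gm: "G = monom (\<alpha> ^ b * \<beta>) (b * d)" using G(2) by simp
  \<comment> \<open>Dropping the linear part q + t*r changes each coordinate by degree at most 1,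
    hence the value of \<open>F\<close> by degree at most (b - 1)*d + 1.\<close>
  have "close_poly d b G (ev3 (\<lambda>c. [:c:]) (smult (p $ 1) W) (smult (p $ 2) W) (smult (p $ 3) W) F)"
    unfolding G_def
    by (rule close_poly_ev3[OF F]) (use dx dW in \<open>auto simp: close_poly_def x_def\<close>)
  moreover have "ev3 (\<lambda>c. [:c:]) (smult (p $ 1) W) (smult (p $ 2) W) (smult (p $ 3) W) F = smult \<beta> (W ^ b)"
  proof (rule poly_ext)
    fix t show "poly (ev3 (\<lambda>c. [:c:]) (smult (p $ 1) W) (smult (p $ 2) W) (smult (p $ 3) W) F) t = poly (smult \<beta> (W ^ b)) t"
      unfolding poly_ev3 poly_smult pv by simp
  qed
  ultimately have cl: "close_poly d b G (smult \<beta> (W ^ b))" by simp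
  \<comment> \<open>Now the monomial is \<beta>*T^b, and T^b - W^b = (T - W)*S. All b summands of S
    have the same coefficient \<alpha>^(b - 1) at degree (b - 1)*d, so S has at least this degree
    and T - W is at most linear.\<close>
  define T where "T = monom \<alpha> d"
  define V where "V = T - W"
  obtain n where n: "b = Suc n" using b by (cases b) auto
  define S where "S = (\<Sum>i<Suc n. T ^ i * W ^ (n - i))"
  have dT: "degree T \<le> d" "degree W \<le> d" using W(1) by (simp_all add: T_def degree_monom_le)
  have "coeff (T ^ i * W ^ (n - i)) (n * d) = \<alpha> ^ n" if "i < Suc n" for i
  proof -
    have e: "n * d = i * d + (n - i) * d" using that by (simp add: distrib_right[symmetric])
    show ?thesis unfolding e coeff_mult_top[OF power_top(1)[OF dT(1)] power_top(1)[OF dT(2)]] power_top(2)[OF dT(1)] power_top(2)[OF dT(2)]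
      using that by (simp add: T_def \<alpha>_def power_add[symmetric])
  qed
  then have "coeff S (n * d) = of_nat b * \<alpha> ^ n" by (simp add: S_def coeff_sum n del: sum.lessThan_Suc)
  then have "coeff S (n * d) \<noteq> 0" using \<alpha> b by simp
  then have S: "n * d \<le> degree S" "S \<noteq> 0" by (auto intro: le_degree)
  have GV: "G - smult \<beta> (W ^ b) = smult \<beta> (V * S)"
  proof -
    have "G = smult \<beta> (T ^ b)" unfolding Gm T_def by (simp add: monom_power smult_monom mult.commute)
    moreover have "T ^ b - W ^ b = V * S" unfolding n V_def S_def by (rule diff_power_eq_sum)
    ultimately show ?thesis by (metis smult_diff_right)
  qed
  have V1: "degree V \<le> 1"
  proof (cases "V = 0")
    case False
    have "degree (smult \<beta> (V * S)) = degree V + degree S"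
      using False S(2) Fp by (simp add: \<beta>_def degree_mult_eq)
    moreover have "smult \<beta> (V * S) \<noteq> 0" using False S(2) Fp by (simp add: \<beta>_def)
    then have "G \<noteq> smult \<beta> (W ^ b)" using GV by auto
    then have "degree (smult \<beta> (V * S)) + d \<le> b * d + 1" using cl unfolding close_poly_def GV by blast
    ultimately show ?thesis using S(1) unfolding n mult_Suc by linarith
  qed simp
  define s where "s = - coeff V 1"
  have V: "V = [:0, - s:]"
  proof (rule poly_eqI)
    fix i show "coeff V i = coeff [:0, - s:] i"
    proof (cases i)
      case 0 then show ?thesis using W(2) d0 by (simp add: V_def T_def)
    next
      case (Suc j)
      then show ?thesis using V1 by (cases j) (simp_all add: s_def coeff_eq_0)
    qed
  qed
  have Wm: "W = T + [:0, s:]"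
  proof -
    have "W = T - V" by (simp add: V_def)
    then show ?thesis unfolding V by simp
  qed
  \<comment> \<open>With W = \<alpha>*t^d + s*t the curve is the line \<open>y\<close> displaced by
    \<alpha>*t^d*p. Modulo t^(2*d) the coefficient of t^d isolates the derivative along p: F(y) has
    degree at most b < d, and the monomial has degree b*d > d.\<close>
  define y where "y i = [:q $ i, r $ i + s * p $ i:]" for i
  have xy: "x i = y i + [:p $ i:] * T" for i by (simp add: x_def y_def Wm smult_add_right)
  define u where "u = monom (1::complex) d"
  define J where "J j = ev3 (\<lambda>c. [:c:]) (y 1) (y 2) (y 3) (partial_deriv j F)" for j
  define E where "E = ev3 (\<lambda>c. [:c:]) (y 1) (y 2) (y 3) F"
  have Tu: "T = [:\<alpha>:] * u" by (simp add: T_def u_def smult_monom)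
  have "u\<^sup>2 dvd G - E - ([:p $ 1:] * T * J 1 + [:p $ 2:] * T * J 2 + [:p $ 3:] * T * J 3)"
    unfolding G_def E_def J_def xy by (rule taylor_ev3[OF comm_ring_hom_poly_const]) (simp_all add: Tu dvd_smult)
  then obtain R where R: "G - E - ([:p $ 1:] * T * J 1 + [:p $ 2:] * T * J 2 + [:p $ 3:] * T * J 3) = u\<^sup>2 * R" by (rule dvdE)
  define Y where "Y = smult (p $ 1) (J 1) + smult (p $ 2) (J 2) + smult (p $ 3) (J 3)"
  have "[:p $ 1:] * T * J 1 + [:p $ 2:] * T * J 2 + [:p $ 3:] * T * J 3 = u * smult \<alpha> Y"
    unfolding Tu Y_def by (simp add: algebra_simps smult_add_right)
  then have GE: "G = E + u * smult \<alpha> Y + u * (u * R)" using R by (simp add: power2_eq_square algebra_simps)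
  have u: "coeff (u * Z) d = coeff Z 0" for Z unfolding u_def coeff_monom_mult by simp
  have "coeff E d = 0"
  proof (rule coeff_eq_0)
    have "degree E \<le> b * 1" unfolding E_def by (rule ev3_top(1)[OF F]) (simp_all add: y_def)
    then show "degree E < d" using b by simp
  qed
  moreover have "coeff G d = 0" using b d0 by (simp add: Gm)
  moreover have "coeff (u * R) 0 = 0" using d0 by (simp add: u_def coeff_mult)
  ultimately have "\<alpha> * coeff Y 0 = 0" using arg_cong[OF GE, of "\<lambda>g. coeff g d"] by (simp add: u)
  then have "coeff Y 0 = 0" using \<alpha> by simp
  moreover have "coeff (J j) 0 = eval3 (partial_deriv j F) q" for j
    unfolding poly_0_coeff_0[symmetric] J_def poly_ev3 eval3_ev3 by (simp add: y_def)
  ultimately have "eval3 (dird p F) q = 0" by (simp add: Y_def eval3_dird sum_3)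
  then show False using tangent by simp
qed

section \<open>The curve as the graph of a polynomial\<close>

context middle_line
begin

lemma degree_bound: assumes b1: "b1 = 1" and n1: "n = 1" and b3: "2 \<le> b3" shows "d \<le> b3"
proof (rule ccontr)
  assume "\<not> d \<le> b3"
  then have db: "b3 < d" by simp
  have l1: "homogeneous 1 F1" using h1 b1 by simp
  note lin1 = eval3_linear(2,3)[OF l1] and lin2 = eval3_linear(2,3)[OF F2_linear]
  obtain c where c: "c \<noteq> 0" "dird \<pp> C = K3 c * F1 ^ (d - 1)" by (rule polar_power[OF b1 n1])
  have F1o: "eval3 F1 \<oo> \<noteq> 0" using transversal(1) unfolding eval3_linear(1)[OF l1] .
  have F2w: "eval3 F2 \<ww> \<noteq> 0"
  proof
    assume z: "eval3 F2 \<ww> = 0"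
    \<comment> \<open>A combination of \<open>\<ww>\<close> and \<open>\<oo>\<close> on the line
      \<open>F1\<close>; if \<open>F2\<close> vanished at \<open>\<ww>\<close> it would be tangent
      to both lines at P without being proportional to \<open>\<pp>\<close>.\<close>
    define s where "s = eval3 F1 \<oo> *s \<ww> + (- eval3 F1 \<ww>) *s \<oo>"
    have "eval3 F1 s = 0" unfolding s_def lin1 by simp
    moreover have "eval3 F2 s = 0" unfolding s_def lin2 z F2_o by simp
    ultimately obtain k where "s = k *s \<pp>" using kerP[of s] unfolding eval3_linear(1)[OF l1] eval3_linear(1)[OF F2_linear] by blast
    then have "0 *s \<pp> + eval3 F1 \<oo> *s \<ww> + (- eval3 F1 \<ww>) *s \<oo> = k *s \<pp> + 0 *s \<ww> + 0 *s \<oo>" by (simp add: s_def)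
    from A_injective(2)[OF this] show False using F1o by simp
  qed
  \<comment> \<open>Coordinates adapted to the two lines, which meet in \<open>\<pp>\<close>:
    \<open>r\<close> lies on \<open>F1\<close> and has F2 = 1, while \<open>q\<close> below is the
    multiple of \<open>\<qq>\<close> with F1 = 1. Points with F1 = 1 are q + w*p + t*r, and t is the
    value of \<open>F2\<close>.\<close>
  define r where "r = (1 / eval3 F2 \<ww>) *s (\<ww> + (- eval3 F1 \<ww> / eval3 F1 \<oo>) *s \<oo>)"
  have r: "eval3 F1 r = 0" "eval3 F2 r = 1" unfolding r_def lin1 lin2 F2_o using F1o F2w by simp_all
  have F1q: "eval3 F1 \<qq> \<noteq> 0" unfolding \<qq>_def lin1 F1p using F1o by simp
  define q where "q = (1 / eval3 F1 \<qq>) *s \<qq>"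
  have q: "eval3 F1 q = 1" "eval3 F2 q = 0" "eval3 C q = 0"
    unfolding q_def lin1 lin2 F2q eval3_scale[OF hom] using F1q Cq by (simp_all add: \<qq>_def)
  define E where "E = ev3 (\<lambda>c. [:c:]) [:q $ 1, r $ 1:] [:q $ 2, r $ 2:] [:q $ 3, r $ 3:] C"
  have E: "poly E t = eval3 C (q + t *s r)" for t unfolding E_def poly_ev3 eval3_ev3 by simp
  \<comment> \<open>The derivative in w is the polar at \<open>\<pp>\<close>, that is c*F1^(d - 1),
    which is the constant c where F1 = 1. So the equation is affine in w.\<close>
  have C_line: "eval3 C (q + w *s \<pp> + t *s r) = c * w + poly E t" for w t
  proof -
    define v where "v = q + t *s r"
    define y where "y i = [:v $ i, \<pp> $ i:]" for i
    define g where "g = ev3 (\<lambda>c. [:c:]) (y 1) (y 2) (y 3) C"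
    have g: "poly g w = eval3 C (v + w *s \<pp>)" for w unfolding g_def poly_ev3 eval3_ev3 by (simp add: y_def)
    have "poly (pderiv g) w = c" for w
    proof -
      have "pderiv g = [:\<pp> $ 1:] * ev3 (\<lambda>c. [:c:]) (y 1) (y 2) (y 3) (partial_deriv 1 C)
        + [:\<pp> $ 2:] * ev3 (\<lambda>c. [:c:]) (y 1) (y 2) (y 3) (partial_deriv 2 C)
        + [:\<pp> $ 3:] * ev3 (\<lambda>c. [:c:]) (y 1) (y 2) (y 3) (partial_deriv 3 C)"
        unfolding g_def
        by (subst chain_rule_ev3[OF derivation_pderiv comm_ring_hom_poly_const]) (simp_all add: y_def pderiv_pCons)
      then have "poly (pderiv g) w = eval3 (dird \<pp> C) (v + w *s \<pp>)"
        unfolding eval3_dird sum_3 unfolding eval3_ev3 by (simp add: poly_ev3 y_def)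
      also have "\<dots> = c * eval3 F1 (v + w *s \<pp>) ^ (d - 1)"
      proof -
        interpret e: comm_ring_hom "ev3 (\<lambda>c. c) ((v + w *s \<pp>) $ 1) ((v + w *s \<pp>) $ 2) ((v + w *s \<pp>) $ 3)"
          by (rule ev3_hom[OF comm_ring_hom_id])
        show ?thesis unfolding c(2) eval3_mult eval3_K3 unfolding eval3_ev3 e.hom_power ..
      qed
      also have "eval3 F1 (v + w *s \<pp>) = 1" unfolding v_def lin1 F1p q r by simp
      finally show ?thesis by simp
    qed
    then have "pderiv (g - [:0, c:]) = 0" by (intro poly_ext) (simp add: pderiv_diff pderiv_pCons)
    then obtain h where h: "g - [:0, c:] = [:h:]" using pderiv_iszero by blast
    have gw: "poly g w = h + c * w" for w using arg_cong[OF h, of "\<lambda>g. poly g w"] by (simp add: algebra_simps)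
    have "eval3 C (q + w *s \<pp> + t *s r) = poly g w" unfolding g v_def by (simp add: algebra_simps)
    moreover have "poly E t = poly g 0" unfolding g E v_def by simp
    ultimately show ?thesis unfolding gw by simp
  qed
  define W where "W = smult (- 1 / c) E"
  \<comment> \<open>\<open>C\<close> meets the line \<open>F1\<close> only in \<open>\<pp>\<close>,
    and \<open>r\<close> is another point of it. This value is the top coefficient of
    \<open>E\<close>, so \<open>W\<close> has degree exactly d.\<close>
  have "eval3 C r \<noteq> 0"
  proof
    assume "eval3 C r = 0"
    moreover have "r \<noteq> 0" using r(2) lin2(2)[of 0 0] by auto
    ultimately obtain k where "r = k *s \<pp>" using z1 r(1) by blast
    then show False using r(2) lin2(2)[of k \<pp>] F2p by simp
  qed
  moreover have "degree E \<le> d * 1" "coeff E (d * 1) = eval3 C r"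
    unfolding E_def eval3_ev3 by (subst ev3_top[OF hom]; simp)+
  ultimately have "degree E = d" using le_degree[of E d] by simp
  then have dW: "degree W = d" using c(1) by (simp add: W_def)
  have W0: "coeff W 0 = 0" using E[of 0] q(3) by (simp add: W_def poly_0_coeff_0)
  have Wt: "eval3 C (q + poly W t *s \<pp> + t *s r) = 0" for t unfolding C_line W_def using c(1) by simp
  show False
  proof (rule no_high_contact[OF h3 b3 db dW W0])
    show "eval3 F3 \<pp> \<noteq> 0" using z3[OF pq_nonzero(1) Cp] not_parallel(1) by blast
    show "t = 0" if F: "eval3 F3 (q + poly W t *s \<pp> + t *s r) = 0" for t
    proof -
      define x where "x = q + poly W t *s \<pp> + t *s r"
      have x1: "eval3 F1 x = 1" and x2: "eval3 F2 x = t" unfolding x_def lin1 lin2 F1p F2p q r by simp_all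
      have "x \<noteq> 0" using x1 lin1(2)[of 0 0] by auto
      then obtain k where "x = k *s \<qq>" using z3 Wt F unfolding x_def by blast
      then show ?thesis using x2 lin2(2)[of k \<qq>] F2q by simp
    qed
    show "eval3 (dird \<pp> F3) q \<noteq> 0"
    proof
      assume "eval3 (dird \<pp> F3) q = 0"
      then have "eval3 (dird \<pp> F3) \<qq> = 0" unfolding q_def eval3_dird_scale_point[OF h3] using F1q by simp
      then show False using kerQ[of \<pp>] not_parallel(1) F2p unfolding eval3_linear(1)[OF F2_linear] by blast
    qed
  qed
qed

end

subsection \<open>Points of a plane curve\<close>

lemma poly_zero_on_range:
  fixes h :: "complex \<Rightarrow> 'a::idom"
  assumes h: "inj h" and z: "\<And>y. poly g (h y) = 0" shows "g = 0"
proof (rule ccontr)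
  assume "g \<noteq> 0"
  then have "finite {x. poly g x = 0}" by (rule poly_roots_finite)
  moreover have "range h \<subseteq> {x. poly g x = 0}" using z by auto
  ultimately have "finite (range h)" by (rule finite_subset[rotated])
  then show False using finite_imageD[OF _ h] infinite_UNIV_char_0[where 'a = complex] by blast
qed

lemma inj_const: "inj (\<lambda>y::complex. [:y:])" "inj (\<lambda>z::complex. [:[:z:]:])" by (simp_all add: inj_on_def)

lemma eval3_zero: assumes "\<And>v. eval3 F v = 0" shows "F = 0"
proof (rule poly_zero_on_range[OF inj_const(2)], rule poly_zero_on_range[OF inj_const(1)])
  fix z y
  have "poly (poly (poly F [:[:z:]:]) [:y:]) x = poly 0 x" for x
    using assms[of "vector [x, y, z]"] by (simp add: eval3_def vector_3)
  then show "poly (poly F [:[:z:]:]) [:y:] = 0" by (rule poly_ext)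
qed

lemma vector_components: "vector [v$1, v$2, v$3] = (v :: complex^3)"
  by (simp add: Finite_Cartesian_Product.vec_eq_iff forall_3 vector_3)

lemma eval3_lsub: "eval3 (lsub A F) v = eval3 F (A *v v)"
  unfolding eval3_ev3 ev3_lsub[OF comm_ring_hom_id] lin_complex vector_components ..

text \<open>The determinant of p, w, r is linear in w, and its coefficients are up to sign the
  coordinates of the cross product of p and r, which are not all zero.\<close>

lemma exists_basis:
  assumes p: "p \<noteq> (0 :: complex^3)" and o: "\<not> (\<exists>c. r = c *s p)"
  obtains A B :: "complex^3^3" and w where "A ** B = mat 1" "B ** A = mat 1"
    "\<forall>x y z. A *v vector [x,y,z] = x *s p + y *s w + z *s r"
proof -
  have "\<exists>w :: complex^3. p$1 * w$2 * r$3 + w$1 * r$2 * p$3 + r$1 * p$2 * w$3 - p$1 * r$2 * w$3 - w$1 * p$2 * r$3 - r$1 * w$2 * p$3 \<noteq> 0"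
  proof (rule ccontr)
    assume n: "\<not> ?thesis"
    have e1: "r$2 * p$3 - p$2 * r$3 = 0" using n[simplified, rule_format, of "vector [1,0,0]"] by (simp add: vector_3)
    have e2: "p$1 * r$3 - r$1 * p$3 = 0" using n[simplified, rule_format, of "vector [0,1,0]"] by (simp add: vector_3)
    have e3: "r$1 * p$2 - p$1 * r$2 = 0" using n[simplified, rule_format, of "vector [0,0,1]"] by (simp add: vector_3)
    obtain i where i: "p $ i \<noteq> 0" using p by (auto simp: Finite_Cartesian_Product.vec_eq_iff)
    have "\<forall>i j. p $ i * r $ j - r $ i * p $ j = 0"
      unfolding forall_3 using e1 e2 e3 by (simp add: mult.commute)
    then have c: "p $ i * r $ j = r $ i * p $ j" for j using right_minus_eq by blast
    define t where "t = r $ i / p $ i"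
    have t: "r $ j = t * p $ j" for j unfolding t_def using i c[of j] by (simp add: nonzero_eq_divide_eq mult.commute)
    have "r = t *s p" using t by (simp add: Finite_Cartesian_Product.vec_eq_iff)
    then show False using o by blast
  qed
  then obtain w :: "complex^3" where w: "p$1 * w$2 * r$3 + w$1 * r$2 * p$3 + r$1 * p$2 * w$3 - p$1 * r$2 * w$3 - w$1 * p$2 * r$3 - r$1 * w$2 * p$3 \<noteq> 0" ..
  define A :: "complex^3^3" where "A = (\<chi> i. vector [p $ i, w $ i, r $ i])"
  have "Determinants.det A \<noteq> 0" using w by (simp add: A_def det_3 vector_3)
  then obtain B where "A ** B = mat 1" "B ** A = mat 1" by (meson invertible_det_nz invertible_def)
  moreover have "\<forall>x y z. A *v vector [x,y,z] = x *s p + y *s w + z *s r"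
    by (simp add: A_def Finite_Cartesian_Product.vec_eq_iff matrix_vector_mult_def sum_3 vector_3 mult.commute)
  ultimately show ?thesis by (rule that)
qed

lemma point_scale: assumes "c \<noteq> 0" shows "point (c *s v) = point v"
proof
  show "point (c *s v) \<subseteq> point v" by (auto simp: point_def)
  have "a *s v = (a / c) *s (c *s v)" for a using assms by simp
  then show "point v \<subseteq> point (c *s v)" unfolding point_def by blast
qed

lemma point_eq: "point v = point p \<Longrightarrow> \<exists>c. v = c *s p"
proof -
  assume "point v = point p"
  moreover have "1 *s v \<in> point v" unfolding point_def by (rule rangeI)
  ultimately show ?thesis by (auto simp: point_def)
qed

section \<open>Charts and common zeros for an integral curve\<close>

locale integral_form =
  fixes C :: poly3 and d :: nat
  assumes hom: "homogeneous d C" and irr: "Factorial_Ring.irreducible C"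
begin

lemma d0: "0 < d"
proof (rule ccontr)
  assume "\<not> 0 < d"
  then have h: "homogeneous 0 C" using hom by simp
  have "C = K3 (coeff3 C (0,0,0))"
  proof (rule coeff3_eqI)
    fix e show "coeff3 C e = coeff3 (K3 (coeff3 C (0,0,0))) e"
      using h unfolding homogeneous_iff by (cases e) (auto simp: coeff3_def K3_def coeff_pCons split: nat.splits)
  qed
  moreover have "coeff3 C (0,0,0) \<noteq> 0"
  proof
    assume "coeff3 C (0,0,0) = 0"
    then have "C = 0" using calculation by (simp add: K3_def)
    then show False using irr by simp
  qed
  then have "K3 (coeff3 C (0,0,0)) * K3 (1 / coeff3 C (0,0,0)) = 1" by (simp add: K3_def one_pCons)
  ultimately have "C dvd 1" by (metis dvd_triv_left)
  then show False using irr Factorial_Ring.irreducible_not_unit by blast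
qed

lemma nonzero_point: obtains v where "eval3 C v \<noteq> 0"
  using eval3_zero[of C] irr by auto

lemma not_on_C: assumes "eval3 C p = 0" "eval3 C r \<noteq> 0" shows "\<not> (\<exists>c. r = c *s p)"
  using assms eval3_scale[OF hom] by auto

lemma chart_at:
  assumes p: "p \<noteq> 0" and r: "eval3 C p = 0" "eval3 C r \<noteq> 0"
  obtains A B N \<eta> where "branches C d A B N \<eta>" "A *v vector [1,0,0] = p" "A *v vector [0,0,1] = r"
proof -
  obtain A B :: "complex^3^3" and w where A: "A ** B = mat 1" "B ** A = mat 1" "\<forall>x y z. A *v vector [x,y,z] = x *s p + y *s w + z *s r"
    by (rule exists_basis[OF p not_on_C[OF r]])
  have e: "A *v vector [1,0,0] = p" "A *v vector [0,0,1] = r" using A(3)[rule_format] by simp_all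
  interpret plane_chart C d A B
    by unfold_locales (use hom irr d0 A(1,2) e r in auto)
  obtain N \<eta> where "branches C d A B N \<eta>" by (rule exists_branches)
  then show ?thesis using e that by blast
qed

lemma common_zero_form: assumes "homogeneous e G" "0 < e" obtains v where "v \<noteq> 0" "eval3 C v = 0" "eval3 G v = 0"
proof -
  obtain r where r: "eval3 C r \<noteq> 0" by (rule nonzero_point)
  have r0: "r \<noteq> 0"
  proof
    assume "r = 0"
    have "eval3 C (0 *s r) = 0" unfolding eval3_scale[OF hom] using d0 by simp
    then show False using \<open>r = 0\<close> r by simp
  qed
  obtain i where i: "r $ i \<noteq> 0" using r0 by (auto simp: Finite_Cartesian_Product.vec_eq_iff)
  \<comment> \<open>Addition in the index type is cyclic, so \<open>p\<close> is a coordinate vector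
    whose i-th entry is 0 and cannot be proportional to \<open>r\<close>.\<close>
  define p :: "complex^3" where "p = axis (i + 1) 1"
  have ii: "i + 1 \<noteq> i" by simp
  have p0: "p \<noteq> 0" by (simp add: p_def axis_eq_0_iff)
  have np: "\<not> (\<exists>c. r = c *s p)" using i ii by (auto simp: p_def axis_def)
  obtain A B :: "complex^3^3" and w where A: "A ** B = mat 1" "B ** A = mat 1" "\<forall>x y z. A *v vector [x,y,z] = x *s p + y *s w + z *s r"
    by (rule exists_basis[OF p0 np])
  interpret plane_chart C d A B
    by unfold_locales (use hom irr d0 A r in auto)
  show ?thesis using common_zero[OF assms] that by blast
qed

lemma dvd_form_degree: assumes "C dvd G" "homogeneous e G" "G \<noteq> 0" shows "d \<le> e"
proof -
  obtain r where r: "eval3 C r \<noteq> 0" by (rule nonzero_point)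
  obtain p where p: "p \<noteq> 0" "eval3 C p = 0" by (rule common_zero_form[OF homogeneous_X(1)]) simp
  obtain A B N \<eta> where "branches C d A B N \<eta>" by (rule chart_at[OF p r])
  then interpret branches C d A B N \<eta> .
  show ?thesis by (rule dvd_degree[OF assms])
qed

lemma fibre_nonempty: assumes v: "v \<noteq> 0" "eval3 C v = 0" obtains M where "(point v, M) \<in> normalization C"
proof -
  obtain r where r: "eval3 C r \<noteq> 0" by (rule nonzero_point)
  obtain A B N \<eta> where b: "branches C d A B N \<eta>" "A *v vector [1,0,0] = v" by (rule chart_at[OF v r])
  interpret branches C d A B N \<eta> by (rule b)
  have "eval3 C (A *v vector [1,0,0]) = 0" using v b(2) by simp
  then obtain k where k: "k < d" "fps_nth (\<eta> k) 0 = 0" by (rule exists_center)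
  have "center k = v" unfolding center_eq \<pp>_def k(2) b(2) by simp
  then show ?thesis using Mideal_normalization[OF k(1)] that by metis
qed

text \<open>Otherwise the whole line through p and q lies on \<open>C\<close>; its equation divides
  the irreducible form \<open>C\<close>, which is then of degree 1.\<close>

lemma point_on_line_off_curve:
  assumes d2: "2 \<le> d" and p: "p \<noteq> 0" "eval3 C p = 0" and q: "eval3 C q = 0" "\<not> (\<exists>c. q = c *s p)"
  obtains c where "c \<noteq> 0" "eval3 C (c *s q - p) \<noteq> 0"
proof (rule ccontr)
  assume no: "\<not> thesis"
  have no: "eval3 C (c *s q - p) = 0" if "c \<noteq> 0" for c using no that \<open>\<And>c. c \<noteq> 0 \<Longrightarrow> eval3 C (c *s q - p) \<noteq> 0 \<Longrightarrow> thesis\<close> by blast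
  have all: "eval3 C (x *s p + y *s q) = 0" for x y
  proof (cases "x = 0 \<or> y = 0")
    case True
    then show ?thesis using p(2) q(1) by (auto simp: eval3_scale[OF hom])
  next
    case False
    then have e: "x *s p + y *s q = (- x) *s ((- y / x) *s q - p)" by (simp add: Finite_Cartesian_Product.vec_eq_iff field_simps)
    show ?thesis unfolding e eval3_scale[OF hom] using no[of "- y / x"] False by simp
  qed
  obtain A B :: "complex^3^3" and w where A: "A ** B = mat 1" "B ** A = mat 1" "\<forall>x y z. A *v vector [x,y,z] = x *s p + y *s w + z *s q"
    by (rule exists_basis[OF p(1) q(2)])
  \<comment> \<open>With the last two columns exchanged, the line through p and q is given by the
    vanishing of the third coordinate, so \<open>X3\<close> divides the transformed
    equation.\<close>
  define A' :: "complex^3^3" where "A' = (\<chi> i. vector [p $ i, q $ i, w $ i])"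
  have A': "A' *v vector [x,y,z] = A *v vector [x,z,y]" for x y z
    unfolding A(3)[rule_format] by (simp add: A'_def Finite_Cartesian_Product.vec_eq_iff matrix_vector_mult_def sum_3 vector_3 mult.commute)
  have inj: "inj ((*v) A')"
  proof (rule injI)
    fix u v assume e: "A' *v u = A' *v v"
    have w: "A' *v u = A *v vector [u$1,u$3,u$2]" for u using A'[of "u$1" "u$2" "u$3"] unfolding vector_components .
    have "A *v vector [u$1,u$3,u$2] = A *v vector [v$1,v$3,v$2]" using e unfolding w .
    then have "B *v (A *v vector [u$1,u$3,u$2]) = B *v (A *v vector [v$1,v$3,v$2])" by simp
    then have v: "(vector [u$1,u$3,u$2] :: complex^3) = vector [v$1,v$3,v$2]" by (simp add: matrix_vector_mul_assoc A(2))
    show "u = v" unfolding Finite_Cartesian_Product.vec_eq_iff forall_3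
      using arg_cong[OF v, of "\<lambda>v. v $ 1"] arg_cong[OF v, of "\<lambda>v. v $ 2"] arg_cong[OF v, of "\<lambda>v. v $ 3"] by (simp add: vector_3)
  qed
  then obtain B' where B': "B' ** A' = mat 1" using matrix_left_invertible_injective[of A'] by blast
  then have B'': "A' ** B' = mat 1" by (simp add: matrix_left_right_inverse)
  interpret b: comm_ring_hom "lsub B'" by (rule lsub_hom)
  have "poly (lsub A' C) 0 = 0"
  proof (rule poly_zero_on_range[OF inj_const(1)])
    fix y
    have "eval3 (lsub A' C) (vector [x,y,0]) = 0" for x
      unfolding eval3_lsub A' A(3)[rule_format] using all[of x y] by simp
    then have "poly (poly (poly (lsub A' C) 0) [:y:]) x = poly 0 x" for x by (simp add: eval3_def vector_3)
    then show "poly (poly (lsub A' C) 0) [:y:] = 0" by (rule poly_ext)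
  qed
  then have "X3 dvd lsub A' C" unfolding X3_def using poly_eq_0_iff_dvd[of "lsub A' C" 0] by simp
  then have "lsub B' X3 dvd lsub B' (lsub A' C)" by (rule b.hom_dvd)
  then have dvd: "lsub B' X3 dvd C" using lsub_lsub[OF B''] by simp
  then obtain H where H: "C = lsub B' X3 * H" by (rule dvdE)
  have "\<not> lsub B' X3 dvd 1"
  proof
    assume "lsub B' X3 dvd 1"
    then obtain G where G: "1 = lsub B' X3 * G" by (rule dvdE)
    have "B' *v (A' *v vector [1,0,0]) = vector [1,0,0]" by (simp only: matrix_vector_mul_assoc B' matrix_vector_mul_lid)
    then have "B' *v p = vector [1,0,0]" by (simp add: A' A(3)[rule_format])
    then have "eval3 (lsub B' X3) p = eval3 X3 (vector [1,0,0])" unfolding eval3_lsub by simp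
    then have "eval3 (lsub B' X3) p = 0" by (simp add: eval3_def X3_def vector_3)
    then show False using arg_cong[OF G, of "\<lambda>G. eval3 G p"] by (simp add: eval3_mult eval3_1)
  qed
  then have "H dvd 1" using H irr Factorial_Ring.irreducibleD by blast
  then obtain K where K: "1 = H * K" by (rule dvdE)
  have "lsub B' X3 = C * K" unfolding H mult.assoc K[symmetric] by simp
  then have "C dvd lsub B' X3" by simp
  moreover have "lsub B' X3 \<noteq> 0" using dvd irr by auto
  ultimately have "d \<le> 1" by (rule dvd_form_degree[OF _ homogeneous_lsub[OF homogeneous_X(3)]])
  then show False using d2 by simp
qed

text \<open>The projection centre c*q - p lies on the line PQ; taking c*q as representative of Q
  gives it the root value 1.\<close>

lemma exists_pq_chart:
  assumes d2: "2 \<le> d" and p: "p \<noteq> 0" "eval3 C p = 0" and q: "eval3 C q = 0" "\<not> (\<exists>c. q = c *s p)"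
    and fp: "\<And>M M'. (point p, M) \<in> normalization C \<Longrightarrow> (point p, M') \<in> normalization C \<Longrightarrow> M = M'"
    and fq: "\<And>M M'. (point q, M) \<in> normalization C \<Longrightarrow> (point q, M') \<in> normalization C \<Longrightarrow> M = M'"
  obtains A B N \<eta> c where "pq_chart C d A B N \<eta>" "A *v vector [1,0,0] = p"
    "A *v vector [1,0,0] + A *v vector [0,0,1] = c *s q" "c \<noteq> 0"
proof -
  obtain c where c: "c \<noteq> 0" "eval3 C (c *s q - p) \<noteq> 0" by (rule point_on_line_off_curve[OF d2 p q])
  obtain A B N \<eta> where b: "branches C d A B N \<eta>" "A *v vector [1,0,0] = p" "A *v vector [0,0,1] = c *s q - p"
    by (rule chart_at[OF p c(2)])
  interpret branches C d A B N \<eta> by (rule b)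
  have P: "\<pp> = p" and Q: "\<pp> + \<oo> = c *s q" unfolding \<pp>_def \<oo>_def b(2,3) by simp_all
  have "pq_chart C d A B N \<eta>"
  proof (intro pq_chart.intro pq_chart_axioms.intro b(1))
    show "eval3 C \<pp> = 0" using p(2) P by simp
    show "eval3 C (\<pp> + \<oo>) = 0" unfolding Q eval3_scale[OF hom] q(1) by simp
    show "2 \<le> d" by (rule d2)
    show "M = M'" if "(point \<pp>, M) \<in> normalization C" "(point \<pp>, M') \<in> normalization C" for M M'
      using that unfolding P by (rule fp)
    show "M = M'" if "(point (\<pp> + \<oo>), M) \<in> normalization C" "(point (\<pp> + \<oo>), M') \<in> normalization C" for M M'
      using that unfolding Q point_scale[OF c(1)] by (rule fq)
  qed
  moreover have "A *v vector [1,0,0] + A *v vector [0,0,1] = c *s q" unfolding b(2,3) by simp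
  ultimately show ?thesis using that b(2) c(1) by blast
qed

end

lemma three_UNIV: assumes "i \<noteq> j" "i \<noteq> k" "j \<noteq> (k::3)" shows "UNIV = {i, j, k}"
  using assms exhaust_3[of i] exhaust_3[of j] exhaust_3[of k] unfolding UNIV_3 by auto

lemma irreducible_nonzero: "Factorial_Ring.irreducible p \<Longrightarrow> p \<noteq> 0"
  using Factorial_Ring.not_irreducible_zero by blast

text \<open>Read a_i and c_i as incidence of the i-th component with P and with Q. If no point lies
  on all three, every component meets one of the points, and no two components miss the same point,
  then one component contains both points and the other two contain one each.\<close>

lemma incidence_cases:
  assumes "\<not> a1 \<or> \<not> a2 \<or> \<not> a3" "\<not> c1 \<or> \<not> c2 \<or> \<not> c3"
    and "\<not> c1 \<Longrightarrow> \<not> c2 \<Longrightarrow> False" "\<not> c1 \<Longrightarrow> \<not> c3 \<Longrightarrow> False" "\<not> c2 \<Longrightarrow> \<not> c3 \<Longrightarrow> False"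
    and "\<not> a1 \<Longrightarrow> \<not> a2 \<Longrightarrow> False" "\<not> a1 \<Longrightarrow> \<not> a3 \<Longrightarrow> False" "\<not> a2 \<Longrightarrow> \<not> a3 \<Longrightarrow> False"
    and "a1 \<or> c1" "a2 \<or> c2" "a3 \<or> c3"
    and "a1 \<Longrightarrow> a2 \<Longrightarrow> c2 \<Longrightarrow> c3 \<Longrightarrow> R" "a1 \<Longrightarrow> a3 \<Longrightarrow> c3 \<Longrightarrow> c2 \<Longrightarrow> R"
    and "a2 \<Longrightarrow> a1 \<Longrightarrow> c1 \<Longrightarrow> c3 \<Longrightarrow> R" "a2 \<Longrightarrow> a3 \<Longrightarrow> c3 \<Longrightarrow> c1 \<Longrightarrow> R"
    and "a3 \<Longrightarrow> a1 \<Longrightarrow> c1 \<Longrightarrow> c2 \<Longrightarrow> R" "a3 \<Longrightarrow> a2 \<Longrightarrow> c2 \<Longrightarrow> c1 \<Longrightarrow> R"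
  shows R
  using assms by argo

lemma prod_three: "(\<Prod>i\<in>UNIV. f i) = f 1 * f 2 * (f (3::3) :: 'a::comm_monoid_mult)"
  unfolding UNIV_3 by (simp add: mult.assoc)

section \<open>The three components and the two points of contact\<close>

locale hyperbolic_curve = integral_form +
  fixes F :: "3 \<Rightarrow> poly3" and b :: "3 \<Rightarrow> nat"
  assumes d2: "2 \<le> d" and hF: "\<And>i. homogeneous (b i) (F i)" and b0: "\<And>i. 0 < b i"
    and nd: "\<And>i. \<not> C dvd F i"
    and node: "\<And>i j v. i \<noteq> j \<Longrightarrow> v \<noteq> 0 \<Longrightarrow> eval3 (F i) v = 0 \<Longrightarrow> eval3 (F j) v = 0 \<Longrightarrow> is_node (\<Prod>i\<in>UNIV. F i) (point v)"
    and fibre: "finite (normalization_preimage C (zero_locus C \<inter> zero_locus (\<Prod>i\<in>UNIV. F i)))"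
      "card (normalization_preimage C (zero_locus C \<inter> zero_locus (\<Prod>i\<in>UNIV. F i))) \<le> 2"
begin

lemma prod_F: assumes "i \<noteq> j" "i \<noteq> k" "j \<noteq> k" shows "(\<Prod>i\<in>UNIV. F i) = F i * F j * F k"
  unfolding three_UNIV[OF assms] using assms by (simp add: mult.assoc)

lemma crossing:
  assumes ijk: "i \<noteq> j" "i \<noteq> k" "j \<noteq> k" and v: "v \<noteq> 0" "eval3 (F i) v = 0" "eval3 (F j) v = 0"
  shows "eval3 (F k) v \<noteq> 0"
    "eval3 (dird s (F i)) v = 0 \<Longrightarrow> eval3 (dird s (F j)) v = 0 \<Longrightarrow> \<exists>c. s = c *s v"
  using node_kernel[OF hF hF hF v node[OF ijk(1) v, unfolded prod_F[OF ijk]]] by blast+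

definition "S = normalization_preimage C (zero_locus C \<inter> zero_locus (\<Prod>i\<in>UNIV. F i))"

lemma in_S:
  assumes v: "v \<noteq> 0" "eval3 C v = 0" "eval3 (F i) v = 0" and M: "(point v, M) \<in> normalization C"
  shows "(point v, M) \<in> S"
proof -
  have p: "(\<Prod>i\<in>UNIV. F i) = F 1 * F 2 * F 3" by (rule prod_F) simp_all
  have h: "homogeneous (b 1 + b 2 + b 3) (\<Prod>i\<in>UNIV. F i)" unfolding p by (intro homogeneous_mult hF)
  have "eval3 (\<Prod>i\<in>UNIV. F i) v = 0" unfolding p eval3_mult using v(3) exhaust_3[of i] by auto
  then show ?thesis using M v point_zero_locus[OF hom v(1)] point_zero_locus[OF h v(1)]
    by (simp add: S_def normalization_preimage_def)
qed

text \<open>Representatives of two distinct points of \<open>C\<close>, each with a single point of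
  the normalization above it, that contain all intersections of \<open>C\<close> with the three
  components.\<close>

definition "pair p q \<longleftrightarrow> p \<noteq> 0 \<and> q \<noteq> 0 \<and> eval3 C p = 0 \<and> eval3 C q = 0 \<and> \<not> (\<exists>c. q = c *s p) \<and>
   (\<forall>M M'. (point p, M) \<in> normalization C \<longrightarrow> (point p, M') \<in> normalization C \<longrightarrow> M = M') \<and>
   (\<forall>M M'. (point q, M) \<in> normalization C \<longrightarrow> (point q, M') \<in> normalization C \<longrightarrow> M = M') \<and>
   (\<forall>i v. v \<noteq> 0 \<longrightarrow> eval3 C v = 0 \<longrightarrow> eval3 (F i) v = 0 \<longrightarrow> (\<exists>c. v = c *s p) \<or> (\<exists>c. v = c *s q))"

lemma pairD:
  assumes "pair p q"
  shows "p \<noteq> 0" "q \<noteq> 0" "eval3 C p = 0" "eval3 C q = 0" "\<not> (\<exists>c. q = c *s p)"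
    "\<forall>M M'. (point p, M) \<in> normalization C \<longrightarrow> (point p, M') \<in> normalization C \<longrightarrow> M = M'"
    "\<forall>M M'. (point q, M) \<in> normalization C \<longrightarrow> (point q, M') \<in> normalization C \<longrightarrow> M = M'"
    "\<forall>i v. v \<noteq> 0 \<longrightarrow> eval3 C v = 0 \<longrightarrow> eval3 (F i) v = 0 \<longrightarrow> (\<exists>c. v = c *s p) \<or> (\<exists>c. v = c *s q)"
  by (insert assms, unfold pair_def, elim conjE, assumption)+

lemma pair_swap: assumes "pair p q" shows "pair q p"
proof -
  have "\<not> (\<exists>c. p = c *s q)"
  proof
    assume "\<exists>c. p = c *s q"
    then obtain c where c: "p = c *s q" ..
    have "c \<noteq> 0"
    proof
      assume "c = 0"
      then have "p = 0" using c by simp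
      then show False using pairD(1)[OF assms] by simp
    qed
    then have "q = (1 / c) *s p" unfolding c by simp
    then show False using pairD(5)[OF assms] by blast
  qed
  moreover have "\<forall>i v. v \<noteq> 0 \<longrightarrow> eval3 C v = 0 \<longrightarrow> eval3 (F i) v = 0 \<longrightarrow> (\<exists>c. v = c *s q) \<or> (\<exists>c. v = c *s p)"
    using pairD(8)[OF assms] by (simp only: disj_commute)
  ultimately show ?thesis using pairD(1-4,6,7)[OF assms] unfolding pair_def by - (intro conjI; assumption)
qed

lemma pair_exists: obtains p q where "pair p q"
proof -
  have "\<exists>v. v \<noteq> 0 \<and> eval3 C v = 0 \<and> eval3 (F i) v = 0" for i
    using common_zero_form[OF hF b0] by metis
  then obtain v where v: "\<And>i. v i \<noteq> 0" "\<And>i. eval3 C (v i) = 0" "\<And>i. eval3 (F i) (v i) = 0" by metis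
  have "\<exists>i j q. i = i \<and> q = v j \<and> \<not> (\<exists>c. v j = c *s v i)"
  proof (rule ccontr)
    assume "\<not> ?thesis"
    then have par: "\<exists>c. v j = c *s v i" for i j by blast
    have z: "eval3 (F j) (v 1) = 0" for j
    proof -
      obtain c where c: "v 1 = c *s v j" using par by blast
      show ?thesis unfolding c eval3_scale[OF hF] v(3) by simp
    qed
    show False using crossing(1)[of 1 2 3 "v 1", OF _ _ _ v(1) z z] z[of 3] by simp
  qed
  then obtain i j where np: "\<not> (\<exists>c. v j = c *s v i)" by blast
  obtain M1 M2 where M: "(point (v i), M1) \<in> normalization C" "(point (v j), M2) \<in> normalization C"
    using fibre_nonempty[OF v(1,2)] by metis
  have ne: "point (v i) \<noteq> point (v j)"
  proof
    assume "point (v i) = point (v j)"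
    then have "\<exists>c. v j = c *s v i" by (intro point_eq) simp
    then show False using np by simp
  qed
  have sub: "{(point (v i), M1), (point (v j), M2)} \<subseteq> S"
    using in_S[OF v(1-3) M(1)] in_S[OF v(1-3) M(2)] by simp
  have "card {(point (v i), M1), (point (v j), M2)} = 2" using ne by simp
  then have S: "S = {(point (v i), M1), (point (v j), M2)}"
    using card_seteq[OF _ sub] fibre unfolding S_def by simp
  have "pair (v i) (v j)" unfolding pair_def
  proof (intro conjI allI impI)
    show "v i \<noteq> 0" "v j \<noteq> 0" "eval3 C (v i) = 0" "eval3 C (v j) = 0" by (rule v)+
    show "\<not> (\<exists>c. v j = c *s v i)" by (rule np)
    show "M = M'" if "(point (v i), M) \<in> normalization C" "(point (v i), M') \<in> normalization C" for M M'
      using in_S[OF v(1-3) that(1)] in_S[OF v(1-3) that(2)] ne unfolding S by auto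
    show "M = M'" if "(point (v j), M) \<in> normalization C" "(point (v j), M') \<in> normalization C" for M M'
      using in_S[OF v(1-3) that(1)] in_S[OF v(1-3) that(2)] ne unfolding S by auto
    show "(\<exists>c. w = c *s v i) \<or> (\<exists>c. w = c *s v j)" if w: "w \<noteq> 0" "eval3 C w = 0" "eval3 (F k) w = 0" for k w
    proof -
      obtain M where "(point w, M) \<in> normalization C" by (rule fibre_nonempty[OF w(1,2)])
      then have "(point w, M) \<in> S" by (rule in_S[OF w])
      then have "point w = point (v i) \<or> point w = point (v j)" unfolding S by auto
      then show ?thesis using point_eq by blast
    qed
  qed
  then show ?thesis by (rule that)
qed

lemma pair_chart:
  assumes "pair p q"
  obtains A B N \<eta> c where "pq_chart C d A B N \<eta>" "A *v vector [1,0,0] = p"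
    "A *v vector [1,0,0] + A *v vector [0,0,1] = c *s q" "c \<noteq> 0"
proof -
  have fp: "M = M'" if "(point p, M) \<in> normalization C" "(point p, M') \<in> normalization C" for M M'
    by (rule pairD(6)[OF assms, rule_format, OF that])
  have fq: "M = M'" if "(point q, M) \<in> normalization C" "(point q, M') \<in> normalization C" for M M'
    by (rule pairD(7)[OF assms, rule_format, OF that])
  obtain A B N \<eta> c where "pq_chart C d A B N \<eta>" "A *v vector [1,0,0] = p"
    "A *v vector [1,0,0] + A *v vector [0,0,1] = c *s q" "c \<noteq> 0" by (rule exists_pq_chart[OF d2 pairD(1,3,4,5)[OF assms] fp fq])
  then show thesis by (rule that)
qed

lemma cover:
  assumes "pair p q" "eval3 (F i) q \<noteq> 0" and v: "v \<noteq> 0" "eval3 C v = 0" "eval3 (F i) v = 0"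
  shows "\<exists>c. v = c *s p"
proof (rule ccontr)
  assume "\<not> ?thesis"
  then obtain c where c: "v = c *s q" using pairD(8)[OF assms(1), rule_format, OF v] by blast
  have "c \<noteq> 0"
  proof
    assume "c = 0"
    then show False using c v(1) by simp
  qed
  then show False using v(3) assms(2) unfolding c eval3_scale[OF hF] by simp
qed

lemma two_through_one_point:
  assumes pq: "pair p q" and ij: "i \<noteq> j"
    and z: "eval3 (F i) p = 0" "eval3 (F j) p = 0" "eval3 (F i) q \<noteq> 0" "eval3 (F j) q \<noteq> 0"
  shows False
proof -
  obtain k where k: "i \<noteq> k" "j \<noteq> k"
  proof -
    have "card {i, j} < card (UNIV :: 3 set)" using ij by simp
    then have "UNIV \<noteq> {i, j}" by auto
    then obtain k where "k \<notin> {i, j}" by blast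
    then show ?thesis using that[of k] by auto
  qed
  obtain A B N \<eta> c where c: "pq_chart C d A B N \<eta>" "A *v vector [1,0,0] = p" by (rule pair_chart[OF pq])
  interpret pq_chart C d A B N \<eta> by (rule c)
  have P: "\<pp> = p" by (simp add: \<pp>_def c(2))
  have p0: "p \<noteq> 0" by (rule pairD[OF pq])
  show False
    by (rule no_common_branch_P[OF hF nd b0 _ _ hF nd b0, of i j, unfolded P])
      (use z cover[OF pq z(3)] cover[OF pq z(4)] crossing(2)[OF ij k p0 z(1,2)] in blast)+
qed

lemma chain_of_two_points:
  assumes pq: "pair p q" and ijk: "i \<noteq> j" "i \<noteq> k" "j \<noteq> k"
    and z: "eval3 (F i) p = 0" "eval3 (F j) p = 0" "eval3 (F j) q = 0" "eval3 (F k) q = 0"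
  shows "b j = 1" "2 \<le> b k \<Longrightarrow> d \<le> b k"
proof -
  have pq0: "p \<noteq> 0" "q \<noteq> 0" by (rule pairD[OF pq])+
  have Fkp: "eval3 (F k) p \<noteq> 0" by (rule crossing(1)[OF ijk pq0(1) z(1,2)])
  have iq: "eval3 (F i) q \<noteq> 0" by (rule crossing(1)[OF _ _ _ pq0(2) z(3,4)]) (use ijk in auto)
  obtain A B N \<eta> c where c: "pq_chart C d A B N \<eta>" "A *v vector [1,0,0] = p"
    "A *v vector [1,0,0] + A *v vector [0,0,1] = c *s q" "c \<noteq> 0" by (rule pair_chart[OF pq])
  interpret pq_chart C d A B N \<eta> by (rule c)
  have P: "\<pp> = p" by (simp add: \<pp>_def c(2))
  have Q: "\<qq> = c *s q" unfolding \<qq>_def \<pp>_def \<oo>_def by (rule c(3))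
  have ex: "\<exists>a. v = a *s \<qq>" if ex': "\<exists>a. v = a *s q" for v
  proof -
    obtain a where a: "v = a *s q" using ex' ..
    have "v = (a / c) *s \<qq>" unfolding Q a using c(4) by simp
    then show ?thesis ..
  qed
  have zQ: "eval3 (F j) \<qq> = 0" "eval3 (F k) \<qq> = 0" unfolding Q eval3_scale[OF hF] z by simp_all
  interpret middle_line C d A B N \<eta> "F i" "F j" "F k" "b i" "b j" "b k"
  proof unfold_locales
    show "eval3 (F i) \<pp> = 0" "eval3 (F j) \<pp> = 0" using z P by simp_all
    show "eval3 (F j) \<qq> = 0" "eval3 (F k) \<qq> = 0" by (rule zQ)+
    show "\<exists>c. v = c *s \<pp>" if "v \<noteq> 0" "eval3 C v = 0" "eval3 (F i) v = 0" for v
      unfolding P by (rule cover[OF pq iq that])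
    show "\<exists>c. v = c *s \<qq>" if "v \<noteq> 0" "eval3 C v = 0" "eval3 (F k) v = 0" for v
      by (rule ex, rule cover[OF pair_swap[OF pq] Fkp that])
    show "(\<exists>c. v = c *s \<pp>) \<or> (\<exists>c. v = c *s \<qq>)" if "v \<noteq> 0" "eval3 C v = 0" "eval3 (F j) v = 0" for v
      unfolding P using pairD(8)[OF pq, rule_format, OF that] ex[of v] by (elim disjE) simp_all
    show "\<exists>c. s = c *s \<pp>" if "eval3 (dird s (F i)) \<pp> = 0" "eval3 (dird s (F j)) \<pp> = 0" for s
      by (rule crossing(2)[OF ijk pq_nonzero(1) _ _ that]) (use z P in simp_all)
    show "\<exists>c. s = c *s \<qq>" if "eval3 (dird s (F k)) \<qq> = 0" "eval3 (dird s (F j)) \<qq> = 0" for s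
      by (rule crossing(2)[where i = k and j = j and k = i]) (use ijk pq_nonzero(2) zQ that in auto)
  qed (rule hF nd b0)+
  show "b j = 1" by (rule line(1))
  show "d \<le> b k" if bk: "2 \<le> b k"
  proof (cases "b i = 1")
    case True
    have "(n - 1) * (b k - 1) = 0" using inequality by linarith
    then have "n - 1 = 0" using bk unfolding mult_eq_0_iff by linarith
    then have "n = 1" using mn(2) by linarith
    then show ?thesis by (rule degree_bound[OF True _ bk])
  next
    case False
    then have "2 \<le> b i" using b0(1) by linarith
    \<comment> \<open>Both outer components have degree at least 2 here, which leaves m = n = 1 and
      hence d = 2.\<close>
    have "(m - 1) * (b i - 1) = 0" "(n - 1) * (b k - 1) = 0" using inequality by linarith+
    then have "m - 1 = 0" "n - 1 = 0" using bk \<open>2 \<le> b i\<close> unfolding mult_eq_0_iff by linarith+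
    then have "d \<le> 2" using line(2) by linarith
    then show ?thesis using bk by linarith
  qed
qed

lemma degree_le: assumes sum: "4 \<le> b 1 + b 2 + b 3" shows "\<exists>l. d \<le> b l"
proof -
  obtain p q where pq: "pair p q" by (rule pair_exists)
  have pq0: "p \<noteq> 0" "q \<noteq> 0" by (rule pairD[OF pq])+
  have meet: "eval3 (F i) p = 0 \<or> eval3 (F i) q = 0" for i
  proof -
    obtain v where v: "v \<noteq> 0" "eval3 C v = 0" "eval3 (F i) v = 0" by (rule common_zero_form[OF hF b0])
    show ?thesis
    proof (rule ccontr)
      assume n: "\<not> ?thesis"
      obtain c where c: "v = c *s p" using cover[OF pq _ v] n by blast
      have "c \<noteq> 0"
      proof
        assume "c = 0"
        then show False using c v(1) by simp
      qed
      then show False using n v(3) unfolding c eval3_scale[OF hF] by simp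
    qed
  qed
  have chain: "\<exists>l. d \<le> b l"
    if ijk: "i \<noteq> j" "i \<noteq> k" "j \<noteq> k" and z: "eval3 (F i) p = 0" "eval3 (F j) p = 0" "eval3 (F j) q = 0" "eval3 (F k) q = 0" for i j k
  proof -
    have "(\<Sum>i\<in>UNIV. b i) = b i + b j + b k" unfolding three_UNIV[OF ijk] using ijk by simp
    then have s: "4 \<le> b i + b j + b k" using sum unfolding sum_3 by linarith
    have "b j = 1" by (rule chain_of_two_points(1)[OF pq ijk z])
    \<comment> \<open>The middle component is a line, so total degree 4 leaves an outer component of
      degree at least 2; the second case is the first with P and Q exchanged.\<close>
    then consider "2 \<le> b k" | "2 \<le> b i" using s by linarith
    then show ?thesis
    proof cases
      case 1
      then show ?thesis using chain_of_two_points(2)[OF pq ijk z] by blast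
    next
      case 2
      then show ?thesis using chain_of_two_points(2)[OF pair_swap[OF pq] ijk(3)[symmetric] ijk(2)[symmetric] ijk(1)[symmetric] z(4,3,2,1)] by blast
    qed
  qed
  have noP: False if "i \<noteq> j" "eval3 (F i) q \<noteq> 0" "eval3 (F j) q \<noteq> 0" for i j
    using two_through_one_point[OF pq that(1) _ _ that(2,3)] meet that by blast
  have noQ: False if "i \<noteq> j" "eval3 (F i) p \<noteq> 0" "eval3 (F j) p \<noteq> 0" for i j
    using two_through_one_point[OF pair_swap[OF pq] that(1) _ _ that(2,3)] meet that by blast
  have n: "(1::3) \<noteq> 2" "(1::3) \<noteq> 3" "(2::3) \<noteq> 3" by simp_all
  have tp: "eval3 (F 1) v \<noteq> 0 \<or> eval3 (F 2) v \<noteq> 0 \<or> eval3 (F 3) v \<noteq> 0" if "v \<noteq> 0" for v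
    using crossing(1)[OF n that] by blast
  show ?thesis
    by (rule incidence_cases[OF tp[OF pq0(1)] tp[OF pq0(2)] noP[OF n(1)] noP[OF n(2)] noP[OF n(3)] noQ[OF n(1)] noQ[OF n(2)]
      noQ[OF n(3)] meet meet meet chain[OF n] chain[OF n(2,1) n(3)[symmetric]] chain[OF n(1)[symmetric] n(3) n(2)]
      chain[OF n(3) n(1)[symmetric] n(2)[symmetric]] chain[OF n(2)[symmetric] n(3)[symmetric] n(1)]
      chain[OF n(3)[symmetric] n(2)[symmetric] n(1)[symmetric]]])
qed

end

lemma integral_curve_form: "integral_curve F \<Longrightarrow> integral_form F (total_degree F)"
  by (simp add: integral_curve_def integral_form_def)

theorem corollary3p3p3:
  fixes B1 B2 B3 C :: poly3
  assumes "three_C_curve B1 B2 B3"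
    and "total_degree (B1 * B2 * B3) \<ge> 4"
    and "total_degree B1 \<le> total_degree B2" and "total_degree B2 \<le> total_degree B3"
    and "C \<in> Hyp (B1 * B2 * B3) 2"
  shows "total_degree C \<le> total_degree B3 \<and>
         total_degree C \<le> total_degree (B1 * B2 * B3) - 2"
proof -
  define F where "F i = (if i = 1 then B1 else if i = 2 then B2 else B3)" for i :: 3
  have F: "F 1 = B1" "F 2 = B2" "F 3 = B3" by (simp_all add: F_def)
  have "integral_curve B1" "integral_curve B2" "integral_curve B3" using assms(1) unfolding three_C_curve_def by blast+
  then have "integral_curve (F i)" for i by (simp add: F_def)
  then have F_int: "integral_form (F i) (total_degree (F i))" for i by (rule integral_curve_form)
  have "integral_curve C" using assms(5) unfolding Hyp_def by blast
  then have C_int: "integral_form C (total_degree C)" by (rule integral_curve_form)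
  have b0: "0 < total_degree (F i)" for i by (rule integral_form.d0[OF F_int])
  have hF: "homogeneous (total_degree (F i)) (F i)" for i by (rule integral_form.hom[OF F_int])
  have nz: "F i \<noteq> 0" for i using integral_form.irr[OF F_int] by (rule irreducible_nonzero)
  have pr: "(\<Prod>i\<in>UNIV. F i) = B1 * B2 * B3" unfolding prod_three F ..
  have "total_degree B1 \<le> total_degree B3" by (rule order_trans[OF assms(3,4)])
  then have le3: "total_degree (F i) \<le> total_degree B3" for i unfolding F_def using assms(4) by (cases "i = 1"; cases "i = 2") simp_all
  have sum: "total_degree (B1 * B2 * B3) = total_degree B1 + total_degree B2 + total_degree B3"
  proof (rule total_degree_eq)
    show "homogeneous (total_degree B1 + total_degree B2 + total_degree B3) (B1 * B2 * B3)"
      using homogeneous_mult[OF homogeneous_mult[OF hF[of 1] hF[of 2]] hF[of 3]] unfolding F .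
    show "B1 * B2 * B3 \<noteq> 0" using nz[of 1] nz[of 2] nz[of 3] unfolding F by simp
  qed
  have main: "total_degree C \<le> total_degree B3"
  \<comment> \<open>If \<open>C\<close> divides a component, the degrees compare directly. Otherwise
    Bezout applies to all three; lines are settled separately, because a point of PQ off
    \<open>C\<close> is only available from degree 2 on.\<close>
  proof (cases "\<exists>i. C dvd F i")
    case True
    then obtain i where "C dvd F i" ..
    then have "total_degree C \<le> total_degree (F i)" by (rule integral_form.dvd_form_degree[OF C_int _ hF nz])
    then show ?thesis using le3[of i] by (rule order_trans)
  next
    case nd: False
    show ?thesis
    proof (cases "2 \<le> total_degree C")
      case False
      then show ?thesis using b0[of 3] unfolding F by linarith
    next
      case True
      have node: "is_node (\<Prod>i\<in>UNIV. F i) (point v)"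
        if "i \<noteq> j" "v \<noteq> 0" "eval3 (F i) v = 0" "eval3 (F j) v = 0" for i j v
      proof -
        have "point v \<in> zero_locus (F i)" "point v \<in> zero_locus (F j)"
          unfolding point_zero_locus[OF hF that(2)] by (rule that)+
        then have "point v \<in> (zero_locus B1 \<inter> zero_locus B2) \<union> (zero_locus B1 \<inter> zero_locus B3) \<union> (zero_locus B2 \<inter> zero_locus B3)"
          using that(1) exhaust_3[of i] exhaust_3[of j] by - (elim disjE; simp add: F)
        then show ?thesis unfolding pr using assms(1) unfolding three_C_curve_def by blast
      qed
      have fib: "finite (normalization_preimage C (zero_locus C \<inter> zero_locus (\<Prod>i\<in>UNIV. F i)))"
        "card (normalization_preimage C (zero_locus C \<inter> zero_locus (\<Prod>i\<in>UNIV. F i))) \<le> 2"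
        using assms(5) unfolding Hyp_def pr by simp_all
      have "hyperbolic_curve C (total_degree C) F (\<lambda>i. total_degree (F i))"
        by (intro hyperbolic_curve.intro C_int hyperbolic_curve_axioms.intro True hF b0 fib) (use nd in blast, rule node)
      then have "\<exists>l. total_degree C \<le> total_degree (F l)"
        by (rule hyperbolic_curve.degree_le) (use assms(2) sum F in simp)
      then obtain l where "total_degree C \<le> total_degree (F l)" ..
      then show ?thesis using le3[of l] by (rule order_trans)
    qed
  qed
  moreover have "2 \<le> total_degree B1 + total_degree B2" using b0[of 1] b0[of 2] unfolding F by linarith
  ultimately show ?thesis unfolding sum by linarith
qed

end
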